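(* As formal power series in $q$ (equivalently, for $|q|<1$), $$\sum_{n=0}^\infty p_\nu(50n+8)q^n=5\left(\frac{E_{2}^{5}E_5^4}{E_1^{6}E_{10}^2}+160q\,\frac{E_2^{11}E_5^4}{E_1^{14}}+2000q^2\,\frac{E_2^{11}E_5^{10}}{E_1^{20}}\right).$$
   Context: For a positive integer $j$, $E_j:=(q^j;q^j)_\infty=\prod_{k\ge1}(1-q^{jk})$. The numbers $p_\nu(n)$ are defined by the generating function $\sum_{n=0}^\infty p_\nu(n)q^n=\nu(-q)=\sum_{n=0}^\infty \frac{q^{n(n+1)}}{(q;q^2)_{n+1}}$, where $\nu(q):=\sum_{n=0}^\infty \frac{q^{n(n+1)}}{(-q;q^2)_{n+1}}$ is the third order mock theta function and $(a;q)_n:=\prod_{k=0}^{n-1}(1-aq^k)$. Combinatorially, $p_\nu(n)$ is the number of partitions of $n$ into distinct nonnegative parts (so $0$ is allowed as a part, at most once) in which every odd part is less than twice the smallest part; for example $p_\nu(8)=5$. *)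

theory Defs
  imports "HOL-Analysis.Analysis" "HOL-Computational_Algebra.Computational_Algebra"
begin

text \<open>
  The definitions are polymorphic in the base \<open>q\<close>: it may be a complex number or a formal power
  series. In the latter case the infinite sum and product refer to the \<open>X\<close>-adic topology that the
  library puts on the type of formal power series.
\<close>

definition qpoch :: "'a :: comm_ring_1 \<Rightarrow> 'a \<Rightarrow> nat \<Rightarrow> 'a" where
  "qpoch a q n = (\<Prod>k<n. 1 - a * q ^ k)"

definition qpoch_inf :: "'a :: {comm_ring_1, t2_space} \<Rightarrow> 'a \<Rightarrow> 'a" where
  "qpoch_inf a q = (\<Prod>k. 1 - a * q ^ k)"

definition mock_nu :: "'a :: {comm_ring_1, inverse, t2_space} \<Rightarrow> 'a" where
  "mock_nu q = (\<Sum>n. q ^ (n * (n + 1)) / qpoch (- q) (q ^ 2) (n + 1))"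

text \<open>
  The numbers \<open>p_nu n\<close> and the coefficients of \<open>E j\<close> are integers; complex coefficients are used
  so that series can be divided and so that the library's analytic tools apply.
\<close>

definition p_nu :: "nat \<Rightarrow> complex" where
  "p_nu n = fps_nth (mock_nu (- fps_X)) n"

definition E :: "nat \<Rightarrow> complex fps" where
  "E j = qpoch_inf (fps_X ^ j) (fps_X ^ j)"

text \<open>
  Both \<open>suminf\<close> and \<open>prodinf\<close> are total, so it has to be checked that the sum and the
  products converge.
\<close>

lemma fps_sums_if_order:
  fixes f :: "nat \<Rightarrow> 'a :: ab_group_add fps"
  assumes "\<And>n k. k < n \<Longrightarrow> fps_nth (f n) k = 0"
  shows   "f sums Abs_fps (\<lambda>k. \<Sum>n\<le>k. fps_nth (f n) k)"
  unfolding sums_def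
proof (rule tendsto_fpsI)
  fix k :: nat
  show "eventually (\<lambda>N. fps_nth (sum f {..<N}) k =
          fps_nth (Abs_fps (\<lambda>k. \<Sum>n\<le>k. fps_nth (f n) k)) k) sequentially"
    using eventually_gt_at_top[of k]
  proof eventually_elim
    case (elim N)
    have "(\<Sum>n<N. fps_nth (f n) k) = (\<Sum>n\<le>k. fps_nth (f n) k)"
      using elim assms by (intro sum.mono_neutral_right) auto
    thus ?case by (simp add: fps_sum_nth)
  qed
qed

lemma qpoch_fps_nth_0 [simp]:
  fixes a q :: "'a :: field fps"
  assumes "fps_nth a 0 = 0"
  shows   "fps_nth (qpoch a q n) 0 = 1"
  unfolding qpoch_def using assms by (induction n) simp_all

lemma p_nu_sums:
  "(\<lambda>n. fps_X ^ (n * (n + 1)) / qpoch fps_X (fps_X ^ 2) (n + 1)) sums Abs_fps p_nu"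
proof -
  let ?f = "\<lambda>n. fps_X ^ (n * (n + 1)) / qpoch fps_X (fps_X ^ 2) (n + 1) :: complex fps"
  have "fps_nth (?f n) k = 0" if "k < n" for n k
  proof -
    have "?f n = fps_X ^ (n * (n + 1)) * inverse (qpoch fps_X (fps_X ^ 2) (n + 1))"
      by (intro fps_divide_unit) simp
    moreover have "k < n * (n + 1)"
      using that by (metis add_leD2 less_le_trans mult_Suc_right Suc_eq_plus1 le_add1)
    ultimately show ?thesis
      by (simp add: fps_X_power_mult_nth del: mult_Suc_right)
  qed
  hence "?f sums suminf ?f"
    by (intro summable_sums sums_summable[OF fps_sums_if_order])
  moreover have "suminf ?f = mock_nu (- fps_X)"
    unfolding mock_nu_def by (intro suminf_cong) (simp add: power_minus_even)
  moreover have "mock_nu (- fps_X) = Abs_fps p_nu"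
    by (simp add: fps_eq_iff p_nu_def)
  ultimately show ?thesis by simp
qed

lemma E_has_prod:
  assumes "j > 0"
  shows   "(\<lambda>k. 1 - fps_X ^ (j * (k + 1))) has_prod E j"
proof -
  let ?f = "\<lambda>k. 1 - fps_X ^ (j * (k + 1)) :: complex fps"
  have nth_0: "fps_nth (?f k) 0 = 1" for k
    using assms by simp
  have nz: "?f k \<noteq> 0" for k
    using nth_0[of k] by (metis fps_zero_nth zero_neq_one)
  have "subdegree (?f k - 1) > n" if "k > n" for n k :: nat
  proof -
    have "n < 1 * (k + 1)" using that by simp
    also have "\<dots> \<le> j * (k + 1)" using assms by (intro mult_right_mono) auto
    finally have "n < j * (k + 1)" .
    moreover have "?f k - 1 = - (fps_X ^ (j * (k + 1)))" by simp
    ultimately show ?thesis by (simp only: subdegree_uminus fps_X_power_subdegree)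
  qed
  from tendsto_prod_fps[of ?f "\<lambda>n. n", OF nz this]
  obtain P where P: "(\<lambda>n. \<Prod>k\<le>n. ?f k) \<longlonglongrightarrow> P" by blast
  from P have "eventually (\<lambda>n. fps_nth (\<Prod>k\<le>n. ?f k) 0 = fps_nth P 0) sequentially"
    unfolding tendsto_fps_iff by blast
  then obtain n where n: "fps_nth (\<Prod>k\<le>n. ?f k) 0 = fps_nth P 0"
    unfolding eventually_sequentially by blast
  have "fps_nth (\<Prod>k\<in>A. ?f k) 0 = 1" if "finite A" for A :: "nat set"
    using that
  proof induction
    case (insert k A)
    thus ?case using nth_0[of k] by (simp only: prod.insert [OF insert.hyps] fps_mult_nth_0 mult_1_left)
  qed simp
  from this[of "{..n}"] n have "fps_nth P 0 = 1" by simp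
  hence "P \<noteq> 0" by auto
  with P have prod: "?f has_prod P" by (simp add: has_prod_def raw_has_prod_def)
  have "fps_X ^ j * (fps_X ^ j) ^ k = (fps_X ^ (j * (k + 1)) :: complex fps)" for k
    by (simp add: power_add power_mult)
  hence "E j = prodinf ?f"
    unfolding E_def qpoch_inf_def by (simp only:)
  also have "\<dots> = P"
    by (rule has_prod_unique [OF prod, symmetric])
  finally show ?thesis using prod by (simp only:)
qed

end

theory Submission
  imports Defs
begin

text \<open>
  Let \<open>\<psi> = E\<^sub>2\<^sup>2/E\<^sub>1\<close> and \<open>\<phi> = E\<^sub>1\<^sup>2/E\<^sub>2\<close>, Ramanujan's theta functions \<open>\<psi>(q)\<close> and
  \<open>\<phi>(-q)\<close>, and let \<open>sect r\<close> pick the coefficients with index \<open>5n + r\<close>.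

  The mock theta function disappears at the first step. One has
  \<open>\<nu>(-q) = \<Sum>n\<ge>0. (-q;q\<^sup>2)\<^sub>n q\<^sup>n\<close>, and the terms of the same series at negative \<open>n\<close> add up to
  \<open>\<nu>(q)\<close>. So \<open>\<nu>(q) + \<nu>(-q)\<close>, twice the even part, is a bilateral series, an instance of
  Ramanujan's \<open>\<^sub>1\<psi>\<^sub>1\<close> summation, and it is a product: the numbers \<open>p_nu (2n)\<close> have the generating
  function \<open>E\<^sub>2\<^sup>3/E\<^sub>1\<^sup>2\<close> (\<open>even_part_nu_minus\<close>). As \<open>50n + 8 = 2(5(5n) + 4)\<close>, it remains to
  apply \<open>sect 4\<close> and then \<open>sect 0\<close> to this quotient.

  First dissection. \<open>E\<^sub>2\<^sup>3/E\<^sub>1\<^sup>2 = \<psi>\<^sup>2/E\<^sub>2\<close>. The denominator is made a series in \<open>q\<^sup>5\<close> by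
  multiplying with the conjugates \<open>E\<^sub>2(\<omega>q)\<close>, \<open>\<omega>\<close> a fifth root of unity, because the product of all
  conjugates is \<open>E\<^sub>1\<^sub>0\<^sup>6/E\<^sub>5\<^sub>0\<close> (\<open>norm5_E\<close>). The components of \<open>\<psi>\<close>, \<open>E\<^sub>1\<close> and \<open>E\<^sub>2\<close> are tied
  together by the components of the relation \<open>\<psi> E\<^sub>1 = E\<^sub>2\<^sup>2\<close>, which allow one to express everything
  by one parameter \<open>k\<close>; in terms of \<open>k\<close> the component of index 4 becomes a square
  (\<open>level_ten_identity\<close>), and it is the single quotient
  \<open>5 E\<^sub>2\<^sup>2 E\<^sub>5\<^sup>2 E\<^sub>1\<^sub>0/E\<^sub>1\<^sup>4\<close> (\<open>sect_4_even_part\<close>).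

  Second dissection. \<open>E\<^sub>5\<^sup>2 E\<^sub>1\<^sub>0\<close> is a series in \<open>q\<^sup>5\<close>, so only \<open>E\<^sub>2\<^sup>2/E\<^sub>1\<^sup>4 = 1/\<phi>\<^sup>2\<close> has to be
  dissected. By the conjugates of \<open>\<phi>\<close> its component of index 0 is a polynomial in
  \<open>T = \<phi>(-q)\<^sup>2/\<phi>(-q\<^sup>5)\<^sup>2\<close> over \<open>T\<^sup>6 \<phi>(-q\<^sup>5)\<^sup>2\<close>, namely
  \<open>T\<^sup>4 + 10 T\<^sup>2 (5 - T)(1 - T) + 125 (1 - T)\<^sup>2\<close> (\<open>sect_0_inverse_square\<close>). The factors \<open>1 - T\<close> and
  \<open>5 - T\<close> are themselves quotients of the \<open>E\<^sub>j\<close>, and the three summands of the polynomial become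
  the three summands of the theorem.

  Two identities are used for the squares of theta functions. The number of representations as a
  sum of two squares satisfies \<open>r\<^sub>2(5n) + r\<^sub>2(n/5) = 2 r\<^sub>2(n)\<close>, which yields
  \<open>\<phi>\<^sup>2 - \<phi>(-q\<^sup>5)\<^sup>2\<close> and \<open>\<psi>\<^sup>2 - q \<psi>(q\<^sup>5)\<^sup>2\<close> as products of two components; and these products are
  evaluated by the Jacobi triple product.
\<close>

section \<open>Congruences and infinite sums of formal power series\<close>

lemma fps_cancel_numeral: "numeral k * a = numeral k * b \<Longrightarrow> a = (b :: complex fps)"
  by simp

lemma fps_nth_numeral_mult: "fps_nth (numeral k * f) n = numeral k * fps_nth (f :: complex fps) n"
  by (simp add: numeral_fps_const)

text \<open>
  Congruence modulo \<open>X\<^sup>n\<close>. The basic identities between infinite products are proved modulo each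
  power of \<open>X\<close>, where the products are finite.
\<close>

definition fps_cong :: "nat \<Rightarrow> 'a::comm_ring_1 fps \<Rightarrow> 'a fps \<Rightarrow> bool" where
  "fps_cong n f g \<longleftrightarrow> (\<forall>i<n. fps_nth f i = fps_nth g i)"

lemma fps_cong_refl [simp]: "fps_cong n f f"
  by (simp add: fps_cong_def)

lemma fps_cong_sym: "fps_cong n f g \<Longrightarrow> fps_cong n g f"
  by (simp add: fps_cong_def)

lemma fps_cong_trans [trans]: "fps_cong n f g \<Longrightarrow> fps_cong n g h \<Longrightarrow> fps_cong n f h"
  by (simp add: fps_cong_def)

lemma fps_cong_mono: "fps_cong n f g \<Longrightarrow> m \<le> n \<Longrightarrow> fps_cong m f g"
  by (simp add: fps_cong_def)

lemma fps_cong_mult: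
  assumes "fps_cong n f g" "fps_cong n f' g'"
  shows   "fps_cong n (f * f') (g * g')"
  using assms unfolding fps_cong_def fps_mult_nth by (auto intro!: sum.cong)

lemma fps_cong_power: "fps_cong n f g \<Longrightarrow> fps_cong n (f ^ k) (g ^ k)"
  by (induction k) (simp_all add: fps_cong_mult)

lemma fps_cong_prod:
  "(\<And>x. x \<in> A \<Longrightarrow> fps_cong n (f x) (g x)) \<Longrightarrow> fps_cong n (prod f A) (prod g A)"
  by (induction A rule: infinite_finite_induct) (simp_all add: fps_cong_mult)

lemma fps_cong_X_power_mult:
  assumes "fps_cong m f g" "n \<le> k + m"
  shows   "fps_cong n (fps_X ^ k * f) (fps_X ^ k * g)"
  using assms by (auto simp: fps_cong_def fps_X_power_mult_nth)

lemma fps_cong_X_power_0: "n \<le> k \<Longrightarrow> fps_cong n (fps_X ^ k * f) 0"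
  by (simp add: fps_cong_def fps_X_power_mult_nth)

lemma fps_eqI_cong: "(\<And>n. fps_cong n f g) \<Longrightarrow> f = g"
  by (rule fps_ext) (meson fps_cong_def lessI)

lemma fps_cong_compose_X_power:
  "d > 0 \<Longrightarrow> fps_cong n f g \<Longrightarrow> fps_cong n (f oo fps_X ^ d) (g oo fps_X ^ d)"
  unfolding fps_cong_def fps_nth_compose_X_power
  by (metis div_le_dividend order_le_less_trans)

text \<open>
  A coefficient of a sum or a product depends on finitely many coefficients of the arguments, so the
  operations are continuous. The two instances make the general theory of \<open>has_sum\<close> applicable.
\<close>

instance fps :: (ab_group_add) topological_comm_monoid_add
proof
  fix a b :: "'a fps"
  have ev: "eventually (\<lambda>x. fps_nth x n = fps_nth a n) (nhds a)" for n and a :: "'a fps"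
    using filterlim_ident[of "nhds a"] unfolding tendsto_fps_iff by blast
  have *: "eventually (\<lambda>x. fps_nth (fst x) n = fps_nth a n \<and> fps_nth (snd x) n = fps_nth b n)
           (nhds a \<times>\<^sub>F nhds b)" for n
    by (rule eventually_prodI; rule ev)
  thus "filterlim (\<lambda>x. fst x + snd x) (nhds (a + b)) (nhds a \<times>\<^sub>F nhds b)"
    unfolding tendsto_fps_iff
  proof (intro allI)
    fix n
    show "eventually (\<lambda>x. fps_nth (fst x + snd x) n = fps_nth (a + b) n) (nhds a \<times>\<^sub>F nhds b)"
      using *[of n] by eventually_elim simp
  qed
qed

instance fps :: (comm_ring_1) topological_semigroup_mult
proof
  fix a b :: "'a fps"
  have "eventually (\<lambda>x. fps_nth x n = fps_nth a n) (nhds a)" for n and a :: "'a fps"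
    using filterlim_ident[of "nhds a"] unfolding tendsto_fps_iff by blast
  hence ev: "eventually (\<lambda>x. \<forall>i\<in>{..n}. fps_nth x i = fps_nth a i) (nhds a)"
    for n and a :: "'a fps"
    by (intro eventually_ball_finite) auto
  have *: "eventually (\<lambda>x. (\<forall>i\<in>{..n}. fps_nth (fst x) i = fps_nth a i) \<and>
           (\<forall>i\<in>{..n}. fps_nth (snd x) i = fps_nth b i)) (nhds a \<times>\<^sub>F nhds b)" for n
    by (rule eventually_prodI; rule ev)
  thus "filterlim (\<lambda>x. fst x * snd x) (nhds (a * b)) (nhds a \<times>\<^sub>F nhds b)"
    unfolding tendsto_fps_iff
  proof (intro allI)
    fix n
    show "eventually (\<lambda>x. fps_nth (fst x * snd x) n = fps_nth (a * b) n) (nhds a \<times>\<^sub>F nhds b)"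
      using *[of n] by eventually_elim (simp add: fps_mult_nth)
  qed
qed

lemma has_sum_cong_fps:
  fixes f g :: "'b \<Rightarrow> 'a::comm_ring_1 fps"
  assumes "(f has_sum s) A" "(g has_sum t) A" "\<And>x. x \<in> A \<Longrightarrow> fps_cong n (f x) (g x)"
  shows   "fps_cong n s t"
  unfolding fps_cong_def
proof (intro allI impI)
  fix i assume "i < n"
  hence "fps_nth (f x) i = fps_nth (g x) i" if "x \<in> A" for x
    using assms(3)[OF that] by (simp add: fps_cong_def)
  thus "fps_nth s i = fps_nth t i"
    unfolding has_sum_fpsD(2)[OF assms(1)] has_sum_fpsD(2)[OF assms(2)]
    by (intro sum.cong) auto
qed

lemma summable_on_fpsI:
  fixes f :: "'b \<Rightarrow> 'a::ab_group_add fps"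
  assumes "\<And>n. finite {x\<in>A. fps_nth (f x) n \<noteq> 0}"
  shows   "f summable_on A"
proof -
  have "(f has_sum Abs_fps (\<lambda>n. \<Sum>x | x \<in> A \<and> fps_nth (f x) n \<noteq> 0. fps_nth (f x) n)) A"
    by (rule has_sum_fpsI) (use assms in auto)
  thus ?thesis by (rule has_sum_imp_summable)
qed

lemma has_sum_compose_X_power:
  fixes f :: "'b \<Rightarrow> 'a::comm_ring_1 fps"
  assumes "(f has_sum s) A"
  shows   "((\<lambda>x. f x oo fps_X ^ d) has_sum (s oo fps_X ^ d)) A"
proof -
  have "eventually (\<lambda>F. fps_nth (sum f F oo fps_X ^ d) n = fps_nth (s oo fps_X ^ d) n)
          (finite_subsets_at_top A)" for n
  proof -
    have "eventually (\<lambda>F. fps_nth (sum f F) (n div d) = fps_nth s (n div d))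
            (finite_subsets_at_top A)"
      using assms unfolding has_sum_def tendsto_fps_iff by blast
    thus ?thesis by eventually_elim (simp add: fps_nth_compose_X_power)
  qed
  thus ?thesis
    by (simp add: has_sum_def tendsto_fps_iff fps_compose_sum_distrib)
qed

section \<open>Finite Euler products\<close>

definition euler_fin :: "nat \<Rightarrow> nat \<Rightarrow> complex fps" where
  "euler_fin j n = (\<Prod>k<n. 1 - fps_X ^ (j * (k + 1)))"

lemma fps_cong_one_minus: "n \<le> k \<Longrightarrow> fps_cong n (1 - fps_X ^ k) (1 :: complex fps)"
  by (simp add: fps_cong_def)

lemma prod_fps_cong_extend:
  fixes f :: "nat \<Rightarrow> complex fps"
  assumes "N \<le> M" "\<And>k. N \<le> k \<Longrightarrow> fps_cong d (f k) 1"
  shows   "fps_cong d (\<Prod>k<M. f k) (\<Prod>k<N. f k)"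
  using assms(1)
proof (induction M)
  case (Suc m)
  show ?case
  proof (cases "N = Suc m")
    case False
    hence "fps_cong d ((\<Prod>k<m. f k) * f m) ((\<Prod>k<N. f k) * 1)"
      using Suc assms(2) by (intro fps_cong_mult) auto
    thus ?thesis by simp
  qed auto
qed auto

lemma euler_fin_cong:
  assumes "j > 0" "N \<le> M"
  shows   "fps_cong (j * (N + 1)) (euler_fin j M) (euler_fin j N)"
  unfolding euler_fin_def using assms
  by (intro prod_fps_cong_extend fps_cong_one_minus) auto

lemma E_cong:
  assumes "j > 0" "d \<le> j * (N + 1)"
  shows   "fps_cong d (E j) (euler_fin j N)"
proof (rule fps_cong_mono[OF _ assms(2)], unfold fps_cong_def, intro allI impI)
  fix i assume i: "i < j * (N + 1)"
  have "(\<lambda>M. \<Prod>k\<le>M. 1 - fps_X ^ (j * (k + 1))) \<longlonglongrightarrow> E j"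
    using has_prod_imp_tendsto[OF E_has_prod[OF assms(1)]] .
  hence "eventually (\<lambda>M. fps_nth (\<Prod>k\<le>M. 1 - fps_X ^ (j * (k + 1))) i = fps_nth (E j) i) sequentially"
    unfolding tendsto_fps_iff by blast
  moreover have "eventually (\<lambda>M. M \<ge> N) sequentially"
    by (rule eventually_ge_at_top)
  ultimately have "eventually (\<lambda>M. M \<ge> N \<and>
      fps_nth (\<Prod>k\<le>M. 1 - fps_X ^ (j * (k + 1))) i = fps_nth (E j) i) sequentially"
    by eventually_elim auto
  then obtain M where M: "M \<ge> N" "fps_nth (\<Prod>k\<le>M. 1 - fps_X ^ (j * (k + 1))) i = fps_nth (E j) i"
    unfolding eventually_sequentially by blast
  have "fps_nth (E j) i = fps_nth (euler_fin j (Suc M)) i"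
    using M(2) by (simp add: euler_fin_def lessThan_Suc_atMost)
  also have "\<dots> = fps_nth (euler_fin j N) i"
    using euler_fin_cong[OF assms(1), of N "Suc M"] M(1) i by (simp add: fps_cong_def)
  finally show "fps_nth (E j) i = fps_nth (euler_fin j N) i" .
qed

lemma E_cong': "j > 0 \<Longrightarrow> d \<le> N + 1 \<Longrightarrow> fps_cong d (E j) (euler_fin j N)"
  using E_cong[of j d N] mult_le_mono1[of 1 j "N + 1"] by simp

lemma fps_nth_power_fps_X_0: "k > 0 \<Longrightarrow> fps_nth (fps_X ^ k) 0 = (0::complex)"
  by simp

lemma euler_fin_nth_0 [simp]: "j > 0 \<Longrightarrow> fps_nth (euler_fin j n) 0 = 1"
  unfolding euler_fin_def by (induction n) auto

lemma euler_fin_nonzero [simp]: "j > 0 \<Longrightarrow> euler_fin j n \<noteq> 0"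
  by (metis euler_fin_nth_0 fps_zero_nth zero_neq_one)

lemma euler_fin_Suc: "euler_fin j (Suc n) = euler_fin j n * (1 - fps_X ^ (j * (n + 1)))"
  by (simp add: euler_fin_def)

lemma E_nth_0 [simp]:
  assumes "j > 0" shows "fps_nth (E j) 0 = 1"
  using E_cong[OF assms, of 1 0] assms by (simp add: fps_cong_def euler_fin_def)

lemma E_nonzero [simp]: "j > 0 \<Longrightarrow> E j \<noteq> 0"
  by (metis E_nth_0 fps_zero_nth zero_neq_one)

text \<open>
  Substituting \<open>q\<^sup>d\<close> for \<open>q\<close>. This is used constantly to move between the levels 1, 2, 5 and 10.
\<close>

lemma E_compose_X_power:
  assumes "j > 0" "d > 0"
  shows   "E j oo fps_X ^ d = E (j * d)"
proof (rule fps_eqI_cong)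
  fix n
  have "euler_fin j n oo fps_X ^ d = euler_fin (j * d) n"
    unfolding euler_fin_def using assms
    by (simp add: fps_compose_prod_distrib fps_compose_sub_distrib
                  fps_X_power_compose fps_nth_power_fps_X_0 power_mult[symmetric] ac_simps)
  thus "fps_cong n (E j oo fps_X ^ d) (E (j * d))"
    using fps_cong_compose_X_power[OF assms(2) E_cong'[OF assms(1), of n n]]
          fps_cong_sym[OF E_cong'[of "j * d" n n]] assms
    by (auto intro: fps_cong_trans)
qed

section \<open>The Jacobi triple product\<close>

text \<open>
  The exponent is \<open>A k(k-1)/2 + B k\<close>, so that \<open>theta A B c\<close> is the bilateral sum of
  \<open>c\<^sup>k q\<^bsup>A k(k-1)/2 + B k\<^esup>\<close>: Ramanujan's \<open>f(a, b)\<close> with \<open>a = c q\<^sup>B\<close> and \<open>a b = q\<^sup>A\<close>.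
  For \<open>B \<le> A\<close> no exponent is negative.
\<close>

definition theta_exp :: "nat \<Rightarrow> nat \<Rightarrow> int \<Rightarrow> int" where
  "theta_exp A B k = int A * (k * (k - 1) div 2) + int B * k"

definition theta_term :: "nat \<Rightarrow> nat \<Rightarrow> complex \<Rightarrow> int \<Rightarrow> complex fps" where
  "theta_term A B c k = fps_const (c powi k) * fps_X ^ nat (theta_exp A B k)"

definition theta :: "nat \<Rightarrow> nat \<Rightarrow> complex \<Rightarrow> complex fps" where
  "theta A B c = infsum (theta_term A B c) UNIV"

lemma theta_exp_double: "2 * theta_exp A B k = int A * (k * (k - 1)) + 2 * int B * k"
proof -
  have "even (k * (k - 1))" by simp
  hence "2 * (k * (k - 1) div 2) = k * (k - 1)" by simp
  thus ?thesis unfolding theta_exp_def by (metis (no_types, lifting) distrib_left mult.left_commute mult.assoc)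
qed

lemma theta_exp_diff: "theta_exp A B k = theta_exp A B (k - 1) + int A * (k - 1) + int B"
proof -
  have "2 * theta_exp A B k = 2 * (theta_exp A B (k - 1) + int A * (k - 1) + int B)"
    unfolding distrib_left theta_exp_double by (simp add: algebra_simps)
  thus ?thesis by simp
qed

text \<open>
  The exponents grow at least linearly. The additive constant is needed: for \<open>A = 1\<close>,
  \<open>B = 0\<close> the exponent at \<open>k = 1\<close> is 0.
\<close>

lemma theta_exp_ge:
  assumes "A > 0" "B \<le> A"
  shows   "theta_exp A B k \<ge> \<bar>k\<bar> - 1"
proof -
  have *: "2 * theta_exp A B k = int A * (k * (k - 1)) + 2 * int B * k"
    by (rule theta_exp_double)
  show ?thesis
  proof (cases "k \<ge> 1")
    case True
    have "1 * (k * (k - 1)) \<le> int A * (k * (k - 1))"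
      using True assms by (intro mult_right_mono) auto
    moreover have "0 \<le> 2 * int B * k" using True by simp
    moreover have "0 \<le> (k - 1) * (k - 2)"
    proof (cases "k = 1")
      case False
      thus ?thesis using True by (intro mult_nonneg_nonneg) auto
    qed auto
    ultimately have "2 * theta_exp A B k \<ge> 2 * (k - 1)" using * by (simp add: algebra_simps)
    thus ?thesis using True by simp
  next
    case False
    have "int B * k \<ge> int A * k"
      using False assms by (intro mult_right_mono_neg) auto
    hence "2 * theta_exp A B k \<ge> int A * (k * (k + 1))"
      using * by (simp add: algebra_simps)
    moreover have "int A * (k * (k + 1)) \<ge> 1 * (k * (k + 1))"
    proof -
      have "k * (k + 1) \<ge> 0"
      proof (cases "k = 0")
        case False
        thus ?thesis using \<open>\<not> k \<ge> 1\<close> by (intro mult_nonpos_nonpos) auto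
      qed auto
      thus ?thesis using assms by (intro mult_right_mono) auto
    qed
    moreover have "(k + 1) * (k + 2) \<ge> 0"
    proof (cases "k \<in> {0,-1}")
      case False
      thus ?thesis using \<open>\<not> k \<ge> 1\<close> by (intro mult_nonpos_nonpos) auto
    qed auto
    ultimately have "2 * theta_exp A B k \<ge> 2 * (- k - 1)" by (simp add: algebra_simps)
    thus ?thesis using False by simp
  qed
qed

lemma theta_exp_nonneg:
  assumes "A > 0" "B \<le> A"
  shows   "theta_exp A B k \<ge> 0"
proof (cases "k = 0")
  case True
  thus ?thesis by (simp add: theta_exp_def)
next
  case False
  thus ?thesis using theta_exp_ge[OF assms, of k] by linarith
qed

lemma has_sum_theta:
  assumes "A > 0" "B \<le> A"
  shows   "(theta_term A B c has_sum theta A B c) UNIV"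
  unfolding theta_def
proof (intro has_sum_infsum summable_on_fpsI)
  fix n
  have "{k. fps_nth (theta_term A B c k) n \<noteq> 0} \<subseteq> {- int n - 1..int n + 1}"
  proof
    fix k assume "k \<in> {k. fps_nth (theta_term A B c k) n \<noteq> 0}"
    hence "nat (theta_exp A B k) = n"
      by (auto simp: theta_term_def split: if_splits)
    thus "k \<in> {- int n - 1..int n + 1}"
      using theta_exp_ge[OF assms, of k] by auto
  qed
  thus "finite {k \<in> UNIV. fps_nth (theta_term A B c k) n \<noteq> 0}"
    using finite_subset by auto
qed

text \<open>
  The Gaussian binomial coefficient to the base \<open>q\<^sup>A\<close>. The lower index is an integer and the value
  is 0 outside the range, so that the recurrences hold without boundary terms and finite sums can be
  written over all integers.
\<close>

definition qbinom :: "nat \<Rightarrow> nat \<Rightarrow> int \<Rightarrow> complex fps" where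
  "qbinom A N r = (if 0 \<le> r \<and> r \<le> int N
     then euler_fin A N * inverse (euler_fin A (nat r) * euler_fin A (N - nat r)) else 0)"

lemma qbinom_eqI:
  assumes "A > 0" "f * (euler_fin A r * euler_fin A (N - r)) = euler_fin A N" "r \<le> N"
  shows   "qbinom A N (int r) = f"
proof -
  let ?u = "euler_fin A r * euler_fin A (N - r)"
  have "qbinom A N (int r) = f * ?u * inverse ?u"
    using assms(2,3) by (simp add: qbinom_def)
  also have "\<dots> = f * (?u * inverse ?u)" by (simp only: mult.assoc)
  also have "?u * inverse ?u = 1" using assms(1) by (intro inverse_mult_eq_1') simp
  finally show ?thesis by simp
qed

lemma qbinom_mult:
  assumes "A > 0" "r \<le> N"
  shows   "qbinom A N (int r) * (euler_fin A r * euler_fin A (N - r)) = euler_fin A N"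
proof -
  let ?u = "euler_fin A r * euler_fin A (N - r)"
  have "qbinom A N (int r) * ?u = euler_fin A N * (inverse ?u * ?u)"
    using assms(2) by (simp add: qbinom_def mult.assoc)
  also have "inverse ?u * ?u = 1" using assms(1) by (intro inverse_mult_eq_1) simp
  finally show ?thesis by simp
qed

lemma qbinom_ends: "A > 0 \<Longrightarrow> qbinom A N 0 = 1" "A > 0 \<Longrightarrow> qbinom A N (int N) = 1"
  using qbinom_eqI[of A 1 0 N] qbinom_eqI[of A 1 N N] by (auto simp: euler_fin_def)

lemma qbinom_outside: "r < 0 \<or> r > int N \<Longrightarrow> qbinom A N r = 0"
  by (auto simp: qbinom_def)

text \<open>
  The two \<open>q\<close>-analogues of Pascal's rule; one serves to add a factor with \<open>q\<^sup>B\<close> to the finite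
  triple product, the other to add a factor with \<open>q\<^sup>-\<^sup>B\<close>.
\<close>

lemma qbinom_Suc:
  assumes "A > 0" "0 \<le> r" "r \<le> int N + 1"
  shows   "qbinom A (Suc N) r = qbinom A N r + fps_X ^ (A * nat (int N + 1 - r)) * qbinom A N (r - 1)"
    and   "qbinom A (Suc N) r = qbinom A N (r - 1) + fps_X ^ (A * nat r) * qbinom A N r"
proof -
  consider "r = 0" | "r = int N + 1" | s where "r = int (Suc s)" "Suc s \<le> N"
    using assms by (metis int_nat_eq nat_0_iff nat_eq_iff not0_implies_Suc of_nat_le_iff
        of_nat_Suc zle_add1_eq_le order_le_less add.commute linorder_not_less nat_int)
  hence "qbinom A (Suc N) r = qbinom A N r + fps_X ^ (A * nat (int N + 1 - r)) * qbinom A N (r - 1)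
     \<and> qbinom A (Suc N) r = qbinom A N (r - 1) + fps_X ^ (A * nat r) * qbinom A N r"
  proof cases
    case 1
    thus ?thesis using assms(1) by (simp add: qbinom_ends qbinom_outside)
  next
    case 2
    hence "r = int (Suc N)" by simp
    thus ?thesis using assms(1) 2 qbinom_ends(2)[of A "Suc N"]
      by (simp add: qbinom_ends qbinom_outside add.commute)
  next
    case (3 s)
    define m where "m = N - Suc s"
    have N: "N = m + Suc s" using 3 by (simp add: m_def)
    define P where "P = euler_fin A"
    have P: "P (Suc k) = P k * (1 - fps_X ^ (A * (k + 1)))" for k
      by (simp add: P_def euler_fin_Suc)
    have q1: "qbinom A N (int (Suc s)) * (P (Suc s) * P m) = P N"
      using qbinom_mult[of A "Suc s" N] assms(1) by (simp add: N P_def)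
    have q2: "qbinom A N (int s) * (P s * P (Suc m)) = P N"
      using qbinom_mult[of A s N] assms(1) by (simp add: N P_def)
    have e: "fps_X ^ (A * (Suc N + 1 - 1)) = fps_X ^ (A * (m + 1)) * (fps_X ^ (A * (s + 1)) :: complex fps)"
      by (simp add: N power_add[symmetric] algebra_simps)
    have PN: "P (Suc N) = P N * (1 - fps_X ^ (A * (m + 1)) * fps_X ^ (A * (s + 1)))"
      unfolding P using e by simp
    have "qbinom A (Suc N) (int (Suc s)) = qbinom A N (int (Suc s)) + fps_X ^ (A * (m + 1)) * qbinom A N (int s)"
    proof (rule qbinom_eqI[OF assms(1)])
      have "(qbinom A N (int (Suc s)) + fps_X ^ (A * (m + 1)) * qbinom A N (int s)) * (P (Suc s) * P (Suc m))
        = (qbinom A N (int (Suc s)) * (P (Suc s) * P m)) * (1 - fps_X ^ (A * (m + 1)))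
         + fps_X ^ (A * (m + 1)) * (qbinom A N (int s) * (P s * P (Suc m))) * (1 - fps_X ^ (A * (s + 1)))"
        unfolding P by (simp add: algebra_simps)
      also have "\<dots> = P (Suc N)"
        unfolding q1 q2 PN by (simp add: algebra_simps)
      finally show "(qbinom A N (int (Suc s)) + fps_X ^ (A * (m + 1)) * qbinom A N (int s)) *
        (euler_fin A (Suc s) * euler_fin A (Suc N - Suc s)) = euler_fin A (Suc N)"
        unfolding P_def by (simp add: N)
    qed (use 3 in auto)
    moreover have "qbinom A (Suc N) (int (Suc s)) = qbinom A N (int s) + fps_X ^ (A * (s + 1)) * qbinom A N (int (Suc s))"
    proof (rule qbinom_eqI[OF assms(1)])
      have "(qbinom A N (int s) + fps_X ^ (A * (s + 1)) * qbinom A N (int (Suc s))) * (P (Suc s) * P (Suc m))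
        = fps_X ^ (A * (s + 1)) * (qbinom A N (int (Suc s)) * (P (Suc s) * P m)) * (1 - fps_X ^ (A * (m + 1)))
         + (qbinom A N (int s) * (P s * P (Suc m))) * (1 - fps_X ^ (A * (s + 1)))"
        unfolding P by (simp add: algebra_simps)
      also have "\<dots> = P (Suc N)"
        unfolding q1 q2 PN by (simp add: algebra_simps)
      finally show "(qbinom A N (int s) + fps_X ^ (A * (s + 1)) * qbinom A N (int (Suc s))) *
        (euler_fin A (Suc s) * euler_fin A (Suc N - Suc s)) = euler_fin A (Suc N)"
        unfolding P_def by (simp add: N)
    qed (use 3 in auto)
    moreover have "nat (int N + 1 - r) = m + 1" "nat r = s + 1" "r - 1 = int s"
      using 3 by (auto simp: N)
    ultimately show ?thesis unfolding 3(1)[symmetric] by simp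
  qed
  thus "qbinom A (Suc N) r = qbinom A N r + fps_X ^ (A * nat (int N + 1 - r)) * qbinom A N (r - 1)"
    and "qbinom A (Suc N) r = qbinom A N (r - 1) + fps_X ^ (A * nat r) * qbinom A N r"
    by blast+
qed

lemma theta_term_shift:
  assumes "A > 0" "B \<le> A" "c \<noteq> 0" and m: "int m = theta_exp A B (k + 1) - theta_exp A B k + int d"
  shows   "fps_const c * fps_X ^ m * theta_term A B c k = fps_X ^ d * theta_term A B c (k + 1)"
proof -
  have n: "m + nat (theta_exp A B k) = d + nat (theta_exp A B (k + 1))"
    using m theta_exp_nonneg[OF assms(1,2), of k] theta_exp_nonneg[OF assms(1,2), of "k+1"] by linarith
  have "fps_const c * fps_X ^ m * theta_term A B c k
      = fps_const (c * c powi k) * fps_X ^ (m + nat (theta_exp A B k))"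
    by (simp add: theta_term_def power_add ac_simps flip: fps_const_mult)
  also have "c * c powi k = c powi (k + 1)"
    using assms(3) by (simp add: power_int_add)
  finally show ?thesis
    unfolding n by (simp add: theta_term_def power_add ac_simps)
qed

lemma theta_term_shift':
  assumes "A > 0" "B \<le> A" "c \<noteq> 0" and m: "int m = theta_exp A B (k - 1) - theta_exp A B k + int d"
  shows   "fps_const (1 / c) * fps_X ^ m * theta_term A B c k = fps_X ^ d * theta_term A B c (k - 1)"
proof -
  have n: "m + nat (theta_exp A B k) = d + nat (theta_exp A B (k - 1))"
    using m theta_exp_nonneg[OF assms(1,2), of k] theta_exp_nonneg[OF assms(1,2), of "k-1"] by linarith
  have "fps_const (1 / c) * fps_X ^ m * theta_term A B c k
      = fps_const (1 / c * c powi k) * fps_X ^ (m + nat (theta_exp A B k))"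
    unfolding theta_term_def fps_const_mult[symmetric] by (simp add: power_add ac_simps)
  also have "1 / c * c powi k = c powi (k - 1)"
    using assms(3) by (simp add: power_int_diff)
  finally show ?thesis
    unfolding n by (simp add: theta_term_def power_add ac_simps)
qed

text \<open>
  Multiplying by one more factor adds to the coefficient at \<open>k\<close> a shifted copy of its neighbour, which
  is Pascal's rule because consecutive exponents differ by \<open>A k + B\<close>.
\<close>

lemma finite_jacobi_triple_product:
  assumes AB: "A > 0" "B \<le> A" and c: "c \<noteq> 0"
  shows   "((\<lambda>k. theta_term A B c k * qbinom A (a + b) (int a + k)) has_sum
             (\<Prod>i<b. 1 + fps_const c * fps_X ^ (A * i + B)) *
             (\<Prod>i<a. 1 + fps_const (1 / c) * fps_X ^ (A * (i + 1) - B))) UNIV"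
proof (induction a)
  case 0
  show ?case
  proof (induction b)
    case 0
    show ?case
      by (rule has_sum_finite_neutralI[of "{0}"])
         (auto simp: qbinom_def theta_term_def theta_exp_def euler_fin_def)
  next
    case (Suc b)
    let ?F = "\<lambda>k. theta_term A B c k * qbinom A b k"
    let ?P = "\<Prod>i<b. 1 + fps_const c * fps_X ^ (A * i + B)"
    let ?g = "fps_const c * fps_X ^ (A * b + B)"
    have F: "(?F has_sum ?P) UNIV" using Suc by simp
    have "((\<lambda>k. ?F (k - 1)) has_sum ?P) UNIV"
      using F by (subst has_sum_reindex_bij_witness[of UNIV "\<lambda>k. k + 1" "\<lambda>k. k - 1" UNIV ?F _ ?P ?P]) auto
    hence "((\<lambda>k. ?F k + ?g * ?F (k - 1)) has_sum (?P + ?g * ?P)) UNIV"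
      using F by (intro has_sum_add has_sum_cmult_right)
    moreover have "?F k + ?g * ?F (k - 1) = theta_term A B c k * qbinom A (Suc b) k" for k
    proof (cases "0 \<le> k \<and> k \<le> int b + 1")
      case True
      have "?g * theta_term A B c (k - 1) = fps_X ^ (A * nat (int b + 1 - k)) * theta_term A B c k"
        using theta_term_shift[OF AB c, of "A * b + B" "k - 1" "A * nat (int b + 1 - k)"] True
          theta_exp_diff[of A B k] by (simp add: algebra_simps)
      hence "?F k + ?g * ?F (k - 1) = theta_term A B c k *
          (qbinom A b k + fps_X ^ (A * nat (int b + 1 - k)) * qbinom A b (k - 1))"
        by (simp add: algebra_simps)
      thus ?thesis using qbinom_Suc(1)[of A k b] True AB by simp
    qed (auto simp: qbinom_outside)
    ultimately show ?case by (simp add: algebra_simps)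
  qed
next
  case (Suc a)
  let ?F = "\<lambda>k. theta_term A B c k * qbinom A (a + b) (int a + k)"
  let ?P = "(\<Prod>i<b. 1 + fps_const c * fps_X ^ (A * i + B)) *
             (\<Prod>i<a. 1 + fps_const (1 / c) * fps_X ^ (A * (i + 1) - B))"
  let ?g = "fps_const (1 / c) * fps_X ^ (A * (a + 1) - B)"
  have F: "(?F has_sum ?P) UNIV" by (rule Suc)
  have "((\<lambda>k. ?F (k + 1)) has_sum ?P) UNIV"
    using F by (subst has_sum_reindex_bij_witness[of UNIV "\<lambda>k. k - 1" "\<lambda>k. k + 1" UNIV ?F _ ?P ?P]) auto
  hence "((\<lambda>k. ?F k + ?g * ?F (k + 1)) has_sum (?P + ?g * ?P)) UNIV"
    using F by (intro has_sum_add has_sum_cmult_right)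
  moreover have "?F k + ?g * ?F (k + 1) = theta_term A B c k * qbinom A (Suc a + b) (int (Suc a) + k)" for k
  proof (cases "0 \<le> int a + 1 + k \<and> int a + 1 + k \<le> int (a + b) + 1")
    case True
    have "B \<le> A * (a + 1)" using AB by (metis le_trans mult_le_mono2 nat_mult_1_right le_add2)
    hence "int (A * (a + 1) - B) = int A * (int a + 1) - int B" by (simp add: of_nat_diff algebra_simps)
    hence "?g * theta_term A B c (k + 1) = fps_X ^ (A * nat (int a + 1 + k)) * theta_term A B c k"
      using theta_term_shift'[OF AB c, of "A * (a + 1) - B" "k + 1" "A * nat (int a + 1 + k)"] True
        theta_exp_diff[of A B "k + 1"] by (simp add: algebra_simps)
    hence "?F k + ?g * ?F (k + 1) = theta_term A B c k *
        (qbinom A (a + b) (int a + k) + fps_X ^ (A * nat (int a + 1 + k)) * qbinom A (a + b) (int a + 1 + k))"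
      by (simp add: algebra_simps)
    thus ?thesis using qbinom_Suc(2)[of A "int a + 1 + k" "a + b"] True AB by (simp add: add_ac)
  qed (auto simp: qbinom_outside)
  ultimately show ?case by (simp add: algebra_simps)
qed

text \<open>
  The \<open>q\<close>-binomial coefficient with large entries tends to \<open>1/E\<^sub>A\<close>.
\<close>

lemma E_qbinom_cong:
  assumes "A > 0" "\<bar>k\<bar> \<le> int n" "int d = int n - \<bar>k\<bar> + 1"
  shows   "fps_cong d (E A * qbinom A (n + n) (int n + k)) 1"
proof -
  define r where "r = nat (int n + k)"
  have r: "int n + k = int r" "r \<le> 2 * n" "d \<le> r + 1" "d \<le> 2 * n - r + 1" "d \<le> 2 * n + 1"
    using assms unfolding r_def by linarith+
  let ?u = "euler_fin A r * euler_fin A (2 * n - r)"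
  have c: "fps_cong d (E A) (euler_fin A r)" "fps_cong d (E A) (euler_fin A (2 * n - r))"
    "fps_cong d (E A) (euler_fin A (2 * n))"
    using r assms(1) by (intro E_cong'; simp)+
  hence "fps_cong d (E A * euler_fin A (2 * n)) ?u"
    by (intro fps_cong_mult[OF c(1)] fps_cong_trans[OF fps_cong_sym[OF c(3)] c(2)])
  hence "fps_cong d (E A * euler_fin A (2 * n) * inverse ?u) (?u * inverse ?u)"
    by (rule fps_cong_mult[OF _ fps_cong_refl])
  moreover have "?u * inverse ?u = 1" using assms(1) by (intro inverse_mult_eq_1') simp
  moreover have "qbinom A (n + n) (int r) = euler_fin A (2 * n) * inverse ?u"
    unfolding mult_2[of n, symmetric] qbinom_def using r(2) by (subst if_P) simp_all
  ultimately show ?thesis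
    unfolding r(1) by (simp only: mult.assoc)
qed

text \<open>
  The limit of the finite form. For \<open>\<bar>k\<bar> \<le> n\<close> the \<open>q\<close>-binomial coefficient contributes an error of order
  \<open>n - \<bar>k\<bar> + 1\<close> and the theta term has order at least \<open>\<bar>k\<bar> - 1\<close>, so the total error has order at
  least \<open>n\<close>.
\<close>

lemma jacobi_triple_product:
  assumes AB: "A > 0" "B \<le> A" and c: "c \<noteq> 0"
  shows   "fps_cong n (theta A B c) (E A * ((\<Prod>i<n. 1 + fps_const c * fps_X ^ (A * i + B)) *
             (\<Prod>i<n. 1 + fps_const (1 / c) * fps_X ^ (A * (i + 1) - B))))"
proof (rule has_sum_cong_fps)
  show "(theta_term A B c has_sum theta A B c) UNIV"
    by (rule has_sum_theta) fact+
  show "((\<lambda>k. E A * (theta_term A B c k * qbinom A (n + n) (int n + k))) has_sum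
    E A * ((\<Prod>i<n. 1 + fps_const c * fps_X ^ (A * i + B)) *
             (\<Prod>i<n. 1 + fps_const (1 / c) * fps_X ^ (A * (i + 1) - B)))) UNIV"
    by (intro has_sum_cmult_right finite_jacobi_triple_product assms)
  fix k :: int
  have *: "theta_exp A B k \<ge> \<bar>k\<bar> - 1" by (rule theta_exp_ge) fact+
  show "fps_cong n (theta_term A B c k) (E A * (theta_term A B c k * qbinom A (n + n) (int n + k)))"
  proof (cases "\<bar>k\<bar> \<le> int n")
    case True
    define d where "d = nat (int n - \<bar>k\<bar> + 1)"
    have "fps_cong d (E A * qbinom A (n + n) (int n + k)) 1"
      using True by (intro E_qbinom_cong AB) (auto simp: d_def)
    hence "fps_cong n (fps_X ^ nat (theta_exp A B k) * (E A * qbinom A (n + n) (int n + k)))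
             (fps_X ^ nat (theta_exp A B k) * 1)"
      by (rule fps_cong_X_power_mult) (use True * in \<open>auto simp: d_def\<close>)
    hence "fps_cong n (fps_const (c powi k) * (fps_X ^ nat (theta_exp A B k) * (E A * qbinom A (n + n) (int n + k))))
             (fps_const (c powi k) * (fps_X ^ nat (theta_exp A B k) * 1))"
      by (rule fps_cong_mult[OF fps_cong_refl])
    also have "fps_const (c powi k) * (fps_X ^ nat (theta_exp A B k) * (E A * qbinom A (n + n) (int n + k)))
        = E A * (theta_term A B c k * qbinom A (n + n) (int n + k))"
      by (simp add: theta_term_def ac_simps)
    finally show ?thesis by (simp add: theta_term_def fps_cong_sym)
  next
    case False
    hence "fps_cong n (fps_X ^ nat (theta_exp A B k) * fps_const (c powi k)) 0"
      using * by (intro fps_cong_X_power_0) linarith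
    moreover have "qbinom A (n + n) (int n + k) = 0"
      using False by (intro qbinom_outside) auto
    ultimately show ?thesis by (simp add: theta_term_def mult.commute)
  qed
qed

section \<open>Product forms of the theta series\<close>

text \<open>
  The truncated product \<open>(-c q\<^sup>B; q\<^sup>A)\<^sub>n\<close>.
\<close>

definition lin_prod :: "complex \<Rightarrow> nat \<Rightarrow> nat \<Rightarrow> nat \<Rightarrow> complex fps" where
  "lin_prod c A B n = (\<Prod>i<n. 1 + fps_const c * fps_X ^ (A * i + B))"

lemma lin_prod_Suc: "lin_prod c A B (Suc n) = lin_prod c A B n * (1 + fps_const c * fps_X ^ (A * n + B))"
  by (simp add: lin_prod_def)

lemma lin_prod_0 [simp]: "lin_prod c A B 0 = 1"
  by (simp add: lin_prod_def)

lemma lin_prod_nth_0: "B > 0 \<Longrightarrow> fps_nth (lin_prod c A B n) 0 = 1"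
  by (induction n) (simp_all add: lin_prod_Suc)

lemma euler_fin_conv_lin_prod: "euler_fin j n = lin_prod (-1) j j n"
  unfolding euler_fin_def lin_prod_def
  by (intro prod.cong) (auto simp flip: fps_const_neg)

lemma E_cong_lin_prod: "j > 0 \<Longrightarrow> d \<le> N + 1 \<Longrightarrow> fps_cong d (E j) (lin_prod (-1) j j N)"
  using E_cong' by (simp add: euler_fin_conv_lin_prod)

lemma lin_prod_group: "lin_prod c A B (n * m) = (\<Prod>r<m. lin_prod c (A * m) (A * r + B) n)"
proof (induction n)
  case (Suc n)
  have "lin_prod c A B (N + m) = lin_prod c A B N * (\<Prod>r<m. 1 + fps_const c * fps_X ^ (A * (N + r) + B))" for N
    by (induction m) (simp_all add: lin_prod_Suc mult.assoc)
  from this[of "n * m"] have "lin_prod c A B (Suc n * m) = lin_prod c A B (n * m) *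
      (\<Prod>r<m. 1 + fps_const c * fps_X ^ (A * (n * m + r) + B))"
    by (simp add: add.commute)
  also have "\<dots> = (\<Prod>r<m. lin_prod c (A * m) (A * r + B) n *
        (1 + fps_const c * fps_X ^ (A * m * n + (A * r + B))))"
    unfolding Suc.IH prod.distrib by (simp add: algebra_simps)
  finally show ?case by (simp only: lin_prod_Suc)
qed simp

lemma prod_lt_2: "(\<Prod>i<2. f i) = f 0 * f (1::nat)"
  by (simp add: numeral_2_eq_2)

lemma lin_prod_conj: "lin_prod c A B n * lin_prod (- c) A B n = lin_prod (- (c * c)) (2 * A) (2 * B) n"
  unfolding lin_prod_def prod.distrib[symmetric]
proof (intro prod.cong refl)
  fix i
  have "(fps_X ^ (A * i + B)) * (fps_X ^ (A * i + B)) = (fps_X ^ (2 * A * i + 2 * B) :: complex fps)"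
    unfolding power_add[symmetric] by (intro arg_cong[of _ _ "power fps_X"]) simp
  thus "(1 + fps_const c * fps_X ^ (A * i + B)) * (1 + fps_const (- c) * fps_X ^ (A * i + B)) =
         1 + fps_const (- (c * c)) * fps_X ^ (2 * A * i + 2 * B)"
    by (simp add: algebra_simps flip: fps_const_neg fps_const_mult)
qed

lemma theta_cong_lin_prod:
  assumes "A > 0" "B \<le> A" "c * c = 1"
  shows   "fps_cong n (theta A B c) (E A * (lin_prod c A B n * lin_prod c A (A - B) n))"
proof -
  have "A * (i + 1) - B = A * i + (A - B)" for i using assms by simp
  moreover have c: "c \<noteq> 0" using assms(3) by auto
  moreover have "1 / c = c" using assms(3) c by (simp add: divide_eq_eq)
  ultimately show ?thesis
    using jacobi_triple_product[of A B c n] assms by (simp add: lin_prod_def)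
qed

lemma theta_reflect:
  assumes "A > 0" "B \<le> A" "c * c = 1"
  shows   "theta A (A - B) c = theta A B c"
proof (rule fps_eqI_cong)
  fix n
  have "fps_cong n (theta A B c) (E A * (lin_prod c A B n * lin_prod c A (A - B) n))"
    by (rule theta_cong_lin_prod) fact+
  moreover have "fps_cong n (theta A (A - B) c) (E A * (lin_prod c A (A - B) n * lin_prod c A B n))"
    using theta_cong_lin_prod[of A "A - B" c n] assms by simp
  ultimately show "fps_cong n (theta A (A - B) c) (theta A B c)"
    by (simp add: fps_cong_def mult.commute)
qed

text \<open>
  Euler's pentagonal number theorem.
\<close>

lemma theta_3_1: "theta 3 1 (-1) = E 1"
proof (rule fps_eqI_cong)
  fix n
  have "fps_cong n (theta 3 1 (-1)) (E 3 * (lin_prod (-1) 3 1 n * lin_prod (-1) 3 2 n))"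
    using theta_cong_lin_prod[of 3 1 "-1" n] by simp
  moreover have "fps_cong n (E 3 * (lin_prod (-1) 3 1 n * lin_prod (-1) 3 2 n))
     (lin_prod (-1) 3 3 n * (lin_prod (-1) 3 1 n * lin_prod (-1) 3 2 n))"
    by (intro fps_cong_mult E_cong_lin_prod fps_cong_refl) auto
  moreover have "lin_prod (-1) 3 3 n * (lin_prod (-1) 3 1 n * lin_prod (-1) 3 2 n) = lin_prod (-1) 1 1 (n * 3)"
    unfolding lin_prod_group by (simp add: numeral_3_eq_3 numeral_2_eq_2 mult.commute)
  moreover have "fps_cong n (E 1) (lin_prod (-1) 1 1 (n * 3))"
    by (intro E_cong_lin_prod) auto
  ultimately show "fps_cong n (theta 3 1 (-1)) (E 1)"
    by (metis fps_cong_sym fps_cong_trans)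
qed

text \<open>
  Gauss's series for the triangular numbers; the exponents \<open>k(k-1)/2\<close> list each triangular number
  twice, which explains the factor 2.
\<close>

lemma theta_1_0: "theta 1 0 1 * E 1 = 2 * E 2 ^ 2"
proof (rule fps_eqI_cong)
  fix n
  have "lin_prod 1 1 0 n * (1 + fps_X ^ n) = 2 * lin_prod 1 1 1 n"
    by (induction n) (simp_all add: lin_prod_Suc algebra_simps)
  moreover have "fps_cong n (lin_prod 1 1 0 n * (1 + fps_X ^ n)) (lin_prod 1 1 0 n * 1)"
    by (intro fps_cong_mult fps_cong_refl) (simp add: fps_cong_def)
  ultimately have c: "fps_cong n (lin_prod 1 1 0 n) (2 * lin_prod 1 1 1 n)"
    by (simp add: fps_cong_sym)
  have "fps_cong n (theta 1 0 1 * E 1) (E 1 * (lin_prod 1 1 0 n * lin_prod 1 1 1 n) * E 1)"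
    using theta_cong_lin_prod[of 1 0 1 n] by (intro fps_cong_mult fps_cong_refl) auto
  moreover have "fps_cong n (E 1 * (lin_prod 1 1 0 n * lin_prod 1 1 1 n) * E 1)
     (lin_prod (-1) 1 1 n * (2 * lin_prod 1 1 1 n * lin_prod 1 1 1 n) * lin_prod (-1) 1 1 n)"
    by (intro fps_cong_mult E_cong_lin_prod fps_cong_refl c) auto
  moreover have "lin_prod (-1) 1 1 n * (2 * lin_prod 1 1 1 n * lin_prod 1 1 1 n) * lin_prod (-1) 1 1 n
      = 2 * (lin_prod 1 1 1 n * lin_prod (-1) 1 1 n) ^ 2"
    by (simp add: power2_eq_square)
  moreover have "\<dots> = 2 * lin_prod (-1) 2 2 n ^ 2"
    unfolding lin_prod_conj by simp
  moreover have "fps_cong n (2 * lin_prod (-1) 2 2 n ^ 2) (2 * E 2 ^ 2)"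
    by (intro fps_cong_mult fps_cong_power fps_cong_sym[OF E_cong_lin_prod]) auto
  ultimately show "fps_cong n (theta 1 0 1 * E 1) (2 * E 2 ^ 2)"
    by (metis fps_cong_trans)
qed

text \<open>
  Gauss's series with square exponents.
\<close>

lemma theta_2_1: "theta 2 1 (-1) * E 2 = E 1 ^ 2"
proof (rule fps_eqI_cong)
  fix n
  have "fps_cong n (theta 2 1 (-1) * E 2) (E 2 * (lin_prod (-1) 2 1 n * lin_prod (-1) 2 1 n) * E 2)"
    using theta_cong_lin_prod[of 2 1 "-1" n] by (intro fps_cong_mult fps_cong_refl) auto
  moreover have "fps_cong n (E 2 * (lin_prod (-1) 2 1 n * lin_prod (-1) 2 1 n) * E 2)
     (lin_prod (-1) 2 2 n * (lin_prod (-1) 2 1 n * lin_prod (-1) 2 1 n) * lin_prod (-1) 2 2 n)"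
    by (intro fps_cong_mult E_cong_lin_prod fps_cong_refl) auto
  moreover have "lin_prod (-1) 2 2 n * (lin_prod (-1) 2 1 n * lin_prod (-1) 2 1 n) * lin_prod (-1) 2 2 n
     = lin_prod (-1) 1 1 (n * 2) ^ 2"
    unfolding lin_prod_group by (simp add: numeral_2_eq_2 power2_eq_square algebra_simps)
  moreover have "fps_cong n (lin_prod (-1) 1 1 (n * 2) ^ 2) (E 1 ^ 2)"
    by (intro fps_cong_power fps_cong_sym[OF E_cong_lin_prod]) auto
  ultimately show "fps_cong n (theta 2 1 (-1) * E 2) (E 1 ^ 2)"
    by (metis fps_cong_trans)
qed

text \<open>
  The four families of factors run through the residues 1, 2, 3, 4 modulo 5. Completed by residue 0
  they give all of \<open>(-q;q)\<^sub>\<infinity> = E\<^sub>2/E\<^sub>1\<close>.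
\<close>

lemma theta_5_prod: "theta 5 2 1 * theta 5 1 1 * (E 10 * E 1) = E 5 ^ 3 * E 2"
proof (rule fps_eqI_cong)
  fix n
  let ?P = "lin_prod 1 5"
  have c0: "fps_cong n (theta 5 2 1 * theta 5 1 1 * (E 10 * E 1))
     (E 5 * (?P 2 n * ?P 3 n) * (E 5 * (?P 1 n * ?P 4 n)) * (lin_prod (-1) 10 10 n * lin_prod (-1) 1 1 (n * 5)))"
    using theta_cong_lin_prod[of 5 2 1 n] theta_cong_lin_prod[of 5 1 1 n]
    by (intro fps_cong_mult E_cong_lin_prod) auto
  have h1: "lin_prod (-1) 10 10 n = ?P 5 n * lin_prod (-1) 5 5 n"
    unfolding lin_prod_conj by simp
  have h2: "?P 2 n * ?P 3 n * (?P 1 n * ?P 4 n) * ?P 5 n = lin_prod 1 1 1 (n * 5)"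
    unfolding lin_prod_group by (simp add: eval_nat_numeral algebra_simps)
  have h3: "lin_prod 1 1 1 (n * 5) * lin_prod (-1) 1 1 (n * 5) = lin_prod (-1) 2 2 (n * 5)"
    unfolding lin_prod_conj by simp
  have "E 5 * (?P 2 n * ?P 3 n) * (E 5 * (?P 1 n * ?P 4 n)) * (lin_prod (-1) 10 10 n * lin_prod (-1) 1 1 (n * 5))
      = E 5 ^ 2 * lin_prod (-1) 5 5 n * (?P 2 n * ?P 3 n * (?P 1 n * ?P 4 n) * ?P 5 n * lin_prod (-1) 1 1 (n * 5))"
    unfolding h1 by (simp only: power2_eq_square mult_ac)
  also have "\<dots> = E 5 ^ 2 * lin_prod (-1) 5 5 n * lin_prod (-1) 2 2 (n * 5)"
    unfolding h2 h3 ..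
  finally have "fps_cong n (theta 5 2 1 * theta 5 1 1 * (E 10 * E 1))
     (E 5 ^ 2 * lin_prod (-1) 5 5 n * lin_prod (-1) 2 2 (n * 5))"
    using c0 by (simp only:)
  also have "fps_cong n (E 5 ^ 2 * lin_prod (-1) 5 5 n * lin_prod (-1) 2 2 (n * 5)) (E 5 ^ 2 * E 5 * E 2)"
    by (intro fps_cong_mult fps_cong_refl fps_cong_sym[OF E_cong_lin_prod]) auto
  also have "E 5 ^ 2 * E 5 * E 2 = E 5 ^ 3 * E 2"
    by (simp add: power2_eq_square power3_eq_cube)
  finally show "fps_cong n (theta 5 2 1 * theta 5 1 1 * (E 10 * E 1)) (E 5 ^ 3 * E 2)" .
qed

text \<open>
  Here the factors run through the odd residues modulo 10 except 5, and completed by 5 they give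
  \<open>(q;q\<^sup>2)\<^sub>\<infinity> = E\<^sub>1/E\<^sub>2\<close>.
\<close>

lemma theta_10_prod: "theta 10 3 (-1) * theta 10 1 (-1) * (E 5 * E 2) = E 10 ^ 3 * E 1"
proof (rule fps_eqI_cong)
  fix n
  let ?P = "lin_prod (-1) 10"
  have c0: "fps_cong n (theta 10 3 (-1) * theta 10 1 (-1) * (E 5 * E 2))
     (E 10 * (?P 3 n * ?P 7 n) * (E 10 * (?P 1 n * ?P 9 n)) * (lin_prod (-1) 5 5 (n * 2) * lin_prod (-1) 2 2 (n * 5)))"
    using theta_cong_lin_prod[of 10 3 "-1" n] theta_cong_lin_prod[of 10 1 "-1" n]
    by (intro fps_cong_mult E_cong_lin_prod) auto
  have h1: "lin_prod (-1) 5 5 (n * 2) = ?P 5 n * ?P 10 n"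
    unfolding lin_prod_group by (simp add: numeral_2_eq_2)
  have h2: "?P 3 n * ?P 7 n * (?P 1 n * ?P 9 n) * ?P 5 n = lin_prod (-1) 2 1 (n * 5)"
    unfolding lin_prod_group by (simp add: eval_nat_numeral algebra_simps)
  have h3: "lin_prod (-1) 2 1 (n * 5) * lin_prod (-1) 2 2 (n * 5) = lin_prod (-1) 1 1 (n * 5 * 2)"
    unfolding lin_prod_group[of "-1" 1 1 "n * 5" 2] by (simp add: numeral_2_eq_2)
  have "E 10 * (?P 3 n * ?P 7 n) * (E 10 * (?P 1 n * ?P 9 n)) * (lin_prod (-1) 5 5 (n * 2) * lin_prod (-1) 2 2 (n * 5))
      = E 10 ^ 2 * ?P 10 n * (?P 3 n * ?P 7 n * (?P 1 n * ?P 9 n) * ?P 5 n * lin_prod (-1) 2 2 (n * 5))"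
    unfolding h1 by (simp only: power2_eq_square mult_ac)
  also have "\<dots> = E 10 ^ 2 * ?P 10 n * lin_prod (-1) 1 1 (n * 5 * 2)"
    unfolding h2 h3 ..
  finally have "fps_cong n (theta 10 3 (-1) * theta 10 1 (-1) * (E 5 * E 2))
     (E 10 ^ 2 * ?P 10 n * lin_prod (-1) 1 1 (n * 5 * 2))"
    using c0 by (simp only:)
  also have "fps_cong n (E 10 ^ 2 * ?P 10 n * lin_prod (-1) 1 1 (n * 5 * 2)) (E 10 ^ 2 * E 10 * E 1)"
    by (intro fps_cong_mult fps_cong_refl fps_cong_sym[OF E_cong_lin_prod]) auto
  also have "E 10 ^ 2 * E 10 * E 1 = E 10 ^ 3 * E 1"
    by (simp add: power2_eq_square power3_eq_cube)
  finally show "fps_cong n (theta 10 3 (-1) * theta 10 1 (-1) * (E 5 * E 2)) (E 10 ^ 3 * E 1)" .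
qed

definition psi :: "complex fps" where "psi = E 2 ^ 2 / E 1"
definition phi :: "complex fps" where "phi = E 1 ^ 2 / E 2"

lemma psi_E1: "psi * E 1 = E 2 ^ 2"
  unfolding psi_def by (intro dvd_div_mult_self) simp

lemma phi_E2: "phi * E 2 = E 1 ^ 2"
  unfolding phi_def by (intro dvd_div_mult_self) simp

lemma theta_psi: "theta 1 0 1 = 2 * psi"
proof -
  have "theta 1 0 1 * E 1 = (2 * psi) * E 1"
    unfolding theta_1_0 mult.assoc psi_E1 ..
  thus ?thesis by simp
qed

lemma theta_phi: "theta 2 1 (-1) = phi"
proof -
  have "theta 2 1 (-1) * E 2 = phi * E 2"
    unfolding theta_2_1 phi_E2 ..
  thus ?thesis by simp
qed

section \<open>Dissection modulo five\<close>

definition sect :: "nat \<Rightarrow> complex fps \<Rightarrow> complex fps" where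
  "sect r f = Abs_fps (\<lambda>n. fps_nth f (5 * n + r))"

lemma fps_nth_sect [simp]: "fps_nth (sect r f) n = fps_nth f (5 * n + r)"
  by (simp add: sect_def)

lemma sect_add [simp]: "sect r (f + g) = sect r f + sect r g"
  and sect_0 [simp]: "sect r 0 = 0"
  and sect_const_mult: "sect r (fps_const c * f) = fps_const c * sect r f"
  by (simp_all add: fps_eq_iff)

lemma sect_numeral_mult [simp]: "sect r (numeral k * f) = numeral k * sect r f"
  by (simp add: fps_eq_iff numeral_fps_const)

lemma sect_sum: "sect r (sum f A) = (\<Sum>x\<in>A. sect r (f x))"
  by (simp add: fps_eq_iff fps_sum_nth)

lemma fps_eq_sects: "f = (\<Sum>i<5. fps_X ^ i * (sect i f oo fps_X ^ 5))"
proof (rule fps_ext)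
  fix n
  have *: "fps_nth (fps_X ^ i * (sect i f oo fps_X ^ 5)) n = (if i = n mod 5 then fps_nth f n else 0)"
    if "i < 5" for i
  proof (cases "i = n mod 5")
    case True
    thus ?thesis by (auto simp: fps_X_power_mult_nth fps_nth_compose_X_power minus_mod_eq_mult_div)
  next
    case False
    hence "\<not> (5 dvd n - i \<and> n \<ge> i)"
      using that by (metis mod_less mod_eq_dvd_iff_nat)
    thus ?thesis using False by (auto simp: fps_X_power_mult_nth fps_nth_compose_X_power)
  qed
  have "(\<Sum>i<5. fps_nth (fps_X ^ i * (sect i f oo fps_X ^ 5)) n) = fps_nth f n"
    by (subst sum.cong[OF refl *]) auto
  thus "fps_nth f n = fps_nth (\<Sum>i<5. fps_X ^ i * (sect i f oo fps_X ^ 5)) n"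
    by (simp add: fps_sum_nth)
qed

lemma sect_X_power_compose:
  assumes "r < 5"
  shows   "sect r (fps_X ^ k * (h oo fps_X ^ 5)) = (if k mod 5 = r then fps_X ^ (k div 5) * h else 0)"
proof (rule fps_ext)
  fix n
  show "fps_nth (sect r (fps_X ^ k * (h oo fps_X ^ 5))) n =
        fps_nth (if k mod 5 = r then fps_X ^ (k div 5) * h else 0) n"
  proof (cases "k mod 5 = r")
    case True
    hence k: "k = 5 * (k div 5) + r" by (metis mult_div_mod_eq)
    have "5 * n + r < k \<longleftrightarrow> n < k div 5" by (subst k) simp
    moreover have "5 * n + r - k = 5 * (n - k div 5)" by (subst k) simp
    ultimately show ?thesis using True
      by (simp add: fps_X_power_mult_nth fps_nth_compose_X_power)
  next
    case False
    hence "\<not> (5 dvd 5 * n + r - k \<and> 5 * n + r \<ge> k)"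
      using assms by (metis mod_less mod_eq_dvd_iff_nat mod_mult_self4)
    thus ?thesis using False by (auto simp: fps_X_power_mult_nth fps_nth_compose_X_power)
  qed
qed

lemma sect_mult:
  assumes "r < 5"
  shows   "sect r (f * g) = (\<Sum>i<5. \<Sum>j<5. if (i + j) mod 5 = r
             then fps_X ^ ((i + j) div 5) * (sect i f * sect j g) else 0)"
proof -
  have "f * g = (\<Sum>i<5. fps_X ^ i * (sect i f oo fps_X ^ 5)) * (\<Sum>j<5. fps_X ^ j * (sect j g oo fps_X ^ 5))"
    by (simp flip: fps_eq_sects)
  also have "\<dots> = (\<Sum>i<5. \<Sum>j<5. fps_X ^ (i + j) * ((sect i f * sect j g) oo fps_X ^ 5))"
    unfolding sum_product
    by (intro sum.cong refl) (simp add: power_add fps_compose_mult_distrib mult_ac)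
  finally show ?thesis
    by (simp only: sect_sum sect_X_power_compose[OF assms])
qed

lemma sum_lt_5: "(\<Sum>i<5. f i) = f 0 + f 1 + f 2 + f 3 + f (4::nat)"
  by (simp add: eval_nat_numeral)

lemma sect_mult_0: "sect 0 (f * g) = sect 0 f * sect 0 g
     + fps_X * (sect 1 f * sect 4 g + sect 2 f * sect 3 g + sect 3 f * sect 2 g + sect 4 f * sect 1 g)"
  and sect_mult_1: "sect 1 (f * g) = sect 0 f * sect 1 g + sect 1 f * sect 0 g
     + fps_X * (sect 2 f * sect 4 g + sect 3 f * sect 3 g + sect 4 f * sect 2 g)"
  and sect_mult_2: "sect 2 (f * g) = sect 0 f * sect 2 g + sect 1 f * sect 1 g + sect 2 f * sect 0 g
     + fps_X * (sect 3 f * sect 4 g + sect 4 f * sect 3 g)"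
  and sect_mult_3: "sect 3 (f * g) = sect 0 f * sect 3 g + sect 1 f * sect 2 g + sect 2 f * sect 1 g
     + sect 3 f * sect 0 g + fps_X * (sect 4 f * sect 4 g)"
  and sect_mult_4: "sect 4 (f * g) = sect 0 f * sect 4 g + sect 1 f * sect 3 g + sect 2 f * sect 2 g
     + sect 3 f * sect 1 g + sect 4 f * sect 0 g"
  by (simp_all add: sect_mult sum_lt_5 algebra_simps)

lemma sect_compose: "r < 5 \<Longrightarrow> sect r (h oo fps_X ^ 5) = (if r = 0 then h else 0)"
  using sect_X_power_compose[of r 0 h] by auto

lemma sect_mult_compose: "r < 5 \<Longrightarrow> sect r (f * (h oo fps_X ^ 5)) = sect r f * h"
proof -
  assume r: "r < 5"
  have "sect r (f * (h oo fps_X ^ 5)) =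
      (\<Sum>i<5. \<Sum>j<(5::nat). if j = 0 then if i = r then sect i f * h else 0 else 0)"
    unfolding sect_mult[OF r] by (intro sum.cong refl) (auto simp: sect_compose)
  also have "\<dots> = sect r f * h" using r by simp
  finally show ?thesis .
qed

lemma has_sum_sect:
  assumes "(f has_sum s) A"
  shows   "((\<lambda>x. sect r (f x)) has_sum sect r s) A"
proof -
  have "eventually (\<lambda>F. fps_nth (sum (\<lambda>x. sect r (f x)) F) n = fps_nth (sect r s) n)
          (finite_subsets_at_top A)" for n
  proof -
    have "eventually (\<lambda>F. fps_nth (sum f F) (5 * n + r) = fps_nth s (5 * n + r))
            (finite_subsets_at_top A)"
      using assms unfolding has_sum_def tendsto_fps_iff by blast
    thus ?thesis by eventually_elim (simp flip: sect_sum)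
  qed
  thus ?thesis by (simp add: has_sum_def tendsto_fps_iff)
qed

text \<open>
  The residues are represented symmetrically by -2, ..., 2, which keeps the exponents of the
  resulting theta series in the range \<open>B \<le> A\<close>.
\<close>

lemma has_sum_residues_mod_5:
  fixes f :: "int \<Rightarrow> complex fps"
  assumes "(f has_sum s) UNIV"
    and "((\<lambda>m. f (5 * m + (-2))) has_sum a) UNIV" "((\<lambda>m. f (5 * m + (-1))) has_sum b) UNIV"
        "((\<lambda>m. f (5 * m + 0)) has_sum c) UNIV" "((\<lambda>m. f (5 * m + 1)) has_sum d) UNIV"
        "((\<lambda>m. f (5 * m + 2)) has_sum e) UNIV"
  shows   "s = a + b + c + d + e"
proof -
  define t where "t = (\<lambda>r::int. if r = -2 then a else if r = -1 then b else if r = 0 then c else if r = 1 then d else e)"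
  have set: "{-2..2::int} = {-2, -1, 0, 1, 2}" by auto
  have "bij_betw (\<lambda>(r, m). 5 * m + r) ({-2..2::int} \<times> UNIV) UNIV"
  proof (rule bij_betwI[of _ _ _ "\<lambda>k. ((k + 2) mod 5 - 2, (k + 2) div 5)"])
    fix x :: "int \<times> int" assume "x \<in> {-2..2} \<times> UNIV"
    then obtain r m where x: "x = (r, m)" and r: "-2 \<le> r" "r \<le> 2" by auto
    have "(5 * m + r + 2) mod 5 - 2 = r \<and> (5 * m + r + 2) div 5 = m" using r by presburger
    thus "(((case x of (r, m) \<Rightarrow> 5 * m + r) + 2) mod 5 - 2, ((case x of (r, m) \<Rightarrow> 5 * m + r) + 2) div 5) = x"
      by (simp add: x)
  next
    fix k :: int
    show "(case ((k + 2) mod 5 - 2, (k + 2) div 5) of (r, m) \<Rightarrow> 5 * m + r) = k"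
      unfolding prod.case by presburger
  qed auto
  from has_sum_reindex_bij_betw[OF this, of f s] assms(1)
  have "((\<lambda>(r, m). f (5 * m + r)) has_sum s) ({-2..2} \<times> UNIV)"
    by (simp add: case_prod_unfold)
  hence "(t has_sum s) {-2..2}"
  proof (rule has_sum_SigmaD)
    fix r :: int assume "r \<in> {-2..2}"
    hence "r = -2 \<or> r = -1 \<or> r = 0 \<or> r = 1 \<or> r = 2" by auto
    thus "((\<lambda>m. case (r, m) of (r, m) \<Rightarrow> f (5 * m + r)) has_sum t r) UNIV"
      using assms(2-6) by (elim disjE) (simp_all add: t_def)
  qed
  hence "s = (\<Sum>r\<in>{-2..2}. t r)"
    by (simp add: has_sum_finite_iff)
  thus ?thesis by (simp add: set t_def add_ac)
qed

lemma sect_theta_term: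
  assumes "theta_exp A B k = 5 * e + int \<rho>'" "\<rho> < 5" "\<rho>' < 5" "A > 0" "B \<le> A"
  shows   "sect \<rho> (theta_term A B c k) =
             (if \<rho> = \<rho>' then fps_const (c powi k) * fps_X ^ nat e else 0)"
proof -
  have "e \<ge> 0" using theta_exp_nonneg[OF assms(4,5), of k] assms(1,3) by linarith
  hence "nat (theta_exp A B k) = 5 * nat e + \<rho>'" using assms(1) by linarith
  thus ?thesis
    using assms(2,3) sect_X_power_compose[of \<rho> "5 * nat e + \<rho>'" 1]
    by (simp add: theta_term_def sect_const_mult)
qed

lemma sect_theta_zero:
  assumes "\<And>m. theta_exp A B (5 * m + r) = 5 * g m + int \<rho>'" "\<rho> \<noteq> \<rho>'" "\<rho> < 5" "\<rho>' < 5" "A > 0" "B \<le> A"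
  shows   "((\<lambda>m. sect \<rho> (theta_term A B c (5 * m + r))) has_sum 0) UNIV"
  using assms by (simp add: sect_theta_term[OF assms(1)])

text \<open>
  In the applications \<open>c\<close> is a sign. The equation \<open>c\<^sup>5 = c\<close> turns \<open>c\<^bsup>5m\<^esup>\<close> into \<open>c\<^sup>m\<close>.
\<close>

lemma sect_theta_has_sum:
  assumes "\<And>m. theta_exp A B (5 * m + r) = 5 * theta_exp A' B' m + int \<rho>" "\<rho> < 5" "A > 0" "B \<le> A"
    "A' > 0" "B' \<le> A'" "c ^ 5 = c" "c \<noteq> 0"
  shows   "((\<lambda>m. sect \<rho> (theta_term A B c (5 * m + r))) has_sum (fps_const (c powi r) * theta A' B' c)) UNIV"
proof -
  have "c powi (5 * m + r) = c powi r * c powi m" for m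
    using assms(7,8) by (simp add: power_int_add power_int_mult)
  hence "sect \<rho> (theta_term A B c (5 * m + r)) = fps_const (c powi r) * theta_term A' B' c m" for m
    by (subst sect_theta_term[OF assms(1)]) (use assms in \<open>simp_all add: theta_term_def flip: fps_const_mult\<close>)
  thus ?thesis
    by (simp add: has_sum_cmult_right has_sum_theta assms)
qed

lemma sect_theta_has_sum_compose:
  assumes "\<And>m. theta_exp A B (5 * m + r) = 5 * (5 * theta_exp A' B' m) + int \<rho>" "\<rho> < 5" "A > 0" "B \<le> A"
    "A' > 0" "B' \<le> A'" "c ^ 5 = c" "c \<noteq> 0"
  shows   "((\<lambda>m. sect \<rho> (theta_term A B c (5 * m + r))) has_sum
              (fps_const (c powi r) * (theta A' B' c oo fps_X ^ 5))) UNIV"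
proof -
  have "c powi (5 * m + r) = c powi r * c powi m" for m
    using assms(7,8) by (simp add: power_int_add power_int_mult)
  moreover have "nat (5 * theta_exp A' B' m) = 5 * nat (theta_exp A' B' m)" for m
    by (simp add: nat_mult_distrib)
  ultimately have "sect \<rho> (theta_term A B c (5 * m + r)) = fps_const (c powi r) * (theta_term A' B' c m oo fps_X ^ 5)" for m
    by (subst sect_theta_term[OF assms(1)]) (use assms in \<open>simp_all add: theta_term_def power_mult
      fps_compose_mult_distrib fps_X_power_compose flip: fps_const_mult\<close>)
  thus ?thesis
    by (simp add: has_sum_cmult_right has_sum_compose_X_power has_sum_theta assms)
qed

text \<open>
  Completing the square: restricted to a residue class modulo 5 the exponent is again of the form
  \<open>theta_exp\<close>, with \<open>25A\<close> in place of \<open>A\<close>, of which one factor 5 is split off.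
\<close>

lemma theta_exp_dissect:
  assumes "int B' = int B + int A * (r + 2)" "A' = 5 * A"
  shows   "theta_exp A B (5 * m + r) = 5 * theta_exp A' B' m + theta_exp A B r"
proof -
  have "2 * theta_exp A B (5 * m + r) = 2 * (5 * theta_exp A' B' m + theta_exp A B r)"
    using assms theta_exp_double[of A B "5 * m + r"] theta_exp_double[of A' B' m] theta_exp_double[of A B r]
    by (simp add: algebra_simps)
  thus ?thesis by simp
qed

text \<open>
  The pentagonal numbers \<open>k(3k-1)/2\<close> leave only the remainders 0, 1, 2 modulo 5, and remainder 1
  occurs only for \<open>k = 5m + 1\<close>, where the number is 25 times a pentagonal number plus 1.
\<close>

lemma E1_sections:
  "sect 1 (E 1) = - E 5" "sect 3 (E 1) = 0" "sect 4 (E 1) = 0"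
proof -
  have e: "theta_exp 3 1 (5 * m + 0) = 5 * theta_exp 15 7 m + int 0"
          "theta_exp 3 1 (5 * m + 1) = 5 * (5 * theta_exp 3 2 m) + int 1"
          "theta_exp 3 1 (5 * m + 2) = 5 * (theta_exp 15 13 m + 1) + int 0"
          "theta_exp 3 1 (5 * m + (-1)) = 5 * theta_exp 15 4 m + int 2"
          "theta_exp 3 1 (5 * m + (-2)) = 5 * (theta_exp 15 1 m + 1) + int 2" for m
    by (subst theta_exp_dissect[of 7 1 3 _ 15], simp, simp, simp add: theta_exp_def,
        subst theta_exp_dissect[of 10 1 3 _ 15], simp, simp, simp add: theta_exp_def,
        subst theta_exp_dissect[of 13 1 3 _ 15], simp, simp, simp add: theta_exp_def,
        subst theta_exp_dissect[of 4 1 3 _ 15], simp, simp, simp add: theta_exp_def,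
        subst theta_exp_dissect[of 1 1 3 _ 15], simp, simp, simp add: theta_exp_def)
  have hs: "((\<lambda>k. sect \<rho> (theta_term 3 1 (-1) k)) has_sum sect \<rho> (E 1)) UNIV" for \<rho>
    unfolding theta_3_1[symmetric] by (intro has_sum_sect has_sum_theta) auto
  note z = sect_theta_zero[OF e(1)] sect_theta_zero[OF e(2)] sect_theta_zero[OF e(3)]
           sect_theta_zero[OF e(4)] sect_theta_zero[OF e(5)]
  note s = sect_theta_has_sum_compose[OF e(2)]
  have "sect 3 (E 1) = 0 + 0 + 0 + 0 + 0"
    by (rule has_sum_residues_mod_5[OF hs]; (rule z; simp))
  thus "sect 3 (E 1) = 0" by simp
  have "sect 4 (E 1) = 0 + 0 + 0 + 0 + 0"
    by (rule has_sum_residues_mod_5[OF hs]; (rule z; simp))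
  thus "sect 4 (E 1) = 0" by simp
  have "sect 1 (E 1) = 0 + 0 + 0 + fps_const ((-1) powi 1) * (theta 3 2 (-1) oo fps_X ^ 5) + 0"
    by (rule has_sum_residues_mod_5[OF hs]; (rule z s; simp))
  moreover have "theta 3 2 (-1) = E 1"
    using theta_reflect[of 3 1 "-1"] theta_3_1 by simp
  ultimately show "sect 1 (E 1) = - E 5"
    by (simp add: E_compose_X_power flip: fps_const_neg)
qed

text \<open>
  The remainders of the triangular numbers modulo 5 are 0, 1, 3, and 3 comes from one residue class of
  \<open>k\<close>, which reproduces the series.
\<close>

lemma theta_1_0_sections:
  "sect 0 (theta 1 0 1) = 2 * theta 5 2 1" "sect 1 (theta 1 0 1) = 2 * theta 5 1 1"
  "sect 2 (theta 1 0 1) = 0" "sect 3 (theta 1 0 1) = theta 1 0 1 oo fps_X ^ 5"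
  "sect 4 (theta 1 0 1) = 0"
proof -
  have e: "theta_exp 1 0 (5 * m + 0) = 5 * theta_exp 5 2 m + int 0"
          "theta_exp 1 0 (5 * m + 1) = 5 * theta_exp 5 3 m + int 0"
          "theta_exp 1 0 (5 * m + 2) = 5 * theta_exp 5 4 m + int 1"
          "theta_exp 1 0 (5 * m + (-1)) = 5 * theta_exp 5 1 m + int 1"
          "theta_exp 1 0 (5 * m + (-2)) = 5 * (5 * theta_exp 1 0 m) + int 3" for m
    by (subst theta_exp_dissect[of 2 0 1 _ 5], simp, simp, simp add: theta_exp_def,
        subst theta_exp_dissect[of 3 0 1 _ 5], simp, simp, simp add: theta_exp_def,
        subst theta_exp_dissect[of 4 0 1 _ 5], simp, simp, simp add: theta_exp_def,
        subst theta_exp_dissect[of 1 0 1 _ 5], simp, simp, simp add: theta_exp_def,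
        subst theta_exp_dissect[of 0 0 1 _ 5], simp, simp, simp add: theta_exp_def)
  have hs: "((\<lambda>k. sect \<rho> (theta_term 1 0 1 k)) has_sum sect \<rho> (theta 1 0 1)) UNIV" for \<rho>
    by (simp add: has_sum_sect has_sum_theta)
  note z = sect_theta_zero[OF e(1)] sect_theta_zero[OF e(2)] sect_theta_zero[OF e(3)]
           sect_theta_zero[OF e(4)] sect_theta_zero[OF e(5)]
  note s = sect_theta_has_sum[OF e(1)] sect_theta_has_sum[OF e(2)] sect_theta_has_sum[OF e(3)]
           sect_theta_has_sum[OF e(4)] sect_theta_has_sum_compose[OF e(5)]
  have refl: "theta 5 3 1 = theta 5 2 1" "theta 5 4 1 = theta 5 1 1"
    using theta_reflect[of 5 2 1] theta_reflect[of 5 1 1] by simp_all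
  have "sect 0 (theta 1 0 1) = 0 + 0 + fps_const (1 powi 0) * theta 5 2 1 + fps_const (1 powi 1) * theta 5 3 1 + 0"
    by (rule has_sum_residues_mod_5[OF hs]; (rule z s; simp))
  thus "sect 0 (theta 1 0 1) = 2 * theta 5 2 1" by (simp add: refl)
  have "sect 1 (theta 1 0 1) = 0 + fps_const (1 powi (-1)) * theta 5 1 1 + 0 + 0 + fps_const (1 powi 2) * theta 5 4 1"
    by (rule has_sum_residues_mod_5[OF hs]; (rule z s; simp))
  thus "sect 1 (theta 1 0 1) = 2 * theta 5 1 1" by (simp add: refl)
  have "sect 2 (theta 1 0 1) = 0 + 0 + 0 + 0 + 0"
    by (rule has_sum_residues_mod_5[OF hs]; (rule z; simp))
  thus "sect 2 (theta 1 0 1) = 0" by simp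
  have "sect 3 (theta 1 0 1) = fps_const (1 powi (-2)) * (theta 1 0 1 oo fps_X ^ 5) + 0 + 0 + 0 + 0"
    by (rule has_sum_residues_mod_5[OF hs]; (rule z s; simp))
  thus "sect 3 (theta 1 0 1) = theta 1 0 1 oo fps_X ^ 5" by simp
  have "sect 4 (theta 1 0 1) = 0 + 0 + 0 + 0 + 0"
    by (rule has_sum_residues_mod_5[OF hs]; (rule z; simp))
  thus "sect 4 (theta 1 0 1) = 0" by simp
qed

lemma psi_sections:
  "sect 0 psi = theta 5 2 1" "sect 1 psi = theta 5 1 1" "sect 2 psi = 0"
  "sect 3 psi = psi oo fps_X ^ 5" "sect 4 psi = 0"
  using theta_1_0_sections[unfolded theta_psi]
  by (simp_all add: fps_compose_mult_distrib)

text \<open>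
  The residue classes \<open>k \<equiv> \<plusminus>1\<close> and \<open>k \<equiv> \<plusminus>2\<close> modulo 5 give equal sums by reflection; the class of
  0 reproduces the series.
\<close>

lemma phi_sections:
  "sect 0 phi = phi oo fps_X ^ 5" "sect 1 phi = - 2 * theta 10 3 (-1)" "sect 2 phi = 0"
  "sect 3 phi = 0" "sect 4 phi = 2 * theta 10 1 (-1)"
proof -
  have e: "theta_exp 2 1 (5 * m + 0) = 5 * (5 * theta_exp 2 1 m) + int 0"
          "theta_exp 2 1 (5 * m + 1) = 5 * theta_exp 10 7 m + int 1"
          "theta_exp 2 1 (5 * m + 2) = 5 * theta_exp 10 9 m + int 4"
          "theta_exp 2 1 (5 * m + (-1)) = 5 * theta_exp 10 3 m + int 1"
          "theta_exp 2 1 (5 * m + (-2)) = 5 * theta_exp 10 1 m + int 4" for m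
    by (subst theta_exp_dissect[of 5 1 2 _ 10], simp, simp, simp add: theta_exp_def,
        subst theta_exp_dissect[of 7 1 2 _ 10], simp, simp, simp add: theta_exp_def,
        subst theta_exp_dissect[of 9 1 2 _ 10], simp, simp, simp add: theta_exp_def,
        subst theta_exp_dissect[of 3 1 2 _ 10], simp, simp, simp add: theta_exp_def,
        subst theta_exp_dissect[of 1 1 2 _ 10], simp, simp, simp add: theta_exp_def)
  have hs: "((\<lambda>k. sect \<rho> (theta_term 2 1 (-1) k)) has_sum sect \<rho> phi) UNIV" for \<rho>
    unfolding theta_phi[symmetric] by (intro has_sum_sect has_sum_theta) auto
  note z = sect_theta_zero[OF e(1)] sect_theta_zero[OF e(2)] sect_theta_zero[OF e(3)]
           sect_theta_zero[OF e(4)] sect_theta_zero[OF e(5)]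
  note s = sect_theta_has_sum_compose[OF e(1)] sect_theta_has_sum[OF e(2)] sect_theta_has_sum[OF e(3)]
           sect_theta_has_sum[OF e(4)] sect_theta_has_sum[OF e(5)]
  have refl: "theta 10 7 (-1) = theta 10 3 (-1)" "theta 10 9 (-1) = theta 10 1 (-1)"
    using theta_reflect[of 10 3 "-1"] theta_reflect[of 10 1 "-1"] by simp_all
  have "sect 0 phi = 0 + 0 + fps_const ((-1) powi 0) * (theta 2 1 (-1) oo fps_X ^ 5) + 0 + 0"
    by (rule has_sum_residues_mod_5[OF hs]; (rule z s; simp))
  thus "sect 0 phi = phi oo fps_X ^ 5" unfolding theta_phi by simp
  have "sect 1 phi = 0 + fps_const ((-1) powi (-1)) * theta 10 3 (-1) + 0
          + fps_const ((-1) powi 1) * theta 10 7 (-1) + 0"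
    by (rule has_sum_residues_mod_5[OF hs]; (rule z s; simp))
  thus "sect 1 phi = - 2 * theta 10 3 (-1)" by (simp add: refl flip: fps_const_neg)
  have "sect 2 phi = 0 + 0 + 0 + 0 + 0"
    by (rule has_sum_residues_mod_5[OF hs]; (rule z; simp))
  thus "sect 2 phi = 0" by simp
  have "sect 3 phi = 0 + 0 + 0 + 0 + 0"
    by (rule has_sum_residues_mod_5[OF hs]; (rule z; simp))
  thus "sect 3 phi = 0" by simp
  have "sect 4 phi = fps_const ((-1) powi (-2)) * theta 10 1 (-1) + 0 + 0 + 0
          + fps_const ((-1) powi 2) * theta 10 9 (-1)"
    by (rule has_sum_residues_mod_5[OF hs]; (rule z s; simp))
  thus "sect 4 phi = 2 * theta 10 1 (-1)" by (simp add: refl)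
qed

section \<open>Sums of two squares\<close>

definition sq_reps :: "nat \<Rightarrow> (int \<times> int) set" where
  "sq_reps n = {(x, y). x ^ 2 + y ^ 2 = int n}"

lemma square_ge_int: "(x :: int) \<le> x ^ 2" "- x \<le> x ^ 2"
proof -
  have "\<bar>x\<bar> \<le> x ^ 2"
  proof (cases "x = 0")
    case False
    hence "\<bar>x\<bar> * 1 \<le> \<bar>x\<bar> * \<bar>x\<bar>" by (intro mult_left_mono) auto
    thus ?thesis by (simp add: power2_eq_square)
  qed auto
  thus "x \<le> x ^ 2" "- x \<le> x ^ 2" by linarith+
qed

lemma finite_sq_reps [simp]: "finite (sq_reps n)"
proof (rule finite_subset)
  show "sq_reps n \<subseteq> {- int n..int n} \<times> {- int n..int n}"
  proof (clarsimp simp: sq_reps_def)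
    fix x y :: int assume *: "x ^ 2 + y ^ 2 = int n"
    show "- int n \<le> x \<and> x \<le> int n \<and> - int n \<le> y \<and> y \<le> int n"
      using * square_ge_int[of x] square_ge_int[of y] zero_le_power2[of x] zero_le_power2[of y] by linarith
  qed
qed auto

text \<open>
  If 5 divides \<open>x\<^sup>2 + y\<^sup>2\<close> then \<open>x \<equiv> 2y\<close> or \<open>x \<equiv> -2y\<close> modulo 5. Each of these lattices is the
  lattice of all integer points multiplied by a Gaussian integer of norm 5, so it contributes as many
  representations of \<open>5n\<close> as \<open>n\<close> has; their intersection consists of the points divisible by 5.
\<close>

lemma card_sq_reps_5:
  "card (sq_reps (5 * n)) + (if 5 dvd n then card (sq_reps (n div 5)) else 0) = 2 * card (sq_reps n)"
proof -
  define P where "P = {(x, y) \<in> sq_reps (5 * n). 5 dvd x - 2 * y}"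
  define Q where "Q = {(x, y) \<in> sq_reps (5 * n). 5 dvd x + 2 * y}"
  have fin: "finite P" "finite Q"
    unfolding P_def Q_def by (rule finite_subset[OF _ finite_sq_reps[of "5 * n"]]; auto)+
  have union: "P \<union> Q = sq_reps (5 * n)"
  proof -
    have "5 dvd x - 2 * y \<or> 5 dvd x + 2 * y" if "x ^ 2 + y ^ 2 = int (5 * n)" for x y
    proof -
      have "(x - 2 * y) * (x + 2 * y) = 5 * (int n - y ^ 2)"
        using that by (simp add: algebra_simps power2_eq_square)
      hence "5 dvd (x - 2 * y) * (x + 2 * y)" by (metis dvd_triv_left)
      moreover have "prime (5::int)" by simp
      ultimately show ?thesis using prime_dvd_mult_iff by blast
    qed
    thus ?thesis by (auto simp: P_def Q_def sq_reps_def)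
  qed
  \<comment> \<open>\<open>(2u + v)\<^sup>2 + (u - 2v)\<^sup>2 = 5(u\<^sup>2 + v\<^sup>2)\<close>, and \<open>(2u + v) - 2(u - 2v) = 5v\<close>.\<close>
  have "bij_betw (\<lambda>(u, v). (2 * u + v, u - 2 * v)) (sq_reps n) P"
  proof (rule bij_betwI[of _ _ _ "\<lambda>(x, y). ((2 * x + y) div 5, (x - 2 * y) div 5)"])
    show "(\<lambda>(u, v). (2 * u + v, u - 2 * v)) \<in> sq_reps n \<rightarrow> P"
      by (auto simp: P_def sq_reps_def power2_eq_square algebra_simps)
    show "(\<lambda>(x, y). ((2 * x + y) div 5, (x - 2 * y) div 5)) \<in> P \<rightarrow> sq_reps n"
    proof safe
      fix x y assume "(x, y) \<in> P"
      then obtain v where v: "x = 2 * y + 5 * v" "x ^ 2 + y ^ 2 = int (5 * n)"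
        by (auto simp: P_def sq_reps_def dvd_def algebra_simps)
      moreover have "(2 * x + y) div 5 = y + 2 * v" "(x - 2 * y) div 5 = v"
        using v(1) by auto
      ultimately show "((2 * x + y) div 5, (x - 2 * y) div 5) \<in> sq_reps n"
        by (auto simp: sq_reps_def power2_eq_square algebra_simps)
    qed
    fix p assume "p \<in> sq_reps n"
    show "(case case p of (u, v) \<Rightarrow> (2 * u + v, u - 2 * v) of (x, y) \<Rightarrow> ((2 * x + y) div 5, (x - 2 * y) div 5)) = p"
      by (cases p) simp
  next
    fix p assume "p \<in> P"
    then obtain x y v where p: "p = (x, y)" "x = 2 * y + 5 * v"
      by (auto simp: P_def dvd_def algebra_simps)
    have "(2 * x + y) div 5 = y + 2 * v" "(x - 2 * y) div 5 = v"
      using p(2) by auto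
    thus "(case case p of (x, y) \<Rightarrow> ((2 * x + y) div 5, (x - 2 * y) div 5) of (u, v) \<Rightarrow> (2 * u + v, u - 2 * v)) = p"
      using p(2) by (simp add: p(1))
  qed
  hence cP: "card P = card (sq_reps n)" by (rule bij_betw_same_card[symmetric])
  have "bij_betw (\<lambda>(x, y). (x, - y)) P Q"
    by (rule bij_betwI[of _ _ _ "\<lambda>(x, y). (x, - y)"]) (auto simp: P_def Q_def sq_reps_def)
  hence cQ: "card Q = card (sq_reps n)" using cP bij_betw_same_card by fastforce
  have PQ: "P \<inter> Q = {(x, y) \<in> sq_reps (5 * n). 5 dvd x \<and> 5 dvd y}"
  proof -
    have "5 dvd x - 2 * y \<and> 5 dvd x + 2 * y \<longleftrightarrow> 5 dvd x \<and> 5 dvd y" for x y :: int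
      by presburger
    thus ?thesis by (auto simp: P_def Q_def)
  qed
  have "card (P \<inter> Q) = (if 5 dvd n then card (sq_reps (n div 5)) else 0)"
  proof (cases "5 dvd n")
    case True
    then obtain m where m: "n = 5 * m" by (elim dvdE)
    have "bij_betw (\<lambda>(u, v). (5 * u, 5 * v)) (sq_reps m) (P \<inter> Q)"
      unfolding PQ
      by (rule bij_betwI[of _ _ _ "\<lambda>(x, y). (x div 5, y div 5)"])
         (auto simp: sq_reps_def m power2_eq_square dvd_def)
    hence "card (sq_reps m) = card (P \<inter> Q)" by (rule bij_betw_same_card)
    thus ?thesis by (simp add: m)
  next
    case False
    have "P \<inter> Q = {}"
    proof -
      have False if xy: "x ^ 2 + y ^ 2 = int (5 * n)" "5 dvd x" "5 dvd y" for x y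
      proof -
        from xy(2,3) obtain a b where "x = 5 * a" "y = 5 * b" by (auto elim!: dvdE)
        with xy(1) have "int n = 5 * (a ^ 2 + b ^ 2)" by (simp add: power2_eq_square)
        hence "5 dvd int n" by (metis dvd_triv_left)
        with False show False by presburger
      qed
      thus ?thesis unfolding PQ by (auto simp: sq_reps_def)
    qed
    thus ?thesis using False by simp
  qed
  moreover have "card (P \<union> Q) + card (P \<inter> Q) = card P + card Q"
    using card_Un_Int[OF fin] by simp
  ultimately show ?thesis using union cP cQ by simp
qed

lemma has_sum_fps_mult:
  fixes f g :: "_ \<Rightarrow> 'a::comm_ring_1 fps"
  assumes f: "(f has_sum s) A" and g: "(g has_sum t) B"
  shows   "((\<lambda>(x, y). f x * g y) has_sum (s * t)) (A \<times> B)"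
proof (rule has_sum_SigmaI)
  show "((\<lambda>x. f x * t) has_sum (s * t)) A" by (intro has_sum_cmult_left f)
  show "((\<lambda>y. case (x, y) of (x, y) \<Rightarrow> f x * g y) has_sum f x * t) B" for x
    by (simp add: has_sum_cmult_right g)
  show "(\<lambda>(x, y). f x * g y) summable_on (A \<times> B)"
  proof (rule summable_on_fpsI)
    fix n
    let ?S = "(\<Union>i\<le>n. {x\<in>A. fps_nth (f x) i \<noteq> 0}) \<times> (\<Union>i\<le>n. {y\<in>B. fps_nth (g y) i \<noteq> 0})"
    have "finite ?S"
      using has_sum_fpsD(1)[OF f] has_sum_fpsD(1)[OF g] by blast
    moreover have "{p \<in> A \<times> B. fps_nth (case p of (x, y) \<Rightarrow> f x * g y) n \<noteq> 0} \<subseteq> ?S"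
    proof safe
      fix x y assume *: "fps_nth (f x * g y) n \<noteq> 0" "x \<in> A" "y \<in> B"
      then obtain i where "i \<in> {0..n}" "fps_nth (f x) i * fps_nth (g y) (n - i) \<noteq> 0"
        unfolding fps_mult_nth by (meson sum.not_neutral_contains_not_neutral)
      moreover from this have "fps_nth (f x) i \<noteq> 0" "fps_nth (g y) (n - i) \<noteq> 0" by auto
      ultimately show "x \<in> (\<Union>i\<le>n. {x\<in>A. fps_nth (f x) i \<noteq> 0})" "y \<in> (\<Union>i\<le>n. {y\<in>B. fps_nth (g y) i \<noteq> 0})"
        using * by auto
    qed
    ultimately show "finite {p \<in> A \<times> B. fps_nth (case p of (x, y) \<Rightarrow> f x * g y) n \<noteq> 0}"
      by (rule finite_subset[rotated])
  qed
qed

lemma theta_square_nth: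
  assumes "A > 0" "B \<le> A" "c \<noteq> 0"
  shows   "fps_nth (theta A B c ^ 2) n =
             (\<Sum>(x, y) | theta_exp A B x + theta_exp A B y = int n. c powi (x + y))"
proof -
  have e: "nat (theta_exp A B x) + nat (theta_exp A B y) = n \<longleftrightarrow> theta_exp A B x + theta_exp A B y = int n" for x y
    using theta_exp_nonneg[OF assms(1,2), of x] theta_exp_nonneg[OF assms(1,2), of y] by linarith
  have *: "theta_term A B c x * theta_term A B c y =
      fps_const (c powi (x + y)) * fps_X ^ (nat (theta_exp A B x) + nat (theta_exp A B y))" for x y
    using assms(3) by (simp add: theta_term_def power_int_add power_add mult_ac flip: fps_const_mult)
  have nth: "fps_nth (theta_term A B c x * theta_term A B c y) n =
      (if theta_exp A B x + theta_exp A B y = int n then c powi (x + y) else 0)" for x y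
    unfolding * using e[of x y] by auto
  have h: "((\<lambda>(x, y). theta_term A B c x * theta_term A B c y) has_sum (theta A B c * theta A B c)) (UNIV \<times> UNIV)"
    by (intro has_sum_fps_mult has_sum_theta assms)
  have "fps_nth (theta A B c * theta A B c) n =
      (\<Sum>p | p \<in> UNIV \<times> UNIV \<and> fps_nth (case p of (x, y) \<Rightarrow> theta_term A B c x * theta_term A B c y) n \<noteq> 0.
         fps_nth (case p of (x, y) \<Rightarrow> theta_term A B c x * theta_term A B c y) n)"
    by (rule has_sum_fpsD(2)[OF h])
  also have "\<dots> = (\<Sum>(x, y) | theta_exp A B x + theta_exp A B y = int n. c powi (x + y))"
    using assms(3) by (intro sum.cong) (auto simp: nth split: if_splits)
  finally show ?thesis by (simp add: power2_eq_square)
qed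

text \<open>
  The sign \<open>(-1)\<^sup>x\<^sup>+\<^sup>y\<close> depends only on \<open>x\<^sup>2 + y\<^sup>2\<close>.
\<close>

lemma phi_square_nth: "fps_nth (phi ^ 2) n = (-1) ^ n * of_nat (card (sq_reps n))"
proof -
  have e: "theta_exp 2 1 x = x ^ 2" for x
    using theta_exp_double[of 2 1 x] by (simp add: power2_eq_square algebra_simps)
  have "(-1::complex) powi (x + y) = (-1) ^ n" if "x ^ 2 + y ^ 2 = int n" for x y :: int
  proof -
    have "even (x + y) \<longleftrightarrow> even (x ^ 2 + y ^ 2)" by simp
    hence "even (x + y) \<longleftrightarrow> even n" using that by simp
    thus ?thesis by (simp add: power_int_minus_left)
  qed
  hence "(\<Sum>(x, y)\<in>sq_reps n. (-1::complex) powi (x + y)) = (\<Sum>p\<in>sq_reps n. (-1) ^ n)"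
    by (intro sum.cong) (auto simp: sq_reps_def)
  thus ?thesis
    using theta_square_nth[of 2 1 "-1" n, unfolded e theta_phi] by (simp add: sq_reps_def mult.commute)
qed

text \<open>
  Two triangular numbers with sum \<open>n\<close> correspond to two odd squares with sum \<open>8n + 2\<close>, and in a
  representation of \<open>8n + 2\<close> both squares are odd because a sum of two even squares is divisible
  by 4.
\<close>

lemma psi_square_nth: "fps_nth ((2 * psi) ^ 2) n = of_nat (card (sq_reps (8 * n + 2)))"
proof -
  have e: "8 * theta_exp 1 0 x + 1 = (2 * x - 1) ^ 2" for x
    using theta_exp_double[of 1 0 x] by (simp add: power2_eq_square algebra_simps)
  have *: "theta_exp 1 0 x + theta_exp 1 0 y = int n \<longleftrightarrow> (2 * x - 1, 2 * y - 1) \<in> sq_reps (8 * n + 2)" for x y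
    unfolding sq_reps_def using e[of x] e[of y] by auto
  have "bij_betw (\<lambda>(x, y). (2 * x - 1, 2 * y - 1)) {(x, y). theta_exp 1 0 x + theta_exp 1 0 y = int n} (sq_reps (8 * n + 2))"
  proof (rule bij_betwI[of _ _ _ "\<lambda>(u, v). ((u + 1) div 2, (v + 1) div 2)"])
    have odd: "odd u \<and> odd v" if "u ^ 2 + v ^ 2 = int (8 * n + 2)" for u v :: int
    proof (rule ccontr)
      assume no: "\<not> (odd u \<and> odd v)"
      have "even (u ^ 2 + v ^ 2)" unfolding that by simp
      hence "even u" "even v" using no by auto
      then obtain a b where "u = 2 * a" "v = 2 * b" by (auto elim!: evenE)
      with that have "2 * (a ^ 2 + b ^ 2) = 4 * int n + 1" by (simp add: power2_eq_square)
      thus False by presburger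
    qed
    show "(\<lambda>(u, v). ((u + 1) div 2, (v + 1) div 2)) \<in> sq_reps (8 * n + 2) \<rightarrow> {(x, y). theta_exp 1 0 x + theta_exp 1 0 y = int n}"
    proof safe
      fix u v assume uv: "(u, v) \<in> sq_reps (8 * n + 2)"
      hence "odd u" "odd v" using odd by (auto simp: sq_reps_def)
      then obtain a b where ab: "u = 2 * a + 1" "v = 2 * b + 1" by (auto elim!: oddE)
      have "(u + 1) div 2 = a + 1" "(v + 1) div 2 = b + 1" by (auto simp: ab)
      moreover have "2 * (a + 1) - 1 = u" "2 * (b + 1) - 1 = v" by (auto simp: ab)
      ultimately show "theta_exp 1 0 ((u + 1) div 2) + theta_exp 1 0 ((v + 1) div 2) = int n"
        using uv by (simp only: *)
    qed
    fix p assume p: "p \<in> sq_reps (8 * n + 2)"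
    obtain u v where uv: "p = (u, v)" by (cases p)
    have "odd u" "odd v" using odd[of u v] p uv by (auto simp: sq_reps_def)
    thus "(case case p of (u, v) \<Rightarrow> ((u + 1) div 2, (v + 1) div 2) of (x, y) \<Rightarrow> (2 * x - 1, 2 * y - 1)) = p"
      by (auto simp: uv elim!: oddE)
  next
    show "(\<lambda>(x, y). (2 * x - 1, 2 * y - 1)) \<in> {(x, y). theta_exp 1 0 x + theta_exp 1 0 y = int n} \<rightarrow> sq_reps (8 * n + 2)"
    proof (rule Pi_I)
      fix p assume "p \<in> {(x, y). theta_exp 1 0 x + theta_exp 1 0 y = int n}"
      thus "(case p of (x, y) \<Rightarrow> (2 * x - 1, 2 * y - 1)) \<in> sq_reps (8 * n + 2)"
        using * by (cases p) (simp only: mem_Collect_eq prod.case)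
    qed
  qed auto
  hence "card {(x, y). theta_exp 1 0 x + theta_exp 1 0 y = int n} = card (sq_reps (8 * n + 2))"
    by (rule bij_betw_same_card)
  thus ?thesis
    using theta_square_nth[of 1 0 1 n, unfolded theta_psi] by (simp add: case_prod_unfold)
qed

text \<open>
  By the formula for sums of two squares, the component of index 0 of \<open>\<phi>\<^sup>2\<close> is
  \<open>2\<phi>\<^sup>2 - \<phi>(-q\<^sup>5)\<^sup>2\<close>. Computed from the components of \<open>\<phi>\<close> it is
  \<open>\<phi>(-q\<^sup>5)\<^sup>2\<close> plus twice the last summand.
\<close>

lemma phi_square_dissect: "phi ^ 2 = (phi oo fps_X ^ 5) ^ 2 + fps_X * (sect 1 phi * sect 4 phi)"
proof -
  have "sect 0 (phi ^ 2) + (phi ^ 2 oo fps_X ^ 5) = 2 * phi ^ 2"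
  proof (rule fps_ext)
    fix n
    have "(-1) ^ (n div 5) = (-1 :: complex) ^ n" if "5 dvd n"
    proof -
      from that obtain k where "n = 5 * k" by (elim dvdE)
      thus ?thesis by (simp add: uminus_power_if)
    qed
    moreover have "(-1) ^ (5 * n) = (-1 :: complex) ^ n" by (simp add: uminus_power_if)
    ultimately have "(-1) ^ (5 * n) * of_nat (card (sq_reps (5 * n))) +
        (if 5 dvd n then (-1) ^ (n div 5) * of_nat (card (sq_reps (n div 5))) else 0) =
        ((-1) ^ n * of_nat (card (sq_reps (5 * n)) + (if 5 dvd n then card (sq_reps (n div 5)) else 0)) :: complex)"
      by (cases "5 dvd n") (simp_all add: distrib_left)
    also have "\<dots> = 2 * ((-1) ^ n * of_nat (card (sq_reps n)))"
      unfolding card_sq_reps_5 by simp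
    finally have "(-1) ^ (5 * n) * of_nat (card (sq_reps (5 * n))) +
        (if 5 dvd n then (-1) ^ (n div 5) * of_nat (card (sq_reps (n div 5))) else 0) =
        2 * ((-1) ^ n * of_nat (card (sq_reps n)) :: complex)" .
    thus "fps_nth (sect 0 (phi ^ 2) + (phi ^ 2 oo fps_X ^ 5)) n = fps_nth (2 * phi ^ 2) n"
      by (simp add: fps_nth_compose_X_power phi_square_nth fps_mult_left_const_nth numeral_fps_const split: if_splits)
  qed
  moreover have "sect 0 (phi ^ 2) = (phi oo fps_X ^ 5) ^ 2 + 2 * (fps_X * (sect 1 phi * sect 4 phi))"
    unfolding power2_eq_square sect_mult_0 phi_sections(1,3,4) by (simp add: algebra_simps)
  moreover have "phi ^ 2 oo fps_X ^ 5 = (phi oo fps_X ^ 5) ^ 2"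
    by (simp add: fps_compose_power)
  ultimately have "2 * phi ^ 2 = 2 * ((phi oo fps_X ^ 5) ^ 2 + fps_X * (sect 1 phi * sect 4 phi))"
    by simp
  thus ?thesis by (rule fps_cancel_numeral)
qed

text \<open>
  The argument for \<open>\<phi>\<^sup>2\<close> applied to the component of index 1, since \<open>8(5n + 1) + 2 = 5(8n + 2)\<close>.
\<close>

lemma psi_square_dissect: "psi ^ 2 = sect 0 psi * sect 1 psi + fps_X * (psi oo fps_X ^ 5) ^ 2"
proof -
  have *: "sect 1 ((2 * psi) ^ 2) + fps_X * ((2 * psi) ^ 2 oo fps_X ^ 5) = 2 * (2 * psi) ^ 2"
  proof (rule fps_ext)
    fix n
    have c: "of_nat (card (sq_reps (5 * (8 * n + 2)))) + (if 5 dvd 8 * n + 2 then of_nat (card (sq_reps ((8 * n + 2) div 5))) else 0)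
        = (2 * of_nat (card (sq_reps (8 * n + 2))) :: complex)"
      using arg_cong[OF card_sq_reps_5[of "8 * n + 2"], of "of_nat :: nat \<Rightarrow> complex"]
      by (simp split: if_splits)
    have "fps_nth (fps_X * ((2 * psi) ^ 2 oo fps_X ^ 5)) n =
       (if 5 dvd 8 * n + 2 then of_nat (card (sq_reps ((8 * n + 2) div 5))) else 0)"
    proof (cases n)
      case (Suc m)
      have "5 dvd 8 * n + 2 \<longleftrightarrow> 5 dvd m" unfolding Suc by presburger
      moreover have "(8 * n + 2) div 5 = 8 * (m div 5) + 2" if "5 dvd m"
        using that Suc by (elim dvdE) simp
      ultimately show ?thesis
        using psi_square_nth[of "m div 5"]
        by (simp add: Suc fps_nth_compose_X_power del: power_mult_numeral)
    next
      case 0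
      have "\<not> 5 dvd 8 * n + 2" unfolding 0 by presburger
      thus ?thesis using 0 by simp
    qed
    moreover have "8 * (5 * n + 1) + 2 = 5 * (8 * n + 2)" by simp
    ultimately show "fps_nth (sect 1 ((2 * psi) ^ 2) + fps_X * ((2 * psi) ^ 2 oo fps_X ^ 5)) n = fps_nth (2 * (2 * psi) ^ 2) n"
      using c unfolding fps_add_nth fps_nth_sect psi_square_nth fps_nth_numeral_mult
      by (simp only: psi_square_nth)
  qed
  have "(2 * psi) ^ 2 = 4 * psi ^ 2" by (simp add: power_mult_distrib)
  moreover have "(4 * psi ^ 2) oo fps_X ^ 5 = 4 * (psi oo fps_X ^ 5) ^ 2"
    by (simp add: fps_compose_mult_distrib fps_compose_power)
  moreover have "sect 1 (psi ^ 2) = 2 * (sect 0 psi * sect 1 psi) + fps_X * (psi oo fps_X ^ 5) ^ 2"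
    unfolding power2_eq_square sect_mult_1 psi_sections(3,4,5) by (simp add: algebra_simps)
  ultimately have "8 * psi ^ 2 = 8 * (sect 0 psi * sect 1 psi + fps_X * (psi oo fps_X ^ 5) ^ 2)"
    using * by (simp add: algebra_simps)
  thus ?thesis by (rule fps_cancel_numeral)
qed

section \<open>The dissections of $E_1$ and $E_2$\<close>

lemma fps_compose_X_powers: "(f oo fps_X ^ a) oo fps_X ^ b = (f oo fps_X ^ (a * b) :: complex fps)"
  if "a > 0" "b > 0"
proof (rule fps_ext)
  fix n
  show "fps_nth ((f oo fps_X ^ a) oo fps_X ^ b) n = fps_nth (f oo fps_X ^ (a * b)) n"
  proof (cases "b dvd n")
    case True
    then obtain m where "n = b * m" by (elim dvdE)
    thus ?thesis using that by (simp add: fps_nth_compose_X_power mult.commute)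
  next
    case False
    hence "\<not> a * b dvd n" using dvd_mult_right by blast
    thus ?thesis using False by (simp add: fps_nth_compose_X_power)
  qed
qed

lemma fps_compose_X_power_inj:
  assumes "f oo fps_X ^ d = (g oo fps_X ^ d :: complex fps)" "d > 0"
  shows   "f = g"
proof (rule fps_ext)
  fix n
  have "fps_nth (f oo fps_X ^ d) (d * n) = fps_nth (g oo fps_X ^ d) (d * n)" using assms by simp
  thus "fps_nth f n = fps_nth g n" using assms(2) by (simp add: fps_nth_compose_X_power)
qed

lemma E1_dissect:
  "E 1 = (sect 0 (E 1) oo fps_X ^ 5) - fps_X * (E 5 oo fps_X ^ 5) + fps_X ^ 2 * (sect 2 (E 1) oo fps_X ^ 5)"
  by (subst fps_eq_sects)
     (simp add: sum_lt_5 E1_sections[simplified] fps_compose_uminus)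

lemma E2_sections:
  "sect 0 (E 2) = sect 0 (E 1) oo fps_X ^ 2" "sect 1 (E 2) = 0" "sect 2 (E 2) = - E 10"
  "sect 3 (E 2) = 0" "sect 4 (E 2) = sect 2 (E 1) oo fps_X ^ 2"
proof -
  have swap: "(f oo fps_X ^ 5) oo fps_X ^ 2 = (f oo fps_X ^ 2) oo fps_X ^ 5" for f :: "complex fps"
    by (simp add: fps_compose_X_powers)
  have "E 2 = E 1 oo fps_X ^ 2" by (simp add: E_compose_X_power)
  also have "\<dots> = fps_X ^ 0 * ((sect 0 (E 1) oo fps_X ^ 2) oo fps_X ^ 5) + fps_X ^ 2 * ((- E 10) oo fps_X ^ 5)
       + fps_X ^ 4 * ((sect 2 (E 1) oo fps_X ^ 2) oo fps_X ^ 5)"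
    by (subst E1_dissect) (simp add: fps_compose_add_distrib fps_compose_sub_distrib fps_compose_mult_distrib
       fps_X_power_compose swap E_compose_X_power fps_compose_uminus power_mult[symmetric])
  finally have E2: "E 2 = \<dots>" .
  show "sect 0 (E 2) = sect 0 (E 1) oo fps_X ^ 2" "sect 1 (E 2) = 0" "sect 2 (E 2) = - E 10"
       "sect 3 (E 2) = 0" "sect 4 (E 2) = sect 2 (E 1) oo fps_X ^ 2"
    unfolding E2 by (simp_all add: sect_X_power_compose del: power_0)
qed

text \<open>
  The component of index 4 of \<open>\<psi> E\<^sub>1 = E\<^sub>2\<^sup>2\<close>. On the left only \<open>\<psi>(q\<^sup>5)\<close> and the middle component
  of \<open>E\<^sub>1\<close> meet, while the right side contains the product of the outer components of \<open>E\<^sub>2\<close>. This gives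
  the claim with \<open>q\<^sup>2\<close> for \<open>q\<close>.
\<close>

lemma E1_sections_prod: "sect 0 (E 1) * sect 2 (E 1) = - (E 5 ^ 2)"
proof -
  have "sect 4 (psi * E 1) = - ((psi oo fps_X ^ 5) * E 5)"
    unfolding sect_mult_4 psi_sections(3-5) E1_sections by simp
  also have "(psi oo fps_X ^ 5) * E 5 = (psi * E 1) oo fps_X ^ 5"
    by (simp add: fps_compose_mult_distrib E_compose_X_power)
  also have "\<dots> = E 10 ^ 2"
    by (simp add: psi_E1[simplified] fps_compose_power[symmetric] E_compose_X_power)
  also have "psi * E 1 = E 2 * E 2" using psi_E1 by (simp add: power2_eq_square)
  also have "sect 4 (E 2 * E 2) = 2 * (sect 0 (E 2) * sect 4 (E 2)) + E 10 ^ 2"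
    unfolding sect_mult_4 E2_sections(2-4) by (simp add: power2_eq_square)
  finally have "2 * (sect 0 (E 2) * sect 4 (E 2)) = 2 * (- (E 10 ^ 2))" by (simp add: eq_neg_iff_add_eq_0 algebra_simps)
  hence "sect 0 (E 2) * sect 4 (E 2) = - (E 10 ^ 2)" by (subst (asm) mult_cancel_left) simp
  also have "E 10 = E 5 oo fps_X ^ 2" by (simp add: E_compose_X_power)
  finally have "(sect 0 (E 1) * sect 2 (E 1)) oo fps_X ^ 2 = (- (E 5 ^ 2)) oo fps_X ^ 2"
    unfolding E2_sections by (simp add: fps_compose_mult_distrib fps_compose_uminus fps_compose_power)
  thus ?thesis by (rule fps_compose_X_power_inj) simp
qed

section \<open>Norms over the fifth roots of unity\<close>

text \<open>
  Conjugate factors are paired: the sums \<open>s = v + v\<^sup>4\<close> and \<open>t = v\<^sup>2 + v\<^sup>3\<close> satisfy \<open>s + t = s t = -1\<close>, so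
  the two pairs multiply to an expression without \<open>v\<close>.
\<close>

lemma trinomial_norm:
  fixes v p a b :: "'a :: idom"
  assumes "1 + v + v ^ 2 + v ^ 3 + v ^ 4 = 0"
  shows "(p + a + b) * (p + v * a + v ^ 4 * b) * (p + v ^ 2 * a + v ^ 3 * b) *
         (p + v ^ 3 * a + v ^ 2 * b) * (p + v ^ 4 * a + v * b)
       = p ^ 5 + a ^ 5 + b ^ 5 - 5 * p ^ 3 * a * b + 5 * p * a ^ 2 * b ^ 2"
proof -
  define s where "s = v + v ^ 4"
  define t where "t = v ^ 2 + v ^ 3"
  have "v ^ 5 - 1 = (v - 1) * (1 + v + v ^ 2 + v ^ 3 + v ^ 4)"
    by (simp add: algebra_simps eval_nat_numeral)
  hence v5: "v ^ 5 = 1" using assms by simp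
  have st: "t = - 1 - s" using assms unfolding s_def t_def by algebra
  have ss: "s ^ 2 = 1 - s"
  proof -
    have "s ^ 2 = v ^ 2 + 2 * v ^ 5 + v ^ 5 * v ^ 3" unfolding s_def by (simp add: algebra_simps eval_nat_numeral)
    also have "\<dots> = 1 - s" unfolding v5 s_def using assms by algebra
    finally show ?thesis .
  qed
  have p1: "(p + v * a + v ^ 4 * b) * (p + v ^ 4 * a + v * b) = p ^ 2 + a ^ 2 + b ^ 2 + s * (p * (a + b)) + t * (a * b)"
  proof -
    have "(p + v * a + v ^ 4 * b) * (p + v ^ 4 * a + v * b) =
       p ^ 2 + v ^ 5 * (a ^ 2 + b ^ 2) + (v + v ^ 4) * (p * (a + b)) + (v ^ 2 + v ^ 5 * v ^ 3) * (a * b)"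
      by (simp add: algebra_simps eval_nat_numeral)
    thus ?thesis unfolding v5 s_def t_def by simp
  qed
  have p2: "(p + v ^ 2 * a + v ^ 3 * b) * (p + v ^ 3 * a + v ^ 2 * b) = p ^ 2 + a ^ 2 + b ^ 2 + t * (p * (a + b)) + s * (a * b)"
  proof -
    have "(p + v ^ 2 * a + v ^ 3 * b) * (p + v ^ 3 * a + v ^ 2 * b) =
       p ^ 2 + v ^ 5 * (a ^ 2 + b ^ 2) + (v ^ 2 + v ^ 3) * (p * (a + b)) + (v ^ 4 + v ^ 5 * v) * (a * b)"
      by (simp add: algebra_simps eval_nat_numeral)
    thus ?thesis unfolding v5 s_def t_def by (simp add: add.commute)
  qed
  have "(p + a + b) * (p + v * a + v ^ 4 * b) * (p + v ^ 2 * a + v ^ 3 * b) *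
         (p + v ^ 3 * a + v ^ 2 * b) * (p + v ^ 4 * a + v * b) =
      (p + a + b) * ((p + v * a + v ^ 4 * b) * (p + v ^ 4 * a + v * b)) *
         ((p + v ^ 2 * a + v ^ 3 * b) * (p + v ^ 3 * a + v ^ 2 * b))"
    by (simp only: mult_ac)
  also have "\<dots> = p ^ 5 + a ^ 5 + b ^ 5 - 5 * p ^ 3 * a * b + 5 * p * a ^ 2 * b ^ 2"
    unfolding p1 p2 st using ss by algebra
  finally show ?thesis .
qed

lemma prod_lt_5: "(\<Prod>i<5. f i) = f 0 * f 1 * f 2 * f 3 * f (4::nat)"
  by (simp add: eval_nat_numeral)

text \<open>
  The product of the conjugates \<open>f(w\<^sup>i q)\<close>; for a primitive fifth root of unity \<open>w\<close> it is a
  series in \<open>q\<^sup>5\<close>.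
\<close>

definition norm5 :: "complex \<Rightarrow> complex fps \<Rightarrow> complex fps" where
  "norm5 w f = (\<Prod>i<5. f oo (fps_const (w ^ i) * fps_X))"

lemma norm5_mult: "norm5 w (f * g) = norm5 w f * norm5 w g"
  by (simp add: norm5_def fps_compose_mult_distrib prod.distrib)

lemma norm5_power: "norm5 w (f ^ k) = norm5 w f ^ k"
  by (induction k) (simp_all add: norm5_mult, simp add: norm5_def)

lemma norm5_cong: "fps_cong n f g \<Longrightarrow> fps_cong n (norm5 w f) (norm5 w g)"
  unfolding norm5_def by (rule fps_cong_prod) (simp add: fps_cong_def fps_compose_linear)

lemma fifth_root_power_sum:
  fixes v :: complex
  assumes "v ^ 5 = 1" "v \<noteq> 1"
  shows   "1 + v + v ^ 2 + v ^ 3 + v ^ 4 = 0"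
proof -
  have "(v - 1) * (1 + v + v ^ 2 + v ^ 3 + v ^ 4) = v ^ 5 - 1"
    by (simp add: algebra_simps eval_nat_numeral)
  thus ?thesis using assms by simp
qed

lemma fifth_root_power_neq_1:
  fixes w :: complex
  assumes "w ^ 5 = 1" "w \<noteq> 1" "\<not> 5 dvd m"
  shows   "w ^ m \<noteq> 1"
proof
  assume m: "w ^ m = 1"
  have "coprime 5 m" using assms(3) by (intro prime_imp_coprime) auto
  hence "\<exists>x y. 5 * x = m * y + 1"
    using coprime_bezout_strong[of 5 m] by (cases "m = 1") (auto intro: exI[of _ 1] exI[of _ 4])
  then obtain x y where xy: "5 * x = m * y + 1" by blast
  have "w = w ^ (m * y + 1)" by (simp add: power_mult m)
  also have "\<dots> = 1" unfolding xy[symmetric] by (simp add: power_mult assms(1))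
  finally show False using assms(2) by simp
qed

context
  fixes w :: complex
  assumes w5: "w ^ 5 = 1" and w1: "w \<noteq> 1"
begin

lemma fps_const_w_sum: "1 + fps_const w + fps_const w ^ 2 + fps_const w ^ 3 + fps_const w ^ 4 = 0"
proof -
  have "1 + fps_const w + fps_const w ^ 2 + fps_const w ^ 3 + fps_const w ^ 4 = fps_const (1 + w + w ^ 2 + w ^ 3 + w ^ 4)"
    by (simp flip: fps_const_add fps_const_power)
  thus ?thesis using fifth_root_power_sum[OF w5 w1] by simp
qed

lemma fps_const_w_5: "fps_const w ^ 5 = 1"
  unfolding fps_const_power w5 by simp

lemma compose_X_5_rotate: "(h oo fps_X ^ 5) oo (fps_const (w ^ i) * fps_X) = h oo fps_X ^ 5"
proof (rule fps_ext)
  fix n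
  have "(w ^ i) ^ n = 1" if "5 dvd n"
  proof -
    from that obtain k where "n = 5 * k" by (elim dvdE)
    hence "(w ^ i) ^ n = (w ^ 5) ^ (i * k)" by (simp flip: power_mult add: mult_ac)
    thus ?thesis by (simp add: w5)
  qed
  thus "fps_nth ((h oo fps_X ^ 5) oo (fps_const (w ^ i) * fps_X)) n = fps_nth (h oo fps_X ^ 5) n"
    by (simp add: fps_compose_linear fps_nth_compose_X_power)
qed

lemma X_power_rotate: "fps_X ^ m oo (fps_const (w ^ i) * fps_X) = (fps_const w ^ m) ^ i * fps_X ^ m"
  by (simp add: fps_X_power_compose power_mult_distrib fps_const_power flip: power_mult)
     (simp add: mult.commute)

lemma X_rotate: "fps_X oo (fps_const (w ^ i) * fps_X) = fps_const w ^ i * fps_X"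
  by (simp add: fps_const_power)

lemma norm5_one_minus_X_power:
  "norm5 w (1 - fps_X ^ m) = (if 5 dvd m then (1 - fps_X ^ m) ^ 5 else 1 - fps_X ^ (5 * m))"
proof -
  define V where "V = fps_const w ^ m"
  have *: "norm5 w (1 - fps_X ^ m) = (\<Prod>i<5. 1 - V ^ i * fps_X ^ m)"
    by (simp add: norm5_def fps_compose_sub_distrib X_power_rotate V_def)
  show ?thesis
  proof (cases "5 dvd m")
    case True
    then obtain k where k: "m = 5 * k" by (elim dvdE)
    have "V = 1" unfolding V_def k power_mult fps_const_w_5 by simp
    thus ?thesis using True * by simp
  next
    case False
    have V: "V = fps_const (w ^ m)" by (simp add: V_def fps_const_power)
    have "(w ^ m) ^ 5 = 1" by (metis w5 power_mult mult.commute power_one)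
    hence "1 + w ^ m + (w ^ m) ^ 2 + (w ^ m) ^ 3 + (w ^ m) ^ 4 = 0"
      by (intro fifth_root_power_sum fifth_root_power_neq_1 w5 w1 False)
    moreover have "1 + V + V ^ 2 + V ^ 3 + V ^ 4 = fps_const (1 + w ^ m + (w ^ m) ^ 2 + (w ^ m) ^ 3 + (w ^ m) ^ 4)"
      unfolding V by (simp flip: fps_const_add fps_const_power)
    ultimately have "1 + V + V ^ 2 + V ^ 3 + V ^ 4 = 0" by simp
    from trinomial_norm[OF this, of 1 "- (fps_X ^ m)" 0]
    have "(\<Prod>i<5. 1 - V ^ i * fps_X ^ m) = 1 - (fps_X ^ m) ^ 5"
      unfolding prod_lt_5 by simp
    thus ?thesis using False * by (simp flip: power_mult add: mult.commute)
  qed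
qed

lemma euler_fin_5_Suc: "euler_fin j (5 * Suc n) = euler_fin j (5 * n) * (1 - fps_X ^ (j * (5 * n + 1))) *
    (1 - fps_X ^ (j * (5 * n + 2))) * (1 - fps_X ^ (j * (5 * n + 3))) * (1 - fps_X ^ (j * (5 * n + 4))) *
    (1 - fps_X ^ (j * (5 * n + 5)))"
proof -
  have "5 * Suc n = Suc (Suc (Suc (Suc (Suc (5 * n)))))" by simp
  moreover have "Suc (5 * n) + 1 = 5 * n + 2" "Suc (Suc (5 * n)) + 1 = 5 * n + 3"
    "Suc (Suc (Suc (5 * n))) + 1 = 5 * n + 4" "Suc (Suc (Suc (Suc (5 * n)))) + 1 = 5 * n + 5"
    by simp_all
  ultimately show ?thesis by (simp only: euler_fin_Suc)
qed

lemma norm5_euler_fin: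
  assumes "\<not> 5 dvd j"
  shows   "norm5 w (euler_fin j (5 * n)) * euler_fin (25 * j) n = euler_fin (5 * j) (5 * n) * euler_fin (5 * j) n ^ 5"
proof (induction n)
  case 0
  thus ?case by (simp add: euler_fin_def norm5_def)
next
  case (Suc n)
  have 5: "prime (5::nat)" by simp
  have nd: "\<not> 5 dvd j * (5 * n + i)" if "i \<in> {1,2,3,4}" for i
  proof
    assume "5 dvd j * (5 * n + i)"
    hence "5 dvd 5 * n + i" using assms prime_dvd_mult_iff[OF 5] by blast
    hence "5 dvd i" by (simp add: dvd_add_right_iff)
    thus False using that by auto
  qed
  let ?g = "\<lambda>i. 1 - fps_X ^ (j * (5 * n + i)) :: complex fps"
  have g': "norm5 w (?g i) = 1 - fps_X ^ (5 * (j * (5 * n + i)))" if "i \<in> {1,2,3,4}" for i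
    using nd[OF that] norm5_one_minus_X_power by simp
  have d5: "5 dvd j * (5 * n + 5)" by simp
  have g: "norm5 w (?g 1) = 1 - fps_X ^ (5 * (j * (5 * n + 1)))" "norm5 w (?g 2) = 1 - fps_X ^ (5 * (j * (5 * n + 2)))"
    "norm5 w (?g 3) = 1 - fps_X ^ (5 * (j * (5 * n + 3)))" "norm5 w (?g 4) = 1 - fps_X ^ (5 * (j * (5 * n + 4)))"
    "norm5 w (?g 5) = (1 - fps_X ^ (j * (5 * n + 5))) ^ 5"
    by (rule g', simp, rule g', simp, rule g', simp, rule g', simp,
        simp only: norm5_one_minus_X_power d5 if_True)
  have "euler_fin j (5 * Suc n) = euler_fin j (5 * n) * ?g 1 * ?g 2 * ?g 3 * ?g 4 * ?g 5"
    by (rule euler_fin_5_Suc)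
  hence "norm5 w (euler_fin j (5 * Suc n)) = norm5 w (euler_fin j (5 * n)) *
      (1 - fps_X ^ (5 * (j * (5 * n + 1)))) * (1 - fps_X ^ (5 * (j * (5 * n + 2)))) *
      (1 - fps_X ^ (5 * (j * (5 * n + 3)))) * (1 - fps_X ^ (5 * (j * (5 * n + 4)))) *
      (1 - fps_X ^ (j * (5 * n + 5))) ^ 5"
    by (simp only: norm5_mult g)
  moreover have "euler_fin (5 * j) (5 * Suc n) = euler_fin (5 * j) (5 * n) *
      (1 - fps_X ^ (5 * (j * (5 * n + 1)))) * (1 - fps_X ^ (5 * (j * (5 * n + 2)))) *
      (1 - fps_X ^ (5 * (j * (5 * n + 3)))) * (1 - fps_X ^ (5 * (j * (5 * n + 4)))) * (1 - fps_X ^ (5 * (j * (5 * n + 5))))"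
    unfolding euler_fin_5_Suc by (simp only: mult.assoc)
  moreover have "euler_fin (25 * j) (Suc n) = euler_fin (25 * j) n * (1 - fps_X ^ (5 * (j * (5 * n + 5))))"
    by (simp add: euler_fin_Suc algebra_simps)
  moreover have "euler_fin (5 * j) (Suc n) ^ 5 = euler_fin (5 * j) n ^ 5 * (1 - fps_X ^ (j * (5 * n + 5))) ^ 5"
  proof -
    have "5 * j * (n + 1) = j * (5 * n + 5)" by (simp add: algebra_simps)
    thus ?thesis by (simp only: euler_fin_Suc power_mult_distrib)
  qed
  moreover have "N * a * b * c * d * e * (L * f) = (P * a * b * c * d * f) * (Q * e)"
    if "N * L = P * Q" for N L P Q a b c d e f :: "complex fps"
  proof -
    have "N * a * b * c * d * e * (L * f) = (N * L) * (a * b * c * d * e * f)" by (simp only: mult_ac)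
    thus ?thesis unfolding that by (simp only: mult_ac)
  qed
  ultimately show ?case using Suc.IH by simp
qed

text \<open>
  A factor \<open>1 - q\<^sup>m\<close> has norm \<open>1 - q\<^sup>5\<^sup>m\<close>, or its fifth power if 5 divides \<open>m\<close>. So the norm of
  \<open>E\<^sub>j\<close> is \<open>E\<^sub>5\<^sub>j\<close> without its factors of exponent divisible by 25, times the fifth power of
  \<open>E\<^sub>5\<^sub>j\<close>.
\<close>

lemma norm5_E:
  assumes "j > 0" "\<not> 5 dvd j"
  shows   "norm5 w (E j) * E (25 * j) = E (5 * j) ^ 6"
proof (rule fps_eqI_cong)
  fix n
  have "fps_cong n (norm5 w (E j) * E (25 * j)) (norm5 w (euler_fin j (5 * n)) * euler_fin (25 * j) n)"
    using assms by (intro fps_cong_mult norm5_cong E_cong') auto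
  also have "norm5 w (euler_fin j (5 * n)) * euler_fin (25 * j) n = euler_fin (5 * j) (5 * n) * euler_fin (5 * j) n ^ 5"
    by (rule norm5_euler_fin) fact
  also have "fps_cong n (euler_fin (5 * j) (5 * n) * euler_fin (5 * j) n ^ 5) (E (5 * j) * E (5 * j) ^ 5)"
    using assms by (intro fps_cong_mult fps_cong_power fps_cong_sym[OF E_cong']) auto
  also have "E (5 * j) * E (5 * j) ^ 5 = E (5 * j) ^ 6" by (simp add: eval_nat_numeral)
  finally show "fps_cong n (norm5 w (E j) * E (25 * j)) (E (5 * j) ^ 6)" .
qed

lemma norm5_phi_sections:
  defines "p \<equiv> phi oo fps_X ^ 5" and "u \<equiv> sect 1 phi" and "v \<equiv> sect 4 phi"
  shows "norm5 w phi = (p ^ 5 + fps_X * u ^ 5 + fps_X ^ 4 * v ^ 5 - 5 * fps_X * p ^ 3 * u * v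
           + 5 * fps_X ^ 2 * p * u ^ 2 * v ^ 2) oo fps_X ^ 5"
proof -
  define W where "W = fps_const w"
  define P where "P = p oo fps_X ^ 5"
  define U where "U = fps_X * (u oo fps_X ^ 5)"
  define V where "V = fps_X ^ 4 * (v oo fps_X ^ 5)"
  have W5: "W ^ 5 = 1" unfolding W_def by (rule fps_const_w_5)
  have phi: "phi = P + fps_X * (u oo fps_X ^ 5) + fps_X ^ 4 * (v oo fps_X ^ 5)"
    by (subst fps_eq_sects) (simp add: sum_lt_5 phi_sections P_def p_def u_def v_def)
  have "phi oo (fps_const (w ^ i) * fps_X) = P + W ^ i * U + (W ^ 4) ^ i * V" for i
    unfolding phi P_def
    by (simp add: fps_compose_add_distrib fps_compose_mult_distrib compose_X_5_rotate X_power_rotate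
         X_rotate U_def V_def W_def mult.assoc del: fps_const_power)
  hence "norm5 w phi = (P + U + V) * (P + W * U + W ^ 4 * V) * (P + W ^ 2 * U + (W ^ 4) ^ 2 * V) *
           (P + W ^ 3 * U + (W ^ 4) ^ 3 * V) * (P + W ^ 4 * U + (W ^ 4) ^ 4 * V)"
    by (simp add: norm5_def prod_lt_5)
  also have "(W ^ 4) ^ 2 = W ^ 5 * W ^ 3"
    by (simp add: eval_nat_numeral mult_ac)
  also have "(W ^ 4) ^ 3 = W ^ 5 * W ^ 5 * W ^ 2"
    by (simp add: eval_nat_numeral mult_ac)
  also have "(W ^ 4) ^ 4 = W ^ 5 * W ^ 5 * W ^ 5 * W"
    by (simp add: eval_nat_numeral mult_ac)
  also have "(P + U + V) * (P + W * U + W ^ 4 * V) * (P + W ^ 2 * U + W ^ 5 * W ^ 3 * V) *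
           (P + W ^ 3 * U + W ^ 5 * W ^ 5 * W ^ 2 * V) * (P + W ^ 4 * U + W ^ 5 * W ^ 5 * W ^ 5 * W * V)
         = P ^ 5 + U ^ 5 + V ^ 5 - 5 * P ^ 3 * U * V + 5 * P * U ^ 2 * V ^ 2"
    using trinomial_norm[OF fps_const_w_sum[folded W_def], of P U V] by (simp only: W5 mult_1_left)
  also have "\<dots> = (p ^ 5 + fps_X * u ^ 5 + fps_X ^ 4 * v ^ 5 - 5 * fps_X * p ^ 3 * u * v
           + 5 * fps_X ^ 2 * p * u ^ 2 * v ^ 2) oo fps_X ^ 5"
  proof -
    have "U ^ 5 = fps_X ^ 5 * (u oo fps_X ^ 5) ^ 5" "V ^ 5 = (fps_X ^ 5) ^ 4 * (v oo fps_X ^ 5) ^ 5"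
      "U * V = fps_X ^ 5 * (u oo fps_X ^ 5) * (v oo fps_X ^ 5)"
      by (simp_all add: U_def V_def power_mult_distrib flip: power_mult power_Suc mult.assoc)
    moreover have "P ^ 5 + U ^ 5 + V ^ 5 - 5 * P ^ 3 * U * V + 5 * P * U ^ 2 * V ^ 2
      = P ^ 5 + U ^ 5 + V ^ 5 - 5 * P ^ 3 * (U * V) + 5 * P * (U * V) ^ 2"
      by (simp add: power_mult_distrib mult.assoc)
    ultimately show ?thesis
      by (simp add: fps_compose_add_distrib fps_compose_sub_distrib fps_compose_mult_distrib
         fps_compose_power[symmetric] P_def power_mult_distrib mult.assoc)
  qed
  finally show ?thesis .
qed

text \<open>
  The trinomial norm is applied to \<open>E\<^sub>1\<close> after dividing the conjugates by \<open>w\<^sup>i\<close>, which makes the middle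
  component the fixed one; the product of the \<open>w\<^sup>i\<close> is \<open>w\<^sup>1\<^sup>0 = 1\<close>.
\<close>

lemma norm5_E1_sections:
  defines "a \<equiv> sect 0 (E 1)" and "c \<equiv> sect 2 (E 1)"
  shows "norm5 w (E 1) = (a ^ 5 - 11 * fps_X * E 5 ^ 5 + fps_X ^ 2 * c ^ 5) oo fps_X ^ 5"
proof -
  define W where "W = fps_const w"
  define P where "P = - (fps_X * (E 5 oo fps_X ^ 5))"
  define U where "U = fps_X ^ 2 * (c oo fps_X ^ 5)"
  define V where "V = a oo fps_X ^ 5"
  have W5: "W ^ 5 = 1" unfolding W_def by (rule fps_const_w_5)
  have "E 1 oo (fps_const (w ^ i) * fps_X) = V + W ^ i * P + (W ^ 2) ^ i * U" for i
    by (subst E1_dissect)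
       (simp add: fps_compose_add_distrib fps_compose_sub_distrib fps_compose_mult_distrib compose_X_5_rotate X_power_rotate
         X_rotate P_def U_def V_def W_def a_def c_def mult.assoc del: fps_const_power)
  hence "norm5 w (E 1) = (V + P + U) * (V + W * P + W ^ 2 * U) * (V + W ^ 2 * P + (W ^ 2) ^ 2 * U) *
           (V + W ^ 3 * P + (W ^ 2) ^ 3 * U) * (V + W ^ 4 * P + (W ^ 2) ^ 4 * U)"
    by (simp add: norm5_def prod_lt_5)
  \<comment> \<open>The terms with \<open>1 - W\<^sup>5 = 0\<close> make these rewriting steps polynomial identities.\<close>
  also have "V + W * P + W ^ 2 * U = W * (P + W * U + W ^ 4 * V) + (1 - W ^ 5) * V"
    by (simp add: algebra_simps eval_nat_numeral)
  also have "V + W ^ 2 * P + (W ^ 2) ^ 2 * U = W ^ 2 * (P + W ^ 2 * U + W ^ 3 * V) + (1 - W ^ 5) * V"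
    by (simp add: algebra_simps eval_nat_numeral)
  also have "V + W ^ 3 * P + (W ^ 2) ^ 3 * U = W ^ 3 * (P + W ^ 3 * U + W ^ 2 * V) + (1 - W ^ 5) * V"
    by (simp add: algebra_simps eval_nat_numeral)
  also have "V + W ^ 4 * P + (W ^ 2) ^ 4 * U = W ^ 4 * (P + W ^ 4 * U + W * V) + (1 - W ^ 5) * V"
    by (simp add: algebra_simps eval_nat_numeral)
  also have "(V + P + U) * (W * (P + W * U + W ^ 4 * V) + (1 - W ^ 5) * V) *
      (W ^ 2 * (P + W ^ 2 * U + W ^ 3 * V) + (1 - W ^ 5) * V) *
      (W ^ 3 * (P + W ^ 3 * U + W ^ 2 * V) + (1 - W ^ 5) * V) *
      (W ^ 4 * (P + W ^ 4 * U + W * V) + (1 - W ^ 5) * V)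
     = (W * W ^ 2 * W ^ 3 * W ^ 4) * ((P + U + V) * (P + W * U + W ^ 4 * V) * (P + W ^ 2 * U + W ^ 3 * V) *
           (P + W ^ 3 * U + W ^ 2 * V) * (P + W ^ 4 * U + W * V))"
    unfolding W5 by (simp add: mult_ac add_ac)
  also have "W * W ^ 2 * W ^ 3 * W ^ 4 = W ^ 5 * W ^ 5" by (simp add: eval_nat_numeral mult_ac)
  also have "(P + U + V) * (P + W * U + W ^ 4 * V) * (P + W ^ 2 * U + W ^ 3 * V) *
           (P + W ^ 3 * U + W ^ 2 * V) * (P + W ^ 4 * U + W * V)
      = P ^ 5 + U ^ 5 + V ^ 5 - 5 * P ^ 3 * U * V + 5 * P * U ^ 2 * V ^ 2"
    unfolding W_def by (rule trinomial_norm[OF fps_const_w_sum])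
  also have "W ^ 5 * W ^ 5 * (P ^ 5 + U ^ 5 + V ^ 5 - 5 * P ^ 3 * U * V + 5 * P * U ^ 2 * V ^ 2)
      = P ^ 5 + U ^ 5 + V ^ 5 - 5 * P ^ 3 * (U * V) + 5 * P * (U * V) ^ 2"
    unfolding W5 by (simp add: power_mult_distrib mult.assoc)
  also have "U * V = - (P ^ 2)"
  proof -
    have "U * V = fps_X ^ 2 * ((a * c) oo fps_X ^ 5)"
      by (simp add: U_def V_def fps_compose_mult_distrib mult_ac)
    also have "a * c = - (E 5 ^ 2)" unfolding a_def c_def by (rule E1_sections_prod)
    finally show ?thesis
      by (simp add: P_def fps_compose_uminus fps_compose_power power_mult_distrib)
  qed
  also have "P ^ 5 + U ^ 5 + V ^ 5 - 5 * P ^ 3 * - (P ^ 2) + 5 * P * (- (P ^ 2)) ^ 2 = V ^ 5 + 11 * P ^ 5 + U ^ 5"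
    by (simp add: eval_nat_numeral algebra_simps)
  also have "\<dots> = (a ^ 5 - 11 * fps_X * E 5 ^ 5 + fps_X ^ 2 * c ^ 5) oo fps_X ^ 5"
  proof -
    have "P ^ 5 = - (fps_X ^ 5 * (E 5 oo fps_X ^ 5) ^ 5)" "U ^ 5 = (fps_X ^ 5) ^ 2 * (c oo fps_X ^ 5) ^ 5"
      by (simp_all add: P_def U_def power_mult_distrib power_minus_odd flip: power_mult)
    thus ?thesis
      by (simp add: fps_compose_add_distrib fps_compose_sub_distrib fps_compose_mult_distrib
         fps_compose_power[symmetric] V_def mult.assoc)
  qed
  finally show ?thesis .
qed

end

lemma ex_primitive_fifth_root: "\<exists>w :: complex. w ^ 5 = 1 \<and> w \<noteq> 1"
proof -
  have c: "card {w :: complex. w ^ 5 = 1} = 5" by (rule card_roots_unity_eq) simp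
  have "\<not> {w :: complex. w ^ 5 = 1} \<subseteq> {1}"
  proof
    assume "{w :: complex. w ^ 5 = 1} \<subseteq> {1}"
    hence "card {w :: complex. w ^ 5 = 1} \<le> card {1 :: complex}" by (intro card_mono) auto
    thus False unfolding c by simp
  qed
  thus ?thesis by blast
qed

lemma E1_sections_norm:
  "(sect 0 (E 1) ^ 5 - 11 * fps_X * E 5 ^ 5 + fps_X ^ 2 * sect 2 (E 1) ^ 5) * E 5 = E 1 ^ 6"
proof -
  obtain w :: complex where w: "w ^ 5 = 1" "w \<noteq> 1" using ex_primitive_fifth_root by blast
  have "norm5 w (E 1) * E 25 = E 5 ^ 6" using norm5_E[OF w, of 1] by simp
  hence "((sect 0 (E 1) ^ 5 - 11 * fps_X * E 5 ^ 5 + fps_X ^ 2 * sect 2 (E 1) ^ 5) * E 5) oo fps_X ^ 5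
      = E 1 ^ 6 oo fps_X ^ 5"
    unfolding norm5_E1_sections[OF w]
    by (simp add: fps_compose_mult_distrib fps_compose_power[symmetric] E_compose_X_power)
  thus ?thesis by (rule fps_compose_X_power_inj) simp
qed

lemma phi_X5_E10: "(phi oo fps_X ^ 5) * E 10 = E 5 ^ 2"
proof -
  have "(phi * E 2) oo fps_X ^ 5 = E 1 ^ 2 oo fps_X ^ 5" unfolding phi_E2 ..
  thus ?thesis by (simp add: fps_compose_mult_distrib fps_compose_power[symmetric] E_compose_X_power)
qed

text \<open>
  The norm is multiplicative, so the norm of \<open>\<phi> = E\<^sub>1\<^sup>2/E\<^sub>2\<close> is \<open>\<phi>(-q\<^sup>5)\<^sup>6/\<phi>(-q\<^sup>2\<^sup>5)\<close>; the claim is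
  its image under \<open>q\<^sup>5 \<mapsto> q\<close>.
\<close>

lemma phi_sections_norm:
  defines "p \<equiv> phi oo fps_X ^ 5" and "u \<equiv> sect 1 phi" and "v \<equiv> sect 4 phi"
  shows "(p ^ 5 + fps_X * u ^ 5 + fps_X ^ 4 * v ^ 5 - 5 * fps_X * p ^ 3 * u * v
           + 5 * fps_X ^ 2 * p * u ^ 2 * v ^ 2) * p = phi ^ 6"
proof -
  obtain w :: complex where w: "w ^ 5 = 1" "w \<noteq> 1" using ex_primitive_fifth_root by blast
  define M where "M = p ^ 5 + fps_X * u ^ 5 + fps_X ^ 4 * v ^ 5 - 5 * fps_X * p ^ 3 * u * v
           + 5 * fps_X ^ 2 * p * u ^ 2 * v ^ 2"
  have n: "norm5 w phi = M oo fps_X ^ 5"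
    unfolding M_def p_def u_def v_def by (rule norm5_phi_sections[OF w])
  have 1: "norm5 w (E 1) * E 25 = E 5 ^ 6" using norm5_E[OF w, of 1] by simp
  have 2: "norm5 w (E 2) * E 50 = E 10 ^ 6" using norm5_E[OF w, of 2] by simp
  have "norm5 w phi * norm5 w (E 2) = norm5 w (E 1) ^ 2"
    using arg_cong[OF phi_E2, of "norm5 w"] by (simp add: norm5_mult norm5_power)
  hence "norm5 w phi * norm5 w (E 2) * (E 50 * E 25 ^ 2) = norm5 w (E 1) ^ 2 * (E 50 * E 25 ^ 2)" by simp
  hence "norm5 w phi * (norm5 w (E 2) * E 50) * E 25 ^ 2 = (norm5 w (E 1) * E 25) ^ 2 * E 50"
    by (simp add: power_mult_distrib mult_ac)
  hence "norm5 w phi * E 10 ^ 6 * E 25 ^ 2 = E 5 ^ 12 * E 50"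
    unfolding 1 2 by (simp flip: power_mult)
  hence "(M * E 2 ^ 6 * E 5 ^ 2) oo fps_X ^ 5 = (E 1 ^ 12 * E 10) oo fps_X ^ 5"
    unfolding n by (simp add: fps_compose_mult_distrib fps_compose_power[symmetric] E_compose_X_power)
  hence "M * E 2 ^ 6 * E 5 ^ 2 = E 1 ^ 12 * E 10" by (rule fps_compose_X_power_inj) simp
  moreover have "E 5 ^ 2 = p * E 10" using phi_X5_E10 by (simp add: p_def)
  moreover have "E 1 ^ 12 = phi ^ 6 * E 2 ^ 6"
    using arg_cong[OF phi_E2, of "\<lambda>x. x ^ 6"] by (simp add: power_mult_distrib flip: power_mult)
  ultimately have "M * p * (E 2 ^ 6 * E 10) = phi ^ 6 * (E 2 ^ 6 * E 10)"
    by (simp add: mult_ac)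
  thus ?thesis unfolding M_def by simp
qed

section \<open>The even part of $\nu(-q)$\<close>

lemma summable_on_fps_X_power:
  fixes h :: "'b \<Rightarrow> complex fps"
  assumes "\<And>n. finite {x\<in>A. g x \<le> n}"
  shows   "(\<lambda>x. fps_X ^ g x * h x) summable_on A"
proof (rule summable_on_fpsI)
  fix n
  have "{x\<in>A. fps_nth (fps_X ^ g x * h x) n \<noteq> 0} \<subseteq> {x\<in>A. g x \<le> n}"
    by (auto simp: fps_X_power_mult_nth split: if_splits)
  thus "finite {x\<in>A. fps_nth (fps_X ^ g x * h x) n \<noteq> 0}"
    using assms finite_subset by blast
qed

lemma summable_on_fps_X_power_nat:
  fixes h :: "nat \<Rightarrow> complex fps"
  assumes "\<And>m. m \<le> g m + c"
  shows   "(\<lambda>m. fps_X ^ g m * h m) summable_on UNIV"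
proof (rule summable_on_fps_X_power)
  fix n
  have "{m \<in> UNIV. g m \<le> n} \<subseteq> {..n + c}"
  proof
    fix m assume "m \<in> {m \<in> UNIV. g m \<le> n}"
    thus "m \<in> {..n + c}" using assms[of m] by simp
  qed
  thus "finite {m \<in> UNIV. g m \<le> n}" using finite_subset by blast
qed

lemma has_sum_nat_shift:
  fixes f :: "nat \<Rightarrow> complex fps"
  assumes "((\<lambda>k. f (Suc k)) has_sum s) UNIV"
  shows   "(f has_sum (f 0 + s)) UNIV"
proof -
  have "(f has_sum s) (range Suc)"
    using assms by (subst has_sum_reindex) (auto simp: o_def)
  hence "(f has_sum (f 0 + s)) (insert 0 (range Suc))"
    by (intro has_sum_insert) auto
  moreover have "insert 0 (range Suc) = UNIV"
    using not0_implies_Suc by blast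
  ultimately show ?thesis by simp
qed

definition inv_euler2 :: "nat \<Rightarrow> complex fps" where
  "inv_euler2 m = inverse (euler_fin 2 m)"

lemma inv_euler2_0 [simp]: "inv_euler2 0 = 1"
  by (simp add: inv_euler2_def euler_fin_def)

lemma inv_euler2_Suc: "inv_euler2 (Suc m) = inv_euler2 m + fps_X ^ (2 * Suc m) * inv_euler2 (Suc m)"
proof -
  have "euler_fin 2 (Suc m) * inv_euler2 (Suc m) = 1" "euler_fin 2 m * inv_euler2 m = 1"
    unfolding inv_euler2_def by (rule inverse_mult_eq_1'; simp)+
  hence "euler_fin 2 m * ((1 - fps_X ^ (2 * Suc m)) * inv_euler2 (Suc m)) = euler_fin 2 m * inv_euler2 m"
    by (simp add: euler_fin_Suc mult.assoc)
  hence "(1 - fps_X ^ (2 * Suc m)) * inv_euler2 (Suc m) = inv_euler2 m" by (subst (asm) mult_cancel_left) simp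
  thus ?thesis by (simp add: algebra_simps)
qed

text \<open>
  The series of \<open>q\<^bsup>g m\<^esup>/(q\<^sup>2;q\<^sup>2)\<^sub>m\<close>; Euler's two product expansions are the cases where \<open>g\<close> is
  linear or quadratic.
\<close>

definition euler_sum :: "(nat \<Rightarrow> nat) \<Rightarrow> complex fps" where
  "euler_sum g = infsum (\<lambda>m. fps_X ^ g m * inv_euler2 m) UNIV"

lemma has_sum_euler_sum:
  assumes "\<And>m. m \<le> g m + c"
  shows   "((\<lambda>m. fps_X ^ g m * inv_euler2 m) has_sum euler_sum g) UNIV"
  unfolding euler_sum_def by (intro has_sum_infsum summable_on_fps_X_power_nat[of _ c] assms)

text \<open>
  Write \<open>1/(q\<^sup>2;q\<^sup>2)\<^sub>m = 1/(q\<^sup>2;q\<^sup>2)\<^sub>m\<^sub>-\<^sub>1 + q\<^sup>2\<^sup>m/(q\<^sup>2;q\<^sup>2)\<^sub>m\<close> in each term. The bounds on the exponents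
  only ensure convergence.
\<close>

lemma euler_sum_rec:
  assumes bd: "\<And>m. m \<le> f m + c" "\<And>m. m \<le> g m + c" "\<And>m. m \<le> h m + c"
    and g: "\<And>m. f m + 2 * m = g m + a" and h: "\<And>m. f (Suc m) = h m + b"
  shows "euler_sum f = fps_X ^ a * euler_sum g + fps_X ^ b * euler_sum h"
proof -
  let ?t = "\<lambda>m. case m of 0 \<Rightarrow> 0 | Suc k \<Rightarrow> fps_X ^ b * (fps_X ^ h k * inv_euler2 k)"
  have "(?t has_sum (?t 0 + fps_X ^ b * euler_sum h)) UNIV"
    by (rule has_sum_nat_shift) (simp add: has_sum_cmult_right has_sum_euler_sum[OF bd(3)])
  hence "((\<lambda>m. fps_X ^ a * (fps_X ^ g m * inv_euler2 m) + ?t m) has_sum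
            (fps_X ^ a * euler_sum g + fps_X ^ b * euler_sum h)) UNIV"
    by (intro has_sum_add has_sum_cmult_right has_sum_euler_sum[OF bd(2)]) simp
  moreover have "fps_X ^ a * (fps_X ^ g m * inv_euler2 m) + ?t m = fps_X ^ f m * inv_euler2 m" for m
  proof -
    have 1: "fps_X ^ a * (fps_X ^ g m * inv_euler2 m) = fps_X ^ f m * (fps_X ^ (2 * m) * inv_euler2 m)"
      using g[of m] by (simp add: mult.assoc[symmetric] add.commute flip: power_add)
    have 2: "?t m = fps_X ^ f m * (if m = 0 then 0 else inv_euler2 (m - 1))"
      using h by (cases m) (simp_all add: power_add mult_ac)
    have 3: "inv_euler2 m = (if m = 0 then 0 else inv_euler2 (m - 1)) + fps_X ^ (2 * m) * inv_euler2 m"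
      using inv_euler2_Suc[of "m - 1"] by (cases m) auto
    show ?thesis
      unfolding 1 2 distrib_left[symmetric] by (rule arg_cong[of _ _ "\<lambda>x. fps_X ^ f m * x"], subst add.commute) (rule 3[symmetric])
  qed
  ultimately have "((\<lambda>m. fps_X ^ f m * inv_euler2 m) has_sum
            (fps_X ^ a * euler_sum g + fps_X ^ b * euler_sum h)) UNIV" by simp
  thus ?thesis using has_sum_euler_sum[OF bd(1)] has_sum_unique by blast
qed

lemma euler_sum_cong_1:
  assumes "g 0 = 0" "\<And>m. m > 0 \<Longrightarrow> n \<le> g m" "\<And>m. m \<le> g m"
  shows   "fps_cong n (euler_sum g) 1"
proof (rule has_sum_cong_fps)
  show "((\<lambda>m. fps_X ^ g m * inv_euler2 m) has_sum euler_sum g) UNIV"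
    using assms(3) by (intro has_sum_euler_sum[of _ 0]) auto
  show "((\<lambda>m. if m = 0 then 1 else 0) has_sum (1 :: complex fps)) (UNIV :: nat set)"
    by (rule has_sum_finite_neutralI[of "{0}"]) auto
  show "fps_cong n (fps_X ^ g m * inv_euler2 m) (if m = 0 then 1 else 0)" for m
    using assms by (auto intro: fps_cong_X_power_0)
qed

text \<open>
  With \<open>Q = q\<^sup>2\<close>, the three series are, in this order, \<open>1/(q\<^sup>2\<^sup>n\<^sup>+\<^sup>1;Q)\<^sub>\<infinity>\<close>, \<open>(-q\<^sup>2\<^sup>n\<^sup>+\<^sup>1;Q)\<^sub>\<infinity>\<close> and
  \<open>(-q;Q)\<^sub>n (-q;Q)\<^sub>\<infinity>\<close>, as the recurrences below show. Up to a power of \<open>q\<close>, \<open>U_sum\<close> is \<open>T_sum\<close>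
  continued to negative \<open>n\<close>.
\<close>

definition V_sum :: "nat \<Rightarrow> complex fps" where "V_sum n = euler_sum (\<lambda>m. m * (2 * n + 1))"
definition U_sum :: "nat \<Rightarrow> complex fps" where "U_sum n = euler_sum (\<lambda>m. m ^ 2 + 2 * m * n)"
definition T_sum :: "nat \<Rightarrow> complex fps" where "T_sum n = euler_sum (\<lambda>m. nat ((int m - int n) ^ 2))"

lemma V_sum_rec: "(1 - fps_X ^ (2 * n + 1)) * V_sum n = V_sum (n + 1)"
proof -
  have "V_sum n = fps_X ^ 0 * V_sum (n + 1) + fps_X ^ (2 * n + 1) * V_sum n"
    unfolding V_sum_def by (rule euler_sum_rec[of _ 0]) (simp_all add: algebra_simps)
  thus ?thesis by (simp add: algebra_simps)
qed

lemma U_sum_rec: "U_sum n = (1 + fps_X ^ (2 * n + 1)) * U_sum (n + 1)"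
proof -
  have "U_sum n = fps_X ^ 0 * U_sum (n + 1) + fps_X ^ (2 * n + 1) * U_sum (n + 1)"
    unfolding U_sum_def
  proof (rule euler_sum_rec[of _ 0])
    show "m \<le> m ^ 2 + 2 * m * k + 0" for m k :: nat
      by (cases m) (auto simp: power2_eq_square)
    thus "m \<le> m ^ 2 + 2 * m * (n + 1) + 0" for m .
  qed (simp_all add: algebra_simps power2_eq_square)
  thus ?thesis by (simp add: algebra_simps)
qed

lemma T_sum_bound: "m \<le> nat ((int m - int n) ^ 2) + n"
  using square_ge_int(1)[of "int m - int n"] by linarith

lemma T_sum_rec: "T_sum (n + 1) = (1 + fps_X ^ (2 * n + 1)) * T_sum n"
proof -
  have "T_sum (n + 1) = fps_X ^ (2 * n + 1) * T_sum n + fps_X ^ 0 * T_sum n"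
    unfolding T_sum_def
  proof (rule euler_sum_rec[of _ "n + 1"])
    fix m
    show "m \<le> nat ((int m - int (n + 1)) ^ 2) + (n + 1)" by (rule T_sum_bound)
    show "m \<le> nat ((int m - int n) ^ 2) + (n + 1)" "m \<le> nat ((int m - int n) ^ 2) + (n + 1)"
      using T_sum_bound[of m n] by linarith+
    have "(int m - int (n + 1)) ^ 2 + 2 * int m = (int m - int n) ^ 2 + int (2 * n + 1)"
      by (simp add: power2_eq_square algebra_simps)
    thus "nat ((int m - int (n + 1)) ^ 2) + 2 * m = nat ((int m - int n) ^ 2) + (2 * n + 1)"
      using zero_le_power2[of "int m - int (n + 1)"] zero_le_power2[of "int m - int n"] by linarith
  qed simp
  thus ?thesis by (simp add: algebra_simps)
qed

lemma V_sum_0: "lin_prod (-1) 2 1 n * V_sum 0 = V_sum n"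
proof (induction n)
  case (Suc n)
  have "lin_prod (-1) 2 1 (Suc n) * V_sum 0 = (1 - fps_X ^ (2 * n + 1)) * (lin_prod (-1) 2 1 n * V_sum 0)"
    by (simp add: lin_prod_Suc mult_ac flip: fps_const_neg)
  thus ?case unfolding Suc.IH V_sum_rec by simp
qed simp

lemma U_sum_0: "lin_prod 1 2 1 n * U_sum n = U_sum 0"
proof (induction n)
  case (Suc n)
  have "lin_prod 1 2 1 (Suc n) * U_sum (Suc n) = lin_prod 1 2 1 n * ((1 + fps_X ^ (2 * n + 1)) * U_sum (n + 1))"
    by (simp add: lin_prod_Suc mult_ac)
  thus ?case unfolding U_sum_rec[symmetric] Suc.IH .
qed simp

lemma T_sum_eq: "T_sum n = lin_prod 1 2 1 n * U_sum 0"
proof (induction n)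
  case 0
  show ?case by (simp add: T_sum_def U_sum_def power2_eq_square nat_mult_distrib)
next
  case (Suc n)
  have "T_sum (Suc n) = (1 + fps_X ^ (2 * n + 1)) * T_sum n" using T_sum_rec by simp
  thus ?case unfolding Suc.IH by (simp add: lin_prod_Suc mult_ac)
qed

lemma V_sum_E: "V_sum 0 * E 1 = E 2"
proof (rule fps_eqI_cong)
  fix n
  have "fps_cong n (V_sum 0 * E 1) (V_sum 0 * lin_prod (-1) 1 1 (n * 2))"
    by (intro fps_cong_mult E_cong_lin_prod) auto
  also have "V_sum 0 * lin_prod (-1) 1 1 (n * 2) = lin_prod (-1) 2 1 n * V_sum 0 * lin_prod (-1) 2 2 n"
    unfolding lin_prod_group by (simp add: prod_lt_2 mult_ac flip: numeral_2_eq_2)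
  also have "lin_prod (-1) 2 1 n * V_sum 0 = V_sum n" by (rule V_sum_0)
  also have "fps_cong n (V_sum n * lin_prod (-1) 2 2 n) (1 * E 2)"
  proof (intro fps_cong_mult fps_cong_sym[OF E_cong_lin_prod])
    show "fps_cong n (V_sum n) 1"
      unfolding V_sum_def
    proof (rule euler_sum_cong_1)
      show "n \<le> m * (2 * n + 1)" if "m > 0" for m using that by (cases m) auto
    qed auto
  qed auto
  finally show "fps_cong n (V_sum 0 * E 1) (E 2)" by simp
qed

lemma U_sum_E: "U_sum 0 * (E 1 * E 4) = E 2 ^ 2"
proof (rule fps_eqI_cong)
  fix n
  have "fps_cong n (U_sum n) 1"
    unfolding U_sum_def
  proof (rule euler_sum_cong_1)
    fix m :: nat
    show "m \<le> m ^ 2 + 2 * m * n" by (cases m) (auto simp: power2_eq_square)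
    show "n \<le> m ^ 2 + 2 * m * n" if "m > 0" using that by (cases m) auto
  qed simp
  hence "fps_cong n (lin_prod 1 2 1 n * U_sum n * (E 1 * E 4))
     (lin_prod 1 2 1 n * 1 * (lin_prod (-1) 1 1 (n * 2) * lin_prod (-1) 4 4 n))"
    by (intro fps_cong_mult E_cong_lin_prod fps_cong_refl) auto
  also have "lin_prod 1 2 1 n * U_sum n = U_sum 0" by (rule U_sum_0)
  also have "lin_prod 1 2 1 n * 1 * (lin_prod (-1) 1 1 (n * 2) * lin_prod (-1) 4 4 n)
     = (lin_prod 1 2 1 n * lin_prod (-1) 2 1 n) * lin_prod (-1) 4 4 n * lin_prod (-1) 2 2 n"
    unfolding lin_prod_group by (simp add: prod_lt_2 mult_ac flip: numeral_2_eq_2)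
  also have "(lin_prod 1 2 1 n * lin_prod (-1) 2 1 n) * lin_prod (-1) 4 4 n = lin_prod (-1) 2 2 (n * 2)"
    unfolding lin_prod_group lin_prod_conj by (simp add: prod_lt_2 flip: numeral_2_eq_2)
  also have "fps_cong n (lin_prod (-1) 2 2 (n * 2) * lin_prod (-1) 2 2 n) (E 2 * E 2)"
    by (intro fps_cong_mult fps_cong_sym[OF E_cong_lin_prod]) auto
  finally show "fps_cong n (U_sum 0 * (E 1 * E 4)) (E 2 ^ 2)" by (simp add: power2_eq_square)
qed

text \<open>
  The series \<open>\<nu>(-q)\<close>.
\<close>

definition nu_minus :: "complex fps" where "nu_minus = Abs_fps p_nu"

lemma qpoch_eq_lin_prod: "qpoch fps_X (fps_X ^ 2) n = lin_prod (-1) 2 1 n"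
  unfolding qpoch_def lin_prod_def
proof (intro prod.cong refl)
  fix k
  have "fps_X * (fps_X ^ 2) ^ k = (fps_X ^ (2 * k + 1) :: complex fps)"
    unfolding power_mult[symmetric] by simp
  thus "1 - fps_X * (fps_X ^ 2) ^ k = 1 + fps_const (-1) * (fps_X ^ (2 * k + 1) :: complex fps)"
    by (simp only: fps_const_neg[symmetric]) simp
qed

text \<open>
  The series of \<open>(-q;q\<^sup>2)\<^sub>n z\<^sup>n\<close> at \<open>z = q\<^sup>2\<^sup>j\<^sup>+\<^sup>1\<close>.
\<close>

definition lin_sum :: "nat \<Rightarrow> complex fps" where
  "lin_sum j = infsum (\<lambda>n. fps_X ^ ((2 * j + 1) * n) * lin_prod 1 2 1 n) UNIV"

lemma has_sum_lin_sum: "((\<lambda>n. fps_X ^ ((2 * j + 1) * n) * lin_prod 1 2 1 n) has_sum lin_sum j) UNIV"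
  unfolding lin_sum_def by (intro has_sum_infsum summable_on_fps_X_power_nat[of _ 0]) simp

lemma lin_sum_rec: "(1 - fps_X ^ (2 * j + 1)) * lin_sum j = 1 + fps_X ^ (2 * j + 2) * lin_sum (j + 1)"
proof -
  define f where "f = (\<lambda>j n. fps_X ^ ((2 * j + 1) * n) * lin_prod 1 2 1 n)"
  have f: "(f j has_sum lin_sum j) UNIV" for j
    unfolding f_def by (rule has_sum_lin_sum)
  have "f j (Suc n) = fps_X ^ (2 * j + 1) * f j n + fps_X ^ (2 * j + 2) * f (j + 1) n" for n
  proof -
    have "f j (Suc n) = fps_X ^ (2 * j + 1) * f j n + (fps_X ^ ((2 * j + 1) * Suc n) * fps_X ^ (2 * n + 1)) * lin_prod 1 2 1 n"
      by (simp add: f_def lin_prod_Suc algebra_simps power_add)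
    also have "fps_X ^ ((2 * j + 1) * Suc n) * fps_X ^ (2 * n + 1) = fps_X ^ (2 * j + 2) * (fps_X ^ ((2 * (j + 1) + 1) * n) :: complex fps)"
      unfolding power_add[symmetric] by (intro arg_cong[of _ _ "power fps_X"]) (simp add: algebra_simps)
    finally show ?thesis by (simp add: f_def mult.assoc)
  qed
  moreover have "((\<lambda>n. fps_X ^ (2 * j + 1) * f j n + fps_X ^ (2 * j + 2) * f (j + 1) n) has_sum
      (fps_X ^ (2 * j + 1) * lin_sum j + fps_X ^ (2 * j + 2) * lin_sum (j + 1))) UNIV"
    by (intro has_sum_add has_sum_cmult_right f)
  ultimately have "(f j has_sum (f j 0 + (fps_X ^ (2 * j + 1) * lin_sum j + fps_X ^ (2 * j + 2) * lin_sum (j + 1)))) UNIV"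
    by (intro has_sum_nat_shift) simp
  hence "lin_sum j = f j 0 + (fps_X ^ (2 * j + 1) * lin_sum j + fps_X ^ (2 * j + 2) * lin_sum (j + 1))"
    using f has_sum_unique by blast
  moreover have "f j 0 = 1" by (simp add: f_def)
  ultimately show ?thesis by (simp add: algebra_simps)
qed

text \<open>
  The recurrence for \<open>lin_sum\<close> iterated \<open>J\<close> times; the remainder has order at least \<open>J(J + 1)\<close>.
\<close>

lemma lin_sum_partial:
  "lin_sum 0 = (\<Sum>j<J. fps_X ^ (j * (j + 1)) / qpoch fps_X (fps_X ^ 2) (j + 1))
     + fps_X ^ (J * (J + 1)) * (lin_sum J / qpoch fps_X (fps_X ^ 2) J)"
proof (induction J)
  case 0
  show ?case by (simp add: qpoch_def)
next
  case (Suc J)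
  define q where "q = qpoch fps_X (fps_X ^ 2 :: complex fps)"
  define i where "i = (\<lambda>n. inverse (q n))"
  have q0: "fps_nth (q n) 0 \<noteq> 0" for n unfolding q_def by simp
  have div: "f / q n = f * i n" for f n unfolding i_def by (rule fps_divide_unit[OF q0])
  have qi: "q n * i n = 1" for n unfolding i_def by (rule inverse_mult_eq_1'[OF q0])
  have qS: "q (Suc J) = q J * (1 - fps_X ^ (2 * J + 1))"
    unfolding q_def qpoch_eq_lin_prod by (simp add: lin_prod_Suc flip: fps_const_neg)
  have "q J * (lin_sum J * i J) = lin_sum J * (q J * i J)" by (simp only: mult_ac)
  also have "\<dots> = q (Suc J) * i (Suc J) * lin_sum J" by (simp add: qi)
  also have "\<dots> = q J * (i (Suc J) * ((1 - fps_X ^ (2 * J + 1)) * lin_sum J))" unfolding qS by (simp only: mult_ac)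
  finally have "lin_sum J * i J = i (Suc J) * ((1 - fps_X ^ (2 * J + 1)) * lin_sum J)"
    using q0[of J] by (subst (asm) mult_cancel_left) auto
  also have "\<dots> = i (Suc J) + fps_X ^ (2 * J + 2) * (lin_sum (Suc J) * i (Suc J))"
    unfolding lin_sum_rec by (simp add: algebra_simps)
  finally have step: "lin_sum J * i J = \<dots>" .
  have e: "fps_X ^ (J * (J + 1)) * fps_X ^ (2 * J + 2) = (fps_X ^ (Suc J * (Suc J + 1)) :: complex fps)"
    unfolding power_add[symmetric] by (intro arg_cong[of _ _ "power fps_X"]) (simp add: algebra_simps)
  have "fps_X ^ (J * (J + 1)) * (lin_sum J * i J) = fps_X ^ (J * (J + 1)) * i (Suc J) +
      (fps_X ^ (J * (J + 1)) * fps_X ^ (2 * J + 2)) * (lin_sum (Suc J) * i (Suc J))"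
    unfolding step by (simp only: distrib_left mult.assoc)
  thus ?case
    using Suc.IH unfolding q_def[symmetric] div e by (simp del: mult_Suc mult_Suc_right power_Suc)
qed

lemma nu_minus_eq_lin_sum: "nu_minus = lin_sum 0"
proof (rule fps_ext)
  fix n
  let ?S = "\<lambda>J. \<Sum>j<J. fps_X ^ (j * (j + 1)) / qpoch fps_X (fps_X ^ 2) (j + 1) :: complex fps"
  have "?S \<longlonglongrightarrow> nu_minus" using p_nu_sums unfolding sums_def nu_minus_def .
  hence "eventually (\<lambda>J. fps_nth (?S J) n = fps_nth nu_minus n) sequentially"
    unfolding tendsto_fps_iff by blast
  moreover have "eventually (\<lambda>J. J > n) sequentially" by (rule eventually_gt_at_top)
  ultimately have "eventually (\<lambda>J. J > n \<and> fps_nth (?S J) n = fps_nth nu_minus n) sequentially"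
    by eventually_elim auto
  then obtain J where J: "J > n" "fps_nth (?S J) n = fps_nth nu_minus n"
    unfolding eventually_sequentially by blast
  have "n < J * (J + 1)" using J(1) by (metis less_le_trans le_add1 mult_Suc_right Suc_eq_plus1)
  hence "fps_nth (fps_X ^ (J * (J + 1)) * (lin_sum J / qpoch fps_X (fps_X ^ 2) J)) n = 0"
    by (simp only: fps_X_power_mult_nth if_True)
  thus "fps_nth nu_minus n = fps_nth (lin_sum 0) n"
    using J(2) by (subst lin_sum_partial[of J]) simp
qed

text \<open>
  The series \<open>\<nu>(q)\<close>.
\<close>

definition nu_plus :: "complex fps" where
  "nu_plus = infsum (\<lambda>n. fps_X ^ (n * (n + 1)) * inverse (lin_prod 1 2 1 (n + 1))) UNIV"

lemma has_sum_nu_plus: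
  "((\<lambda>n. fps_X ^ (n * (n + 1)) * inverse (lin_prod 1 2 1 (n + 1))) has_sum nu_plus) UNIV"
  unfolding nu_plus_def by (intro has_sum_infsum summable_on_fps_X_power_nat[of _ 0]) simp

lemma nu_plus_eq: "nu_plus = nu_minus oo (- fps_X)"
proof -
  let ?L = "- fps_X :: complex fps"
  let ?f = "\<lambda>n. fps_X ^ (n * (n + 1)) / qpoch fps_X (fps_X ^ 2) (n + 1) :: complex fps"
  have "(\<lambda>n. ?f n oo ?L) sums (nu_minus oo ?L)"
    unfolding sums_def tendsto_fps_iff
  proof
    fix n
    have "eventually (\<lambda>J. fps_nth (\<Sum>j<J. ?f j) n = fps_nth nu_minus n) sequentially"
      using p_nu_sums unfolding sums_def nu_minus_def tendsto_fps_iff by blast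
    thus "eventually (\<lambda>J. fps_nth (\<Sum>j<J. ?f j oo ?L) n = fps_nth (nu_minus oo ?L) n) sequentially"
      by eventually_elim (simp only: fps_compose_sum_distrib[symmetric], simp only: fps_compose_uminus' fps_nth_Abs_fps)
  qed
  moreover have "?f n oo ?L = fps_X ^ (n * (n + 1)) * inverse (lin_prod 1 2 1 (n + 1))" for n
  proof -
    have l: "lin_prod (-1) 2 1 k oo ?L = lin_prod 1 2 1 k" for k
    proof (induction k)
      case (Suc k)
      have "fps_X ^ (2 * k + 1) oo ?L = - (fps_X ^ (2 * k + 1))"
        by (subst fps_X_power_compose) (simp_all add: power_minus_odd del: power_Suc)
      thus ?case using Suc.IH
        by (simp add: lin_prod_Suc fps_compose_mult_distrib fps_compose_add_distrib fps_compose_sub_distrib del: power_Suc flip: fps_const_neg)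
    qed simp
    have "?f n = fps_X ^ (n * (n + 1)) * inverse (lin_prod (-1) 2 1 (n + 1))"
      unfolding qpoch_eq_lin_prod[symmetric] by (rule fps_divide_unit) simp
    hence "?f n oo ?L = (fps_X ^ (n * (n + 1)) oo ?L) * inverse (lin_prod (-1) 2 1 (n + 1) oo ?L)"
      by (simp add: fps_compose_mult_distrib fps_inverse_compose lin_prod_nth_0 del: mult_Suc_right power_Suc)
    moreover have "fps_X ^ (n * (n + 1)) oo ?L = fps_X ^ (n * (n + 1))"
      by (subst fps_X_power_compose) (simp_all add: power_minus_even)
    ultimately show ?thesis unfolding l by simp
  qed
  ultimately have "(\<lambda>n. fps_X ^ (n * (n + 1)) * inverse (lin_prod 1 2 1 (n + 1))) sums (nu_minus oo ?L)"
    by (simp only:)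
  moreover have "(\<lambda>n. fps_X ^ (n * (n + 1)) * inverse (lin_prod 1 2 1 (n + 1))) sums nu_plus"
    using has_sum_nu_plus by (rule has_sum_imp_sums)
  ultimately show ?thesis using sums_unique2 by blast
qed

text \<open>
  The double series of \<open>q\<^bsup>(m-N)\<^sup>2+N\<^esup>/(q\<^sup>2;q\<^sup>2)\<^sub>m\<close> over \<open>m \<ge> 0\<close> and all integers \<open>N\<close>, summed in both orders.
  Summation over \<open>m\<close> gives \<open>q\<^sup>N\<close> times \<open>T_sum\<close> or \<open>U_sum\<close>, that is, \<open>U_sum 0\<close> times the terms of
  \<open>\<nu>(-q)\<close> for \<open>N \<ge> 0\<close> and of \<open>\<nu>(q)\<close> for \<open>N < 0\<close>. Summation over \<open>N\<close> gives a theta series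
  times the terms of \<open>V_sum 0\<close>.
\<close>

lemma nu_bilateral: "U_sum 0 * (nu_minus + nu_plus) = theta 2 0 1 * V_sum 0"
proof -
  define e where "e = (\<lambda>(m :: nat) (N :: int). (int m - N) ^ 2 + N)"
  define t where "t = (\<lambda>m N. fps_X ^ nat (e m N) * inv_euler2 m)"
  have e: "e m N = (int m - N - 1) * (int m - N) + int m" for m N
    by (simp add: e_def power2_eq_square algebra_simps)
  have pronic: "x * (x + 1) \<ge> 0" "x * (x + 1) \<ge> \<bar>x\<bar> - 1" for x :: int
  proof -
    have eq: "x * (x + 1) = x ^ 2 + x" by (simp add: power2_eq_square algebra_simps)
    show "x * (x + 1) \<ge> 0" using eq square_ge_int(2)[of x] by linarith
    have "(x + 1) ^ 2 = x * (x + 1) + x + 1" by (simp add: power2_eq_square algebra_simps)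
    thus "x * (x + 1) \<ge> \<bar>x\<bar> - 1"
      using eq zero_le_power2[of x] zero_le_power2[of "x + 1"] by linarith
  qed
  have e_ge: "e m N \<ge> int m" "e m N \<ge> \<bar>int m - N - 1\<bar> - 1" for m N
    using pronic[of "int m - N - 1"] unfolding e by simp_all
  have "(\<lambda>(m, N). t m N) summable_on UNIV \<times> UNIV"
    unfolding t_def case_prod_unfold
  proof (rule summable_on_fps_X_power)
    fix n
    \<comment> \<open>Any finite box does; this one follows from the linear bounds on \<open>e\<close>.\<close>
    have "{x \<in> UNIV \<times> UNIV. nat (e (fst x) (snd x)) \<le> n} \<subseteq> {..n} \<times> {- int n - 5..2 * int n + 5}"
    proof
      fix p assume p: "p \<in> {x \<in> UNIV \<times> UNIV. nat (e (fst x) (snd x)) \<le> n}"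
      obtain m N where mN: "p = (m, N)" by (cases p)
      from p have "e m N \<le> int n" by (simp add: mN)
      thus "p \<in> {..n} \<times> {- int n - 5..2 * int n + 5}"
        using e_ge[of m N] by (auto simp: mN)
    qed
    thus "finite {x \<in> UNIV \<times> UNIV. nat (e (fst x) (snd x)) \<le> n}"
      by (rule finite_subset) auto
  qed
  then obtain D where D: "((\<lambda>(m, N). t m N) has_sum D) (UNIV \<times> UNIV)"
    by (auto simp: summable_on_def)

  have "((\<lambda>N. t m N) has_sum theta 2 0 1 * (fps_X ^ m * inv_euler2 m)) UNIV" for m
  proof -
    have "((\<lambda>k. theta_term 2 2 1 k * (fps_X ^ m * inv_euler2 m)) has_sum theta 2 2 1 * (fps_X ^ m * inv_euler2 m)) UNIV"
      by (intro has_sum_cmult_left has_sum_theta) auto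
    moreover have "theta_term 2 2 1 k * (fps_X ^ m * inv_euler2 m) = t m (int m - 1 - k)" for k
    proof -
      have "theta_exp 2 2 k = k * (k + 1)"
        using theta_exp_double[of 2 2 k] by (simp add: algebra_simps)
      moreover from this have "e m (int m - 1 - k) = theta_exp 2 2 k + int m" unfolding e by (simp add: algebra_simps)
      moreover have "theta_exp 2 2 k \<ge> 0" by (rule theta_exp_nonneg) auto
      ultimately have "nat (e m (int m - 1 - k)) = nat (theta_exp 2 2 k) + m" by linarith
      thus ?thesis by (simp add: t_def theta_term_def power_add mult.assoc)
    qed
    moreover have "theta 2 2 1 = theta 2 0 1" using theta_reflect[of 2 0 1] by simp
    \<comment> \<open>The substitution \<open>N = m - 1 - k\<close> turns the exponent into \<open>k(k+1) + m\<close>.\<close>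
    ultimately have h: "((\<lambda>k. t m (int m - 1 - k)) has_sum theta 2 0 1 * (fps_X ^ m * inv_euler2 m)) UNIV" by simp
    have "bij_betw (\<lambda>k. int m - 1 - k) UNIV UNIV"
      by (rule bij_betwI[of _ _ _ "\<lambda>k. int m - 1 - k"]) auto
    from has_sum_reindex_bij_betw[OF this, of "t m"] h show ?thesis by simp
  qed
  hence "((\<lambda>m. theta 2 0 1 * (fps_X ^ m * inv_euler2 m)) has_sum D) UNIV"
    by (intro has_sum_SigmaD[OF D]) auto
  moreover have "((\<lambda>m. theta 2 0 1 * (fps_X ^ (m * (2 * 0 + 1)) * inv_euler2 m)) has_sum theta 2 0 1 * V_sum 0) UNIV"
    unfolding V_sum_def by (intro has_sum_cmult_right has_sum_euler_sum[of _ 0]) simp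
  ultimately have D1: "D = theta 2 0 1 * V_sum 0" using has_sum_unique by fastforce

  \<comment> \<open>The sum over \<open>m\<close> for fixed \<open>N\<close>; a negative \<open>N\<close> is written as \<open>-n - 1\<close>.\<close>
  define s where "s = (\<lambda>N. if N \<ge> 0 then U_sum 0 * (fps_X ^ nat N * lin_prod 1 2 1 (nat N))
     else U_sum 0 * (fps_X ^ (nat (- N - 1) * (nat (- N - 1) + 1)) * inverse (lin_prod 1 2 1 (nat (- N - 1) + 1))))"
  have cols: "((\<lambda>m. t m N) has_sum s N) UNIV" for N
  proof (cases "N \<ge> 0")
    case True
    define n where "n = nat N"
    have N: "N = int n" using True by (simp add: n_def)
    have "((\<lambda>m. fps_X ^ n * (fps_X ^ nat ((int m - int n) ^ 2) * inv_euler2 m)) has_sum fps_X ^ n * T_sum n) UNIV"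
      unfolding T_sum_def by (intro has_sum_cmult_right has_sum_euler_sum[of _ n] T_sum_bound)
    moreover have "fps_X ^ n * (fps_X ^ nat ((int m - int n) ^ 2) * inv_euler2 m) = t m N" for m
    proof -
      have "nat (e m N) = n + nat ((int m - int n) ^ 2)"
        unfolding e_def N using zero_le_power2[of "int m - int n"] by linarith
      thus ?thesis by (simp add: t_def power_add mult.assoc)
    qed
    moreover have "fps_X ^ n * T_sum n = s N" unfolding s_def T_sum_eq by (simp add: N mult_ac)
    ultimately show ?thesis by simp
  next
    case False
    define n where "n = nat (- N - 1)"
    have N: "N = - int n - 1" using False by (simp add: n_def)
    have "((\<lambda>m. fps_X ^ (n * (n + 1)) * (fps_X ^ (m ^ 2 + 2 * m * (n + 1)) * inv_euler2 m)) has_sum fps_X ^ (n * (n + 1)) * U_sum (n + 1)) UNIV"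
      unfolding U_sum_def
    proof (intro has_sum_cmult_right has_sum_euler_sum[of _ 0])
      show "m \<le> m ^ 2 + 2 * m * (n + 1) + 0" for m :: nat by (cases m) (auto simp: power2_eq_square)
    qed
    moreover have "fps_X ^ (n * (n + 1)) * (fps_X ^ (m ^ 2 + 2 * m * (n + 1)) * inv_euler2 m) = t m N" for m
    proof -
      have "e m N = int (n * (n + 1) + (m ^ 2 + 2 * m * (n + 1)))"
        unfolding e_def N by (simp add: power2_eq_square algebra_simps)
      hence "nat (e m N) = n * (n + 1) + (m ^ 2 + 2 * m * (n + 1))" by linarith
      thus ?thesis by (simp only: t_def power_add mult.assoc)
    qed
    moreover have "fps_X ^ (n * (n + 1)) * U_sum (n + 1) = s N"
    proof -
      have inv: "lin_prod 1 2 1 (n + 1) * inverse (lin_prod 1 2 1 (n + 1)) = 1"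
        by (rule inverse_mult_eq_1') (simp add: lin_prod_nth_0)
      have "U_sum (n + 1) = U_sum (n + 1) * (lin_prod 1 2 1 (n + 1) * inverse (lin_prod 1 2 1 (n + 1)))"
        unfolding inv by simp
      also have "\<dots> = (lin_prod 1 2 1 (n + 1) * U_sum (n + 1)) * inverse (lin_prod 1 2 1 (n + 1))"
        by (simp only: mult_ac)
      also have "lin_prod 1 2 1 (n + 1) * U_sum (n + 1) = U_sum 0" by (rule U_sum_0)
      finally show ?thesis using False unfolding s_def n_def by (simp only: if_False mult_ac)
    qed
    ultimately show ?thesis by simp
  qed
  have swapped: "((\<lambda>(N, m). t m N) has_sum D) (UNIV \<times> UNIV)"
    using D by (subst (asm) has_sum_swap) simp
  have sD: "(s has_sum D) UNIV"
    by (rule has_sum_SigmaD[OF swapped]) (use cols in auto)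
  have "(s has_sum U_sum 0 * nu_minus) (range int)"
  proof (subst has_sum_reindex)
    show "(s \<circ> int has_sum U_sum 0 * nu_minus) UNIV"
      unfolding nu_minus_eq_lin_sum using has_sum_cmult_right[OF has_sum_lin_sum[of 0], of "U_sum 0"]
      by (simp add: s_def o_def)
  qed auto
  moreover have "(s has_sum U_sum 0 * nu_plus) (range (\<lambda>n. - int n - 1))"
  proof (subst has_sum_reindex)
    show "(s \<circ> (\<lambda>n. - int n - 1) has_sum U_sum 0 * nu_plus) UNIV"
      using has_sum_cmult_right[OF has_sum_nu_plus, of "U_sum 0"]
      by (simp add: s_def o_def)
  qed (auto simp: inj_on_def)
  ultimately have "(s has_sum U_sum 0 * nu_minus + U_sum 0 * nu_plus) (range int \<union> range (\<lambda>n. - int n - 1))"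
    by (rule has_sum_Un_disjoint) auto
  moreover have "range int \<union> range (\<lambda>n. - int n - 1) = UNIV"
  proof -
    have "N \<in> range int \<union> range (\<lambda>n. - int n - 1)" for N
      by (cases "N \<ge> 0") (auto simp: image_iff intro: exI[of _ "nat N"] exI[of _ "nat (- N - 1)"])
    thus ?thesis by blast
  qed
  ultimately have "D = U_sum 0 * nu_minus + U_sum 0 * nu_plus" using sD has_sum_unique by auto
  thus ?thesis using D1 by (simp add: distrib_left)
qed

text \<open>
  \<open>\<nu>(q) + \<nu>(-q)\<close> is twice the even part, and every factor in the evaluation of the bilateral series
  is a quotient of Euler products.
\<close>

lemma even_part_nu_minus: "Abs_fps (\<lambda>n. p_nu (2 * n)) * E 1 ^ 2 = E 2 ^ 3"
proof -
  define H where "H = Abs_fps (\<lambda>n. p_nu (2 * n))"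
  have "theta_term 2 0 1 k = theta_term 1 0 1 k oo fps_X ^ 2" for k
  proof -
    have "theta_exp 2 0 k = 2 * theta_exp 1 0 k" by (simp add: theta_exp_def)
    hence "nat (theta_exp 2 0 k) = 2 * nat (theta_exp 1 0 k)" by (simp add: nat_mult_distrib)
    thus ?thesis by (simp add: theta_term_def fps_compose_mult_distrib fps_X_power_compose power_mult)
  qed
  hence "theta_term 2 0 1 = (\<lambda>k. theta_term 1 0 1 k oo fps_X ^ 2)" by (rule ext)
  moreover have "((\<lambda>k. theta_term 1 0 1 k oo fps_X ^ 2) has_sum (theta 1 0 1 oo fps_X ^ 2)) UNIV"
    by (intro has_sum_compose_X_power has_sum_theta) auto
  ultimately have "(theta_term 2 0 1 has_sum (theta 1 0 1 oo fps_X ^ 2)) UNIV"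
    by (simp only:)
  hence th: "theta 2 0 1 = theta 1 0 1 oo fps_X ^ 2"
    by (intro has_sum_unique[where f = "theta_term 2 0 1" and A = UNIV] has_sum_theta) auto
  have "(theta 1 0 1 * E 1) oo fps_X ^ 2 = (2 * E 2 ^ 2) oo fps_X ^ 2" unfolding theta_1_0 ..
  hence th': "theta 2 0 1 * E 2 = 2 * E 4 ^ 2"
    unfolding th by (simp add: fps_compose_mult_distrib fps_compose_power[symmetric] E_compose_X_power)
  have H: "nu_minus + nu_plus = 2 * (H oo fps_X ^ 2)"
  proof (rule fps_ext)
    fix n
    show "fps_nth (nu_minus + nu_plus) n = fps_nth (2 * (H oo fps_X ^ 2)) n"
      unfolding nu_plus_eq fps_compose_uminus' fps_nth_numeral_mult
      by (auto simp: nu_minus_def H_def fps_nth_compose_X_power uminus_power_if elim!: evenE oddE)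
  qed
  have "E 2 ^ 2 * (nu_minus + nu_plus) = (U_sum 0 * (nu_minus + nu_plus)) * (E 1 * E 4)"
    unfolding U_sum_E[symmetric] by (simp only: mult_ac)
  also have "\<dots> = theta 2 0 1 * (V_sum 0 * E 1) * E 4" unfolding nu_bilateral by (simp only: mult_ac)
  also have "\<dots> = 2 * E 4 ^ 3" unfolding V_sum_E th' by (simp add: eval_nat_numeral)
  finally have "2 * (H oo fps_X ^ 2 ) * E 2 ^ 2 = 2 * E 4 ^ 3" unfolding H by (simp only: mult_ac)
  hence "2 * ((H oo fps_X ^ 2) * E 2 ^ 2) = 2 * E 4 ^ 3" by (simp only: mult_ac)
  hence "(H oo fps_X ^ 2) * E 2 ^ 2 = E 4 ^ 3" by (rule fps_cancel_numeral)
  hence "(H * E 1 ^ 2) oo fps_X ^ 2 = E 2 ^ 3 oo fps_X ^ 2"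
    by (simp add: fps_compose_mult_distrib fps_compose_power[symmetric] E_compose_X_power)
  hence "H * E 1 ^ 2 = E 2 ^ 3" by (rule fps_compose_X_power_inj) simp
  thus ?thesis unfolding H_def .
qed

section \<open>The numbers $p_\nu(10n+8)$\<close>

text \<open>
  In the application, \<open>x\<close> and \<open>y\<close> are the Rogers-Ramanujan continued fractions of \<open>q\<close> and \<open>q\<^sup>2\<close>
  without their fractional powers of \<open>q\<close>, \<open>\<alpha>\<close> and \<open>\<beta>\<close> are the components of \<open>\<psi>\<close> divided by
  \<open>\<psi>(q\<^sup>5)\<close>, and the hypotheses are components of \<open>\<psi> E\<^sub>1 = E\<^sub>2\<^sup>2\<close>. They determine \<open>\<alpha>\<close>, \<open>\<beta>\<close>
  and \<open>y\<close> in terms of \<open>x\<close> and Ramanujan's parameter \<open>k = q x y\<^sup>2\<close>. All terms of the conclusion have the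
  same degree in \<open>x\<close>, so it becomes an identity between rational functions of \<open>k\<close>.
\<close>

lemma level_ten_identity:
  fixes x y q \<alpha> \<beta> :: "'a :: field_char_0"
  assumes nz: "x \<noteq> 0" "y \<noteq> 0"
    and r0: "\<alpha> / x - q * x = 1 / y ^ 2"
    and r1: "\<beta> / x - \<alpha> = 2 * q * y"
    and r2: "\<alpha> * x + \<beta> = 2 / y"
    and r3: "1 / x - x * \<beta> = q * y ^ 2"
  shows "\<alpha> ^ 2 * (2 / y ^ 2 - q ^ 2 * y ^ 3) + 5 * q * (2 * \<alpha> * \<beta> + q) + \<beta> ^ 2 * (1 / y ^ 3 + 2 * q ^ 2 * y ^ 2)
       + 2 * q * \<alpha> * (3 / y + q ^ 2 * y ^ 4) + 2 * \<beta> * (1 / y ^ 4 - 3 * q ^ 2 * y) = 5 * (\<alpha> * \<beta> + q) ^ 2"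
proof -
  define k where "k = q * x * y ^ 2"
  define p where "p = 1 + k"
  define m where "m = 1 - k"
  have q: "q = k / (x * y ^ 2)" using nz by (simp add: k_def)
  have "\<alpha> / x = 1 / y ^ 2 + q * x" using r0 by (simp add: algebra_simps)
  also have "\<dots> = p / y ^ 2" using nz unfolding q p_def by (simp add: field_simps)
  finally have a: "\<alpha> = x * p / y ^ 2" using nz by (simp add: field_simps)
  have "x * \<beta> = 1 / x - q * y ^ 2" using r3 by (simp add: algebra_simps)
  also have "\<dots> = m / x" using nz unfolding q m_def by (simp add: field_simps)
  finally have b: "\<beta> = m / x ^ 2" using nz by (simp add: field_simps power2_eq_square)
  have "x ^ 4 * p + m * y ^ 2 = (x * p / y ^ 2 * x + m / x ^ 2) * (x ^ 2 * y ^ 2)"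
    using nz by (simp add: field_simps eval_nat_numeral)
  also have "\<dots> = 2 / y * (x ^ 2 * y ^ 2)" using r2 unfolding a b by simp
  also have "\<dots> = 2 * x ^ 2 * y" using nz by (simp add: eval_nat_numeral)
  finally have "x ^ 4 * p + m * y ^ 2 = 2 * x ^ 2 * y" .
  hence 1: "(y - x ^ 2) * (y * m - x ^ 2 * p) = 0"
    unfolding p_def m_def by (simp add: algebra_simps eval_nat_numeral)
  have "m * y ^ 2 - x ^ 4 * p = (m / x ^ 2 / x - x * p / y ^ 2) * (x ^ 3 * y ^ 2)"
    using nz by (simp add: field_simps eval_nat_numeral)
  also have "\<dots> = 2 * (k / (x * y ^ 2)) * y * (x ^ 3 * y ^ 2)" using r1 unfolding a b q by simp
  also have "\<dots> = 2 * k * x ^ 2 * y" using nz by (simp add: field_simps eval_nat_numeral)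
  finally have "m * y ^ 2 - x ^ 4 * p = 2 * k * x ^ 2 * y" .
  hence 2: "(y + x ^ 2) * (y * m - x ^ 2 * p) = 0"
    unfolding p_def m_def by (simp add: algebra_simps eval_nat_numeral)
  \<comment> \<open>The two factors \<open>y - x\<^sup>2\<close> and \<open>y + x\<^sup>2\<close> add up to \<open>2y\<close>, so they do not both vanish.\<close>
  have "(y * m - x ^ 2 * p) * (2 * y) = 0" using 1 2 by algebra
  hence ym: "y * m = x ^ 2 * p" using nz by simp
  have p0: "p \<noteq> 0" using ym nz by (auto simp: p_def m_def)
  have m0: "m \<noteq> 0" using ym nz by (auto simp: p_def m_def)
  have y: "y = x ^ 2 * p / m" using ym m0 by (simp add: field_simps)
  have q': "q = k * m ^ 2 / (x ^ 5 * p ^ 2)" using nz p0 m0 unfolding q y by (simp add: field_simps eval_nat_numeral)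
  have a': "\<alpha> = m ^ 2 / (x ^ 3 * p)" using nz p0 m0 unfolding a y by (simp add: field_simps eval_nat_numeral)
  define z where "z = 1 / (x ^ 10 * p ^ 4)"
  \<comment> \<open>The denominator \<open>x\<^sup>1\<^sup>0 p\<^sup>4\<close> and the factor \<open>m\<^sup>4\<close> are common to all terms.\<close>
  have t1: "\<alpha> ^ 2 * (2 / y ^ 2 - q ^ 2 * y ^ 3) = z * m ^ 4 * (2 * m ^ 2 - k ^ 2 * m * p)"
    using nz p0 m0 unfolding a' y q' z_def by (simp add: field_simps eval_nat_numeral)
  have t2: "5 * q * (2 * \<alpha> * \<beta> + q) = z * m ^ 4 * (5 * k * (2 * m * p + k))"
    using nz p0 m0 unfolding a' b q' z_def by (simp add: field_simps eval_nat_numeral)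
  have t3: "\<beta> ^ 2 * (1 / y ^ 3 + 2 * q ^ 2 * y ^ 2) = z * m ^ 4 * (m * p + 2 * k ^ 2 * p ^ 2)"
    using nz p0 m0 unfolding b y q' z_def by (simp add: field_simps eval_nat_numeral)
  have t4: "2 * q * \<alpha> * (3 / y + q ^ 2 * y ^ 4) = z * m ^ 4 * (2 * k * (3 * m + k ^ 2 * p))"
    using nz p0 m0 unfolding a' y q' z_def by (simp add: field_simps eval_nat_numeral)
  have t5: "2 * \<beta> * (1 / y ^ 4 - 3 * q ^ 2 * y) = z * m ^ 4 * (2 * (m - 3 * k ^ 2 * p))"
    using nz p0 m0 unfolding b y q' z_def by (simp add: field_simps eval_nat_numeral)
  have "\<alpha> * \<beta> + q = (m * p + k) * (m ^ 2 / (x ^ 5 * p ^ 2))"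
    using nz p0 m0 unfolding a' b q' by (simp add: field_simps eval_nat_numeral)
  hence t6: "5 * (\<alpha> * \<beta> + q) ^ 2 = z * m ^ 4 * (5 * (m * p + k) ^ 2)"
    unfolding z_def by (simp add: power_mult_distrib power_divide flip: power_mult)
  have "(2 * m ^ 2 - k ^ 2 * m * p) + 5 * k * (2 * m * p + k) + (m * p + 2 * k ^ 2 * p ^ 2)
      + 2 * k * (3 * m + k ^ 2 * p) + 2 * (m - 3 * k ^ 2 * p) = 5 * (m * p + k) ^ 2"
    unfolding p_def m_def by (simp add: algebra_simps eval_nat_numeral)
  thus ?thesis unfolding t1 t2 t3 t4 t5 t6 distrib_left[symmetric] by simp
qed

text \<open>
  Let \<open>f\<close> have the components \<open>a\<close>, \<open>-b\<close>, \<open>c\<close> at the indices 0, 2, 4 and no others, like \<open>E\<^sub>2\<close>. The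
  hypotheses on \<open>P0\<close>, ..., \<open>P4\<close> are the components of an equation \<open>P = h f\<close>. The multipliers in the
  conclusion are the components of the product of the four nontrivial conjugates of \<open>f\<close>, and the
  factor of \<open>h4\<close> is the norm of \<open>f\<close>.
\<close>

lemma circulant_solve:
  fixes a b c X :: "'a :: idom"
  assumes ac: "a * c = - (b ^ 2)"
    and P0: "P0 = h0 * a + X * (h1 * c - h3 * b)"
    and P1: "P1 = h1 * a + X * (h2 * c - h4 * b)"
    and P2: "P2 = h2 * a - h0 * b + X * (h3 * c)"
    and P3: "P3 = h3 * a - h1 * b + X * (h4 * c)"
    and P4: "P4 = h4 * a - h2 * b + h0 * c"
  shows "P0 * (2 * a ^ 2 * b ^ 2 + X ^ 2 * b * c ^ 3) + P1 * (5 * X * b ^ 4) + P2 * (a ^ 3 * b + 2 * X ^ 2 * b ^ 2 * c ^ 2)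
      + P3 * (3 * X * a * b ^ 3 + X ^ 3 * c ^ 4) + P4 * (a ^ 4 + 3 * X ^ 2 * b ^ 3 * c)
      = h4 * (a ^ 5 - 11 * X ^ 2 * b ^ 5 + X ^ 4 * c ^ 5)"
proof -
  \<comment> \<open>Each combination of multipliers below is the coefficient of one \<open>h\<close>; only that of \<open>h4\<close> survives.\<close>
  define D4 D3 D2 D1 D0 where D: "D4 = 2 * a ^ 2 * b ^ 2 + X ^ 2 * b * c ^ 3" "D3 = 5 * X * b ^ 4"
    "D2 = a ^ 3 * b + 2 * X ^ 2 * b ^ 2 * c ^ 2" "D1 = 3 * X * a * b ^ 3 + X ^ 3 * c ^ 4" "D0 = a ^ 4 + 3 * X ^ 2 * b ^ 3 * c"
  have c0: "a * D4 - b * D2 + c * D0 = 0"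
    unfolding D using ac by algebra
  have c1: "X * c * D4 + a * D3 - b * D1 = 0"
    unfolding D using ac by algebra
  have c2: "X * c * D3 + a * D2 - b * D0 = 0"
    unfolding D using ac by algebra
  have c3: "X * c * D2 + a * D1 - X * b * D4 = 0"
    unfolding D using ac by algebra
  have c4: "a * D0 + X * c * D1 - X * b * D3 = a ^ 5 - 11 * X ^ 2 * b ^ 5 + X ^ 4 * c ^ 5"
    unfolding D using ac by algebra
  have "P0 * D4 + P1 * D3 + P2 * D2 + P3 * D1 + P4 * D0
     = h0 * (a * D4 - b * D2 + c * D0) + h1 * (X * c * D4 + a * D3 - b * D1)
     + h2 * (X * c * D3 + a * D2 - b * D0) + h3 * (X * c * D2 + a * D1 - X * b * D4)
     + h4 * (a * D0 + X * c * D1 - X * b * D3)"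
    unfolding P0 P1 P2 P3 P4 by (simp add: algebra_simps)
  also have "\<dots> = h4 * (a ^ 5 - 11 * X ^ 2 * b ^ 5 + X ^ 4 * c ^ 5)"
    unfolding c0 c1 c2 c3 c4 by simp
  finally show ?thesis unfolding D .
qed

text \<open>
  Formal Laurent series form a field, in which quotients can be calculated freely.
\<close>

abbreviation F :: "complex fps \<Rightarrow> complex fls" where "F \<equiv> fps_to_fls"

lemma F_mult: "F (f * g) = F f * F g"
  by (simp add: fls_times_fps_to_fls)

lemma F_divide: "fps_nth g 0 \<noteq> 0 \<Longrightarrow> F (f / g) = F f / F g"
proof -
  assume g: "fps_nth g 0 \<noteq> 0"
  hence "f / g * g = f" by (intro dvd_div_mult_self) simp
  hence "F (f / g) * F g = F f" by (simp flip: F_mult)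
  moreover have "F g \<noteq> 0" using g by auto
  ultimately show ?thesis by (simp add: field_simps)
qed

lemmas F_hom = fps_to_fls_plus fps_to_fls_minus fps_to_fls_uminus fps_to_fls_power
  fps_to_fls_numeral F_mult

lemma psi_X5_E5: "(psi oo fps_X ^ 5) * E 5 = E 10 ^ 2"
proof -
  have "(psi * E 1) oo fps_X ^ 5 = E 2 ^ 2 oo fps_X ^ 5" unfolding psi_E1 ..
  thus ?thesis by (simp add: fps_compose_mult_distrib fps_compose_power[symmetric] E_compose_X_power)
qed

lemma E2_sections_prod: "sect 0 (E 2) * sect 4 (E 2) = - (E 10 ^ 2)"
proof -
  have "(sect 0 (E 1) * sect 2 (E 1)) oo fps_X ^ 2 = (- (E 5 ^ 2)) oo fps_X ^ 2"
    unfolding E1_sections_prod ..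
  thus ?thesis
    by (simp add: E2_sections fps_compose_mult_distrib fps_compose_uminus fps_compose_power[symmetric] E_compose_X_power)
qed

lemma E2_sections_norm:
  "(sect 0 (E 2) ^ 5 - 11 * fps_X ^ 2 * E 10 ^ 5 + fps_X ^ 4 * sect 4 (E 2) ^ 5) * E 10 = E 2 ^ 6"
proof -
  have "((sect 0 (E 1) ^ 5 - 11 * fps_X * E 5 ^ 5 + fps_X ^ 2 * sect 2 (E 1) ^ 5) * E 5) oo fps_X ^ 2 = E 1 ^ 6 oo fps_X ^ 2"
    unfolding E1_sections_norm ..
  thus ?thesis
    by (simp add: E2_sections fps_compose_mult_distrib fps_compose_add_distrib fps_compose_sub_distrib
      fps_compose_power[symmetric] E_compose_X_power flip: power_mult)
qed

text \<open>
  Apply \<open>circulant_solve\<close> to \<open>H E\<^sub>2 = \<psi>\<^sup>2\<close>. By \<open>level_ten_identity\<close> the result is 5 times the square of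
  \<open>\<alpha> \<beta> + q \<psi>(q\<^sup>5)\<^sup>2 = \<psi>\<^sup>2\<close>, up to powers of \<open>E\<^sub>1\<^sub>0\<close> and \<open>\<psi>(q\<^sup>5)\<close>.
\<close>

lemma sect_4_even_part:
  assumes H: "H * E 1 ^ 2 = E 2 ^ 3"
  shows "sect 4 H * E 1 ^ 4 = 5 * E 2 ^ 2 * E 5 ^ 2 * E 10"
proof -
  define A C a c where ac_def: "A = sect 0 (E 1)" "C = sect 2 (E 1)" "a = sect 0 (E 2)" "c = sect 4 (E 2)"
  define \<alpha> \<beta> \<psi> where ab_def: "\<alpha> = sect 0 psi" "\<beta> = sect 1 psi" "\<psi> = psi oo fps_X ^ 5"
  have "H * E 2 * E 1 ^ 2 = (H * E 1 ^ 2) * E 2" by (simp only: mult_ac)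
  also have "\<dots> = (psi * E 1) ^ 2" unfolding H psi_E1 by (simp add: eval_nat_numeral)
  also have "\<dots> = psi ^ 2 * E 1 ^ 2" by (simp only: power_mult_distrib)
  finally have HE: "H * E 2 = psi * psi" by (simp add: power2_eq_square)
  have ac: "a * c = - (E 10 ^ 2)" unfolding ac_def by (rule E2_sections_prod)
  have AC: "A * C = - (E 5 ^ 2)" unfolding ac_def by (rule E1_sections_prod)
  have \<psi>5: "\<psi> * E 5 = E 10 ^ 2" unfolding ab_def by (rule psi_X5_E5)
  have S: "\<alpha> * \<alpha> * (2 * a ^ 2 * E 10 ^ 2 + fps_X ^ 2 * E 10 * c ^ 3)
      + (2 * (\<alpha> * \<beta>) + fps_X * \<psi> ^ 2) * (5 * fps_X * E 10 ^ 4)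
      + \<beta> * \<beta> * (a ^ 3 * E 10 + 2 * fps_X ^ 2 * E 10 ^ 2 * c ^ 2)
      + 2 * (\<alpha> * \<psi>) * (3 * fps_X * a * E 10 ^ 3 + fps_X ^ 3 * c ^ 4)
      + 2 * (\<beta> * \<psi>) * (a ^ 4 + 3 * fps_X ^ 2 * E 10 ^ 3 * c)
      = sect 4 H * (a ^ 5 - 11 * fps_X ^ 2 * E 10 ^ 5 + fps_X ^ 4 * c ^ 5)"
  proof (rule circulant_solve[OF ac])
    note s = arg_cong[OF HE, of "sect 0"] arg_cong[OF HE, of "sect 1"] arg_cong[OF HE, of "sect 2"]
      arg_cong[OF HE, of "sect 3"] arg_cong[OF HE, of "sect 4"]
    note s = s[unfolded sect_mult_0 sect_mult_1 sect_mult_2 sect_mult_3 sect_mult_4 psi_sections(3-5) E2_sections(2-4)]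
    show "\<alpha> * \<alpha> = sect 0 H * a + fps_X * (sect 1 H * c - sect 3 H * E 10)"
      using s(1) by (simp add: ac_def ab_def algebra_simps)
    show "2 * (\<alpha> * \<beta>) + fps_X * \<psi> ^ 2 = sect 1 H * a + fps_X * (sect 2 H * c - sect 4 H * E 10)"
      using s(2) by (simp add: ac_def ab_def algebra_simps power2_eq_square)
    show "\<beta> * \<beta> = sect 2 H * a - sect 0 H * E 10 + fps_X * (sect 3 H * c)"
      using s(3) by (simp add: ac_def ab_def algebra_simps)
    show "2 * (\<alpha> * \<psi>) = sect 3 H * a - sect 1 H * E 10 + fps_X * (sect 4 H * c)"
      using s(4) by (simp add: ac_def ab_def algebra_simps)
    show "2 * (\<beta> * \<psi>) = sect 4 H * a - sect 2 H * E 10 + sect 0 H * c"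
      using s(5) by (simp add: ac_def ab_def algebra_simps)
  qed
  have pE: "psi * E 1 = E 2 * E 2" using psi_E1 by (simp add: power2_eq_square)
  note s = arg_cong[OF pE, of "sect 0"] arg_cong[OF pE, of "sect 2"] arg_cong[OF pE, of "sect 3"] arg_cong[OF pE, of "sect 1"]
  note s = s[unfolded sect_mult_0 sect_mult_1 sect_mult_2 sect_mult_3 psi_sections(3-5) E1_sections E2_sections(2-4)]
  have r0: "\<alpha> * A + fps_X * \<psi> * C = a ^ 2"
    using s(1) by (simp add: ac_def ab_def algebra_simps power2_eq_square)
  have r1: "\<beta> * A - \<alpha> * E 5 = - (2 * fps_X * E 10 * c)"
    using s(4) by (simp add: ac_def ab_def algebra_simps)
  have r2: "\<beta> * E 5 - \<alpha> * C = 2 * a * E 10"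
    using s(2) by (simp add: ac_def ab_def algebra_simps)
  have r3: "\<beta> * C + \<psi> * A = fps_X * c ^ 2"
    using s(3) by (simp add: ac_def ab_def algebra_simps power2_eq_square)
  have psi2: "psi ^ 2 = \<alpha> * \<beta> + fps_X * \<psi> ^ 2" unfolding ab_def by (rule psi_square_dissect)
  have norm: "(a ^ 5 - 11 * fps_X ^ 2 * E 10 ^ 5 + fps_X ^ 4 * c ^ 5) * E 10 = E 2 ^ 6"
    unfolding ac_def by (rule E2_sections_norm)

  define e b q p where e_def: "e = F (E 5)" "b = F (E 10)" "q = (fls_X :: complex fls)" "p = F \<psi>"
  have nz: "e \<noteq> 0" "b \<noteq> 0" by (simp_all add: e_def)
  have p: "p = b ^ 2 / e"
    using arg_cong[OF \<psi>5, of F] nz by (simp add: F_hom e_def field_simps)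
  have pnz: "p \<noteq> 0" using nz p by simp
  \<comment> \<open>The components of \<open>E\<^sub>1\<close> divided by \<open>E\<^sub>5\<close> are \<open>1/x\<close>, \<open>-1\<close>, \<open>-x\<close>, and likewise \<open>y\<close> for \<open>E\<^sub>2\<close> and \<open>E\<^sub>1\<^sub>0\<close>.\<close>
  define x y where "x = - F C / e" and "y = - F c / b"
  have "F A * F C = - (e ^ 2)" "F a * F c = - (b ^ 2)"
    using arg_cong[OF AC, of F] arg_cong[OF ac, of F] by (simp_all add: F_hom e_def)
  hence FA: "F A * x = e" and Fa: "F a * y = b" and FC: "F C = - (e * x)" and Fc: "F c = - (b * y)"
    using nz by (simp_all add: x_def y_def field_simps power2_eq_square)
  have xy: "x \<noteq> 0" "y \<noteq> 0" using FA Fa nz by auto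
  have FA: "F A = e / x" and Fa: "F a = b / y" using FA Fa xy by (simp_all add: field_simps)
  define \<alpha>' \<beta>' where "\<alpha>' = F \<alpha> / p" and "\<beta>' = F \<beta> / p"
  have F\<alpha>: "F \<alpha> = \<alpha>' * p" and F\<beta>: "F \<beta> = \<beta>' * p" using pnz by (simp_all add: \<alpha>'_def \<beta>'_def)
  have pe: "p * e = b ^ 2" using p nz by simp
  have pe0: "p * e \<noteq> 0" using pnz nz by simp
  have "(\<alpha>' / x - q * x) * (p * e) = 1 / y ^ 2 * (p * e)"
  proof -
    have "(\<alpha>' / x - q * x) * (p * e) = b ^ 2 / y ^ 2"
      using arg_cong[OF r0, of F] xy by (simp add: F_hom F\<alpha> FA FC Fa e_def[symmetric] field_simps power2_eq_square)
    thus ?thesis by (simp add: pe)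
  qed
  hence R0: "\<alpha>' / x - q * x = 1 / y ^ 2" by (simp only: mult_right_cancel[OF pe0])
  have "(\<beta>' / x - \<alpha>') * (p * e) = 2 * q * y * (p * e)"
  proof -
    have "(\<beta>' / x - \<alpha>') * (p * e) = 2 * q * y * b ^ 2"
      using arg_cong[OF r1, of F] xy by (simp add: F_hom F\<alpha> F\<beta> FA Fc e_def[symmetric] field_simps power2_eq_square)
    thus ?thesis by (simp add: pe)
  qed
  hence R1: "\<beta>' / x - \<alpha>' = 2 * q * y" by (simp only: mult_right_cancel[OF pe0])
  have "(\<alpha>' * x + \<beta>') * (p * e) = 2 / y * (p * e)"
  proof -
    have "(\<alpha>' * x + \<beta>') * (p * e) = 2 * b ^ 2 / y"
      using arg_cong[OF r2, of F] xy by (simp add: F_hom F\<alpha> F\<beta> FC Fa e_def[symmetric] field_simps power2_eq_square)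
    thus ?thesis by (simp add: pe)
  qed
  hence R2: "\<alpha>' * x + \<beta>' = 2 / y" by (simp only: mult_right_cancel[OF pe0])
  have "(1 / x - x * \<beta>') * (p * e) = q * y ^ 2 * (p * e)"
  proof -
    have "(1 / x - x * \<beta>') * (p * e) = q * (b * y) ^ 2"
    proof -
      have "\<beta>' * p * - (e * x) + p * (e / x) = q * (b * y) ^ 2"
        using arg_cong[OF r3, of F] by (simp add: F_hom F\<beta> FA FC Fc e_def[symmetric])
      thus ?thesis by (simp add: algebra_simps)
    qed
    thus ?thesis by (simp add: pe power_mult_distrib)
  qed
  hence R3: "1 / x - x * \<beta>' = q * y ^ 2" by (simp only: mult_right_cancel[OF pe0])
  note key = level_ten_identity[OF xy R0 R1 R2 R3]
  define L where "L = F (sect 4 H)"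
  define N where "N = F (a ^ 5 - 11 * fps_X ^ 2 * E 10 ^ 5 + fps_X ^ 4 * c ^ 5)"
  have "L * N = p ^ 2 * b ^ 4 * (\<alpha>' ^ 2 * (2 / y ^ 2 - q ^ 2 * y ^ 3) + 5 * q * (2 * \<alpha>' * \<beta>' + q) + \<beta>' ^ 2 * (1 / y ^ 3 + 2 * q ^ 2 * y ^ 2)
       + 2 * q * \<alpha>' * (3 / y + q ^ 2 * y ^ 4) + 2 * \<beta>' * (1 / y ^ 4 - 3 * q ^ 2 * y))"
  proof -
    have "L * N = \<alpha>' * p * (\<alpha>' * p) * (2 * (b / y) ^ 2 * b ^ 2 + q ^ 2 * b * (- (b * y)) ^ 3)
      + (2 * (\<alpha>' * p * (\<beta>' * p)) + q * p ^ 2) * (5 * q * b ^ 4)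
      + \<beta>' * p * (\<beta>' * p) * ((b / y) ^ 3 * b + 2 * q ^ 2 * b ^ 2 * (- (b * y)) ^ 2)
      + 2 * (\<alpha>' * p * p) * (3 * q * (b / y) * b ^ 3 + q ^ 3 * (- (b * y)) ^ 4)
      + 2 * (\<beta>' * p * p) * ((b / y) ^ 4 + 3 * q ^ 2 * b ^ 3 * (- (b * y)))"
      unfolding L_def N_def F_mult[symmetric] S[symmetric]
      by (simp only: F_hom F\<alpha> F\<beta> Fa Fc fps_X_to_fls e_def[symmetric])
    moreover have "\<alpha>' * p * (\<alpha>' * p) * (2 * (b / y) ^ 2 * b ^ 2 + q ^ 2 * b * (- (b * y)) ^ 3)
      = p ^ 2 * b ^ 4 * (\<alpha>' ^ 2 * (2 / y ^ 2 - q ^ 2 * y ^ 3))"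
      using xy by (simp add: field_simps eval_nat_numeral)
    moreover have "(2 * (\<alpha>' * p * (\<beta>' * p)) + q * p ^ 2) * (5 * q * b ^ 4)
      = p ^ 2 * b ^ 4 * (5 * q * (2 * \<alpha>' * \<beta>' + q))"
      by (simp add: algebra_simps eval_nat_numeral)
    moreover have "\<beta>' * p * (\<beta>' * p) * ((b / y) ^ 3 * b + 2 * q ^ 2 * b ^ 2 * (- (b * y)) ^ 2)
      = p ^ 2 * b ^ 4 * (\<beta>' ^ 2 * (1 / y ^ 3 + 2 * q ^ 2 * y ^ 2))"
      using xy by (simp add: field_simps eval_nat_numeral)
    moreover have "2 * (\<alpha>' * p * p) * (3 * q * (b / y) * b ^ 3 + q ^ 3 * (- (b * y)) ^ 4)
      = p ^ 2 * b ^ 4 * (2 * q * \<alpha>' * (3 / y + q ^ 2 * y ^ 4))"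
      using xy by (simp add: field_simps eval_nat_numeral)
    moreover have "2 * (\<beta>' * p * p) * ((b / y) ^ 4 + 3 * q ^ 2 * b ^ 3 * (- (b * y)))
      = p ^ 2 * b ^ 4 * (2 * \<beta>' * (1 / y ^ 4 - 3 * q ^ 2 * y))"
      using xy by (simp add: field_simps eval_nat_numeral)
    ultimately show ?thesis by (simp only: distrib_left)
  qed
  also have "\<dots> = 5 * b ^ 4 * (p * p * (\<alpha>' * \<beta>' + q)) ^ 2 / p ^ 2"
    unfolding key using pnz by (simp add: field_simps eval_nat_numeral)
  also have "p * p * (\<alpha>' * \<beta>' + q) = F psi ^ 2"
    using arg_cong[OF psi2, of F] by (simp add: F_hom F\<alpha> F\<beta> e_def[symmetric] algebra_simps power2_eq_square)
  finally have "L * N * b = 5 * b ^ 5 * F psi ^ 4 / p ^ 2" by (simp add: eval_nat_numeral)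
  moreover have "N * b = F (E 2) ^ 6"
    using arg_cong[OF norm, of F] unfolding N_def e_def by (simp only: F_mult fps_to_fls_power)
  ultimately have "L * F (E 2) ^ 6 = 5 * b ^ 5 * F psi ^ 4 / p ^ 2" by (simp add: mult.assoc)
  also have "\<dots> = 5 * b * e ^ 2 * F psi ^ 4" unfolding p using nz by (simp add: field_simps eval_nat_numeral)
  finally have "F (sect 4 H * E 2 ^ 6) = F (5 * E 10 * E 5 ^ 2 * psi ^ 4)"
    by (simp add: L_def e_def F_hom)
  hence eq: "sect 4 H * E 2 ^ 6 = 5 * E 10 * E 5 ^ 2 * psi ^ 4" by simp
  \<comment> \<open>It remains to replace \<open>\<psi>\<close> by Euler products.\<close>
  have "psi ^ 4 * E 1 ^ 4 = E 2 ^ 8"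
    using arg_cong[OF psi_E1, of "\<lambda>x. x ^ 4"] by (simp add: power_mult_distrib flip: power_mult)
  hence "sect 4 H * E 1 ^ 4 * E 2 ^ 6 = 5 * E 2 ^ 2 * E 5 ^ 2 * E 10 * E 2 ^ 6"
    using eq by (simp add: eval_nat_numeral mult_ac)
  thus ?thesis by simp
qed

section \<open>The numbers $p_\nu(50n+8)$\<close>

text \<open>
  Let \<open>g = 1/\<phi>\<close>. Multiplied by the norm of \<open>\<phi>\<close>, it is the product of the nontrivial conjugates of \<open>\<phi>\<close>,
  whose components are polynomials in those of \<open>\<phi>\<close>. The component of index 0 of \<open>g\<^sup>2\<close> is symmetric
  under the exchange of \<open>q u\<close> and \<open>q\<^sup>4 v\<close>, so it depends only on \<open>p\<close>, on \<open>w = q u v\<close> and on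
  \<open>S = q u\<^sup>5 + q\<^sup>4 v\<^sup>5\<close>. Now \<open>w\<close> is \<open>\<phi>\<^sup>2 - p\<^sup>2\<close>, and \<open>S\<close> is known from the norm \<open>\<phi>\<^sup>6/p\<close>.
\<close>

lemma sect_0_inverse_square:
  assumes h: "h * phi ^ 2 = 1"
  defines "p \<equiv> phi oo fps_X ^ 5"
  shows "sect 0 h * (phi ^ 2) ^ 6 = p ^ 2 * ((phi ^ 2) ^ 4
     + 10 * (phi ^ 2) ^ 2 * (5 * p ^ 2 - phi ^ 2) * (p ^ 2 - phi ^ 2) + 125 * p ^ 4 * (p ^ 2 - phi ^ 2) ^ 2)"
proof -
  define u v where "u = sect 1 phi" and "v = sect 4 phi"
  define w where "w = fps_X * u * v"
  define S where "S = fps_X * u ^ 5 + fps_X ^ 4 * v ^ 5"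
  define M where "M = p ^ 5 + fps_X * u ^ 5 + fps_X ^ 4 * v ^ 5 - 5 * fps_X * p ^ 3 * u * v
           + 5 * fps_X ^ 2 * p * u ^ 2 * v ^ 2"
  have Mp: "M * p = phi ^ 6"
    unfolding M_def p_def u_def v_def by (rule phi_sections_norm)
  have t: "phi ^ 2 = p ^ 2 + w"
    using phi_square_dissect by (simp add: p_def u_def v_def w_def mult.assoc)
  define g where "g = h * phi"
  have g1: "g * phi = 1" using h by (simp add: g_def power2_eq_square mult.assoc)
  have gg: "g * g = h"
  proof -
    have "g * g = h * (h * phi ^ 2)" by (simp add: g_def power2_eq_square mult_ac)
    thus ?thesis using h by simp
  qed
  \<comment> \<open>The components of the product of the nontrivial conjugates of \<open>\<phi>\<close>.\<close>
  define K where "K = (\<lambda>i::nat. [p ^ 4 - 3 * fps_X * p ^ 2 * u * v + fps_X ^ 2 * u ^ 2 * v ^ 2,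
     - (p ^ 3) * u + 2 * fps_X * p * u ^ 2 * v + fps_X ^ 3 * v ^ 4,
     p ^ 2 * u ^ 2 - fps_X * u ^ 3 * v - fps_X ^ 2 * p * v ^ 3,
     fps_X * p ^ 2 * v ^ 2 - fps_X ^ 2 * u * v ^ 3 - p * u ^ 3,
     - (p ^ 3) * v + 2 * fps_X * p * u * v ^ 2 + u ^ 4] ! i)"
  define Q where "Q = (\<Sum>i<5. fps_X ^ i * (K i oo fps_X ^ 5))"
  have phi: "phi = (p oo fps_X ^ 5) + fps_X * (u oo fps_X ^ 5) + fps_X ^ 4 * (v oo fps_X ^ 5)"
    by (subst fps_eq_sects) (simp add: sum_lt_5 phi_sections p_def u_def v_def)
  have "phi * Q = M oo fps_X ^ 5"
    unfolding phi Q_def sum_lt_5 K_def M_def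
    by (simp add: eval_nat_numeral fps_compose_add_distrib fps_compose_sub_distrib fps_compose_mult_distrib fps_compose_uminus
        algebra_simps)
  hence "g * (M oo fps_X ^ 5) = (g * phi) * Q" by (simp only: mult.assoc)
  hence gM: "g * (M oo fps_X ^ 5) = Q" by (simp add: g1)
  have gK: "sect i g * M = K i" if "i < 5" for i
  proof -
    have "sect i g * M = sect i Q" using gM sect_mult_compose[OF that, of g M] by simp
    also have "\<dots> = (\<Sum>j<5. if j = i then K j else 0)"
      unfolding Q_def sect_sum using that by (intro sum.cong refl) (auto simp: sect_X_power_compose)
    also have "\<dots> = K i" using that by simp
    finally show ?thesis .
  qed
  have K: "sect 0 g * M = p ^ 4 - 3 * p ^ 2 * w + w ^ 2"
    "sect 1 g * M = (2 * p * w - p ^ 3) * u + fps_X ^ 3 * v ^ 4"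
    "sect 2 g * M = (p ^ 2 - w) * u ^ 2 - fps_X ^ 2 * p * v ^ 3"
    "sect 3 g * M = (p ^ 2 - w) * fps_X * v ^ 2 - p * u ^ 3"
    "sect 4 g * M = (2 * p * w - p ^ 3) * v + u ^ 4"
    using gK[of 0] gK[of 1] gK[of 2] gK[of 3] gK[of 4]
    by (simp_all add: K_def w_def eval_nat_numeral algebra_simps)
  have "sect 0 h * M ^ 2 = (sect 0 g * M) ^ 2 + 2 * (fps_X * (sect 1 g * M) * (sect 4 g * M)
          + fps_X * (sect 2 g * M) * (sect 3 g * M))"
    unfolding gg[symmetric] sect_mult_0 by (simp add: algebra_simps power2_eq_square)
  also have "\<dots> = (p ^ 4 - 3 * p ^ 2 * w + w ^ 2) ^ 2
       + 2 * (w * (2 * p * w - p ^ 3) ^ 2 + w ^ 4 + w ^ 2 * (p ^ 2 - w) ^ 2 + p ^ 2 * w ^ 3)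
       + 2 * (3 * w - 2 * p ^ 2) * (p * S)"
  proof -
    have 1: "fps_X * ((2 * p * w - p ^ 3) * u + fps_X ^ 3 * v ^ 4) * ((2 * p * w - p ^ 3) * v + u ^ 4)
      = (2 * p * w - p ^ 3) ^ 2 * w + (2 * p * w - p ^ 3) * S + w ^ 4"
      unfolding S_def w_def by (simp add: algebra_simps eval_nat_numeral)
    have 2: "fps_X * ((p ^ 2 - w) * u ^ 2 - fps_X ^ 2 * p * v ^ 3) * ((p ^ 2 - w) * fps_X * v ^ 2 - p * u ^ 3)
      = (p ^ 2 - w) ^ 2 * w ^ 2 - (p ^ 2 - w) * p * S + p ^ 2 * w ^ 3"
      unfolding S_def w_def by (simp add: algebra_simps eval_nat_numeral)
    show ?thesis unfolding K 1 2 by (simp add: algebra_simps eval_nat_numeral)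
  qed
  also have "p * S = phi ^ 6 - p ^ 6 + 5 * p ^ 4 * w - 5 * p ^ 2 * w ^ 2"
    unfolding Mp[symmetric] M_def S_def w_def by (simp add: algebra_simps eval_nat_numeral)
  also have "phi ^ 6 = (p ^ 2 + w) ^ 3" unfolding t[symmetric] by (simp flip: power_mult)
  also have "(p ^ 4 - 3 * p ^ 2 * w + w ^ 2) ^ 2
       + 2 * (w * (2 * p * w - p ^ 3) ^ 2 + w ^ 4 + w ^ 2 * (p ^ 2 - w) ^ 2 + p ^ 2 * w ^ 3)
       + 2 * (3 * w - 2 * p ^ 2) * ((p ^ 2 + w) ^ 3 - p ^ 6 + 5 * p ^ 4 * w - 5 * p ^ 2 * w ^ 2)
      = (p ^ 2 + w) ^ 4 + 10 * (p ^ 2 + w) ^ 2 * (5 * p ^ 2 - (p ^ 2 + w)) * (p ^ 2 - (p ^ 2 + w)) + 125 * p ^ 4 * (p ^ 2 - (p ^ 2 + w)) ^ 2"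
    by (simp add: algebra_simps eval_nat_numeral)
  finally have "sect 0 h * M ^ 2 = \<dots>" .
  hence "p ^ 2 * (sect 0 h * M ^ 2) = p ^ 2 * ((phi ^ 2) ^ 4
     + 10 * (phi ^ 2) ^ 2 * (5 * p ^ 2 - phi ^ 2) * (p ^ 2 - phi ^ 2) + 125 * p ^ 4 * (p ^ 2 - phi ^ 2) ^ 2)"
    unfolding t[symmetric] by simp
  moreover have "p ^ 2 * (sect 0 h * M ^ 2) = sect 0 h * (M * p) ^ 2" by (simp only: power_mult_distrib mult_ac)
  ultimately show ?thesis unfolding Mp by (simp flip: power_mult)
qed

lemma phi_square_diff: "((phi oo fps_X ^ 5) ^ 2 - phi ^ 2) * (E 5 * E 2) = 4 * fps_X * E 10 ^ 3 * E 1"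
proof -
  have "(phi oo fps_X ^ 5) ^ 2 - phi ^ 2 = 4 * fps_X * (theta 10 3 (-1) * theta 10 1 (-1))"
    unfolding phi_square_dissect phi_sections(2,5) by (simp add: algebra_simps)
  thus ?thesis using theta_10_prod by (simp add: mult.assoc)
qed

text \<open>
  The identity \<open>\<psi>\<^sup>2 - q \<psi>(q\<^sup>5)\<^sup>2 = E\<^sub>2 E\<^sub>5\<^sup>3/(E\<^sub>1 E\<^sub>1\<^sub>0)\<close>, cleared of denominators.
\<close>

lemma psi_square_E: "E 2 ^ 4 * E 10 * E 5 ^ 2 = E 5 ^ 5 * E 2 * E 1 + fps_X * E 10 ^ 5 * E 1 ^ 2"
proof -
  have "psi ^ 2 = theta 5 2 1 * theta 5 1 1 + fps_X * (psi oo fps_X ^ 5) ^ 2"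
    unfolding psi_square_dissect[unfolded psi_sections(1,2)] by simp
  hence "psi ^ 2 * (E 1 ^ 2 * E 10 * E 5 ^ 2) = (theta 5 2 1 * theta 5 1 1 * (E 10 * E 1)) * (E 1 * E 5 ^ 2)
      + fps_X * ((psi oo fps_X ^ 5) * E 5) ^ 2 * (E 1 ^ 2 * E 10)"
    by (simp add: algebra_simps power2_eq_square)
  moreover have "psi ^ 2 * (E 1 ^ 2 * E 10 * E 5 ^ 2) = (psi * E 1) ^ 2 * (E 10 * E 5 ^ 2)"
    by (simp only: power_mult_distrib mult_ac)
  ultimately show ?thesis
    unfolding theta_5_prod psi_X5_E5 psi_E1 by (simp add: eval_nat_numeral algebra_simps)
qed

theorem theorem1p1:
  shows "Abs_fps (\<lambda>n. p_nu (50 * n + 8)) =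
    5 * (E 2 ^ 5 * E 5 ^ 4 / (E 1 ^ 6 * E 10 ^ 2)
         + 160 * fps_X * (E 2 ^ 11 * E 5 ^ 4 / E 1 ^ 14)
         + 2000 * fps_X ^ 2 * (E 2 ^ 11 * E 5 ^ 10 / E 1 ^ 20))"
proof -
  define H where "H = Abs_fps (\<lambda>n. p_nu (2 * n))"
  define h where "h = E 2 ^ 2 / E 1 ^ 4"
  define p where "p = phi oo fps_X ^ 5"
  have H: "sect 4 H * E 1 ^ 4 = 5 * E 2 ^ 2 * E 5 ^ 2 * E 10"
    by (rule sect_4_even_part) (simp only: H_def even_part_nu_minus)
  have hE: "h * E 1 ^ 4 = E 2 ^ 2" unfolding h_def by (intro dvd_div_mult_self) simp
  have "h * phi ^ 2 * (E 2 ^ 2 * E 1 ^ 4) = (h * E 1 ^ 4) * (phi * E 2) ^ 2"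
    by (simp only: power_mult_distrib mult_ac)
  also have "\<dots> = 1 * (E 2 ^ 2 * E 1 ^ 4)" unfolding hE phi_E2 by (simp flip: power_mult)
  finally have h: "h * phi ^ 2 = 1" by simp
  have "sect 4 H * E 1 ^ 4 = h * (5 * (E 5 ^ 2 * E 10)) * E 1 ^ 4"
    unfolding H using hE by (simp add: mult_ac)
  hence "sect 4 H = h * (5 * (E 5 ^ 2 * E 10))" by simp
  also have "5 * (E 5 ^ 2 * E 10) = (5 * (E 1 ^ 2 * E 2)) oo fps_X ^ 5"
    by (simp add: fps_compose_mult_distrib fps_compose_power[symmetric] E_compose_X_power)
  finally have s: "sect 0 (sect 4 H) = sect 0 h * (5 * (E 1 ^ 2 * E 2))"
    by (simp add: sect_mult_compose)
  have lhs: "Abs_fps (\<lambda>n. p_nu (50 * n + 8)) = sect 0 (sect 4 H)"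
    by (rule fps_ext) (simp add: H_def algebra_simps)

  define e1 e2 e5 e10 where e: "e1 = F (E 1)" "e2 = F (E 2)" "e5 = F (E 5)" "e10 = F (E 10)"
  have nz: "e1 \<noteq> 0" "e2 \<noteq> 0" "e5 \<noteq> 0" "e10 \<noteq> 0" by (simp_all add: e)
  define q where "q = (fls_X :: complex fls)"
  define P t where "P = F p" and "t = F phi ^ 2"
  have P: "P = e5 ^ 2 / e10"
    using arg_cong[OF phi_X5_E10, of F] nz by (simp add: F_hom e P_def p_def field_simps)
  have t: "t = e1 ^ 4 / e2 ^ 2"
  proof -
    have "F phi * e2 = e1 ^ 2" using arg_cong[OF phi_E2, of F] by (simp add: F_hom e)
    hence "F phi = e1 ^ 2 / e2" using nz by (simp add: field_simps)
    thus ?thesis unfolding t_def by (simp add: power_divide flip: power_mult)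
  qed
  have d1: "P ^ 2 - t = 4 * q * e10 ^ 3 * e1 / (e5 * e2)"
    using arg_cong[OF phi_square_diff, of F] nz
    by (simp add: F_hom e P_def p_def t_def q_def field_simps)
  have R: "e2 ^ 4 * e10 * e5 ^ 2 = e5 ^ 5 * e2 * e1 + q * e10 ^ 5 * e1 ^ 2"
    using arg_cong[OF psi_square_E, of F] by (simp add: F_hom e q_def)
  have d5: "5 * P ^ 2 - t = 4 * e2 ^ 3 * e5 / (e1 * e10)"
  proof -
    have "5 * P ^ 2 - t = 4 * P ^ 2 + (P ^ 2 - t)" by simp
    also have "\<dots> = 4 * (e5 ^ 5 * e2 * e1 + q * e10 ^ 5 * e1 ^ 2) / (e5 * e2 * e1 * e10 ^ 2)"
      unfolding d1 unfolding P using nz by (simp add: field_simps eval_nat_numeral)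
    also have "\<dots> = 4 * e2 ^ 3 * e5 / (e1 * e10)"
      unfolding R[symmetric] using nz by (simp add: field_simps eval_nat_numeral)
    finally show ?thesis .
  qed
  have tnz: "t \<noteq> 0" using nz by (simp add: t)
  have "F (sect 0 h) * t ^ 6 = P ^ 2 * (t ^ 4 + 10 * t ^ 2 * (5 * P ^ 2 - t) * (P ^ 2 - t) + 125 * P ^ 4 * (P ^ 2 - t) ^ 2)"
    using arg_cong[OF sect_0_inverse_square[OF h], of F]
    by (simp only: F_hom P_def p_def t_def)
  hence F0: "F (sect 0 h) = P ^ 2 * (t ^ 4 + 10 * t ^ 2 * (5 * P ^ 2 - t) * (P ^ 2 - t) + 125 * P ^ 4 * (P ^ 2 - t) ^ 2) / t ^ 6"
    using tnz by (simp add: field_simps)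
  have "F (sect 0 (sect 4 H)) = 5 * (e1 ^ 2 * e2 * P ^ 2 / t ^ 2 + 10 * e1 ^ 2 * e2 * P ^ 2 * ((5 * P ^ 2 - t) * (P ^ 2 - t)) / t ^ 4
      + 125 * e1 ^ 2 * e2 * P ^ 6 * (P ^ 2 - t) ^ 2 / t ^ 6)"
    unfolding s F_hom F0 e[symmetric] using tnz by (simp add: field_simps eval_nat_numeral)
  also have "e1 ^ 2 * e2 * P ^ 2 / t ^ 2 = e2 ^ 5 * e5 ^ 4 / (e1 ^ 6 * e10 ^ 2)"
    unfolding P t using nz by (simp add: field_simps eval_nat_numeral)
  also have "10 * e1 ^ 2 * e2 * P ^ 2 * ((5 * P ^ 2 - t) * (P ^ 2 - t)) / t ^ 4 = 160 * q * (e2 ^ 11 * e5 ^ 4 / e1 ^ 14)"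
    unfolding d1 d5 unfolding P t using nz by (simp add: field_simps eval_nat_numeral)
  also have "125 * e1 ^ 2 * e2 * P ^ 6 * (P ^ 2 - t) ^ 2 / t ^ 6 = 2000 * q ^ 2 * (e2 ^ 11 * e5 ^ 10 / e1 ^ 20)"
    unfolding d1 unfolding P t using nz by (simp add: field_simps eval_nat_numeral)
  also have "5 * (e2 ^ 5 * e5 ^ 4 / (e1 ^ 6 * e10 ^ 2) + 160 * q * (e2 ^ 11 * e5 ^ 4 / e1 ^ 14) + 2000 * q ^ 2 * (e2 ^ 11 * e5 ^ 10 / e1 ^ 20))
     = F (5 * (E 2 ^ 5 * E 5 ^ 4 / (E 1 ^ 6 * E 10 ^ 2)
         + 160 * fps_X * (E 2 ^ 11 * E 5 ^ 4 / E 1 ^ 14)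
         + 2000 * fps_X ^ 2 * (E 2 ^ 11 * E 5 ^ 10 / E 1 ^ 20)))"
    by (simp add: F_hom F_divide e q_def)
  finally show ?thesis unfolding lhs by (simp only: fps_to_fls_eq_iff)
qed

end
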